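(* Let $r \geq 2$ and $c \geq 2$ be integers. There exist symmetric polynomials $f_{r,k} \in \mathbb{Z}[x_1,\ldots,x_r]^{\mathrm{Sym}(r)}$ (with $1 \leq k \leq c$) such that, for any endomorphism $\varphi \in \mathrm{End}(N_{r,c})$, $$R(\varphi) = \left|\prod_{k=1}^{c} f_{r,k}(\lambda_1,\ldots,\lambda_r)\right|_{\infty},$$ where $\lambda_1,\ldots,\lambda_r \in \mathbb{C}$ are the eigenvalues, listed with multiplicity, of the endomorphism $\varphi_1$ induced by $\varphi$ on $N_{r,c}/\gamma_2(N_{r,c})$.
   Context: For a group $G$, put $\gamma_1(G) := G$ and $\gamma_{i+1}(G) := [\gamma_i(G), G]$. Let $F(r)$ be the free group of rank $r$; the free $c$-step nilpotent group of rank $r$ is $N_{r,c} := F(r)/\gamma_{c+1}(F(r))$. The quotient $N_{r,c}/\gamma_2(N_{r,c})$ is free abelian of rank $r$, so an endomorphism of it is given by an integer $r\times r$ matrix and has $r$ complex eigenvalues counted with multiplicity. For a group $G$ and $\varphi \in \mathrm{End}(G)$, elements $x,y\in G$ are $\varphi$-conjugate if $x = z y \varphi(z)^{-1}$ for some $z \in G$; this is an equivalence relation, and the Reidemeister number $R(\varphi) \in \{1,2,\ldots\}\cup\{\infty\}$ is the number of equivalence classes ($\infty$ if there are infinitely many). For $n \in \mathbb{Z}$, $|n|_\infty := \infty$ if $n = 0$ and $|n|_\infty := |n|$ otherwise. $\mathbb{Z}[x_1,\ldots,x_r]^{\mathrm{Sym}(r)}$ is the ring of polynomials with integer coefficients that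 are invariant under all permutations of the variables. The value of such a polynomial at $(\lambda_1,\ldots,\lambda_r)$ above is an integer. *)

theory Defs
  imports
    "HOL-Algebra.Generated_Groups"
    "HOL-Algebra.Elementary_Groups"
    "HOL-Library.Poly_Mapping"
    "HOL-Library.Extended_Nat"
    "Jordan_Normal_Form.Char_Poly"
begin

section \<open>Free groups\<close>

text \<open>
  The letter \<open>(i, True)\<close> stands for the generator \<open>x\<^sub>i\<close> and \<open>(i, False)\<close> for its inverse. The
  elements of the free group are the reduced words; \<open>push a w\<close> is the reduced form of
  \<open>a # w\<close> when \<open>w\<close> is reduced, so that \<open>foldr push u v\<close> is the reduced form of \<open>u @ v\<close>.
\<close>

type_synonym letter = "nat \<times> bool"

definition inv_letter :: "letter \<Rightarrow> letter" where
  "inv_letter a = (fst a, \<not> snd a)"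

definition reduced :: "letter list \<Rightarrow> bool" where
  "reduced w \<longleftrightarrow> successively (\<lambda>a b. b \<noteq> inv_letter a) w"

fun push :: "letter \<Rightarrow> letter list \<Rightarrow> letter list" where
  "push a [] = [a]"
| "push a (b # w) = (if b = inv_letter a then w else a # b # w)"

definition free_group :: "nat \<Rightarrow> letter list monoid" where
  "free_group r =
     \<lparr> carrier = {w. fst ` set w \<subseteq> {..<r} \<and> reduced w},
       monoid.mult = (\<lambda>u v. foldr push u v),
       one = [] \<rparr>"

section \<open>Lower central series and free nilpotent groups\<close>

definition commutator_subgroup :: "('a, 'm) monoid_scheme \<Rightarrow> 'a set \<Rightarrow> 'a set \<Rightarrow> 'a set" where
  "commutator_subgroup G H K =
     generate G (\<Union>h\<in>H. \<Union>k\<in>K. {h \<otimes>\<^bsub>G\<^esub> k \<otimes>\<^bsub>G\<^esub> inv\<^bsub>G\<^esub> h \<otimes>\<^bsub>G\<^esub> inv\<^bsub>G\<^esub> k})"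

text \<open>The index starts at 1; the value at 0 is a dummy.\<close>

fun lower_central :: "('a, 'm) monoid_scheme \<Rightarrow> nat \<Rightarrow> 'a set" where
  "lower_central G 0 = carrier G"
| "lower_central G (Suc 0) = carrier G"
| "lower_central G (Suc (Suc i)) =
     commutator_subgroup G (lower_central G (Suc i)) (carrier G)"

definition free_nilpotent :: "nat \<Rightarrow> nat \<Rightarrow> letter list set monoid" where
  "free_nilpotent r c = free_group r Mod lower_central (free_group r) (c + 1)"

section \<open>Reidemeister numbers\<close>

definition twisted_conj :: "('a, 'm) monoid_scheme \<Rightarrow> ('a \<Rightarrow> 'a) \<Rightarrow> ('a \<times> 'a) set" where
  "twisted_conj G \<phi> = {(x, y). x \<in> carrier G \<and> y \<in> carrier G \<and>
     (\<exists>z\<in>carrier G. x = z \<otimes>\<^bsub>G\<^esub> y \<otimes>\<^bsub>G\<^esub> inv\<^bsub>G\<^esub> (\<phi> z))}"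

definition reidemeister_number :: "('a, 'm) monoid_scheme \<Rightarrow> ('a \<Rightarrow> 'a) \<Rightarrow> enat" where
  "reidemeister_number G \<phi> =
     (let C = carrier G // twisted_conj G \<phi> in if finite C then enat (card C) else \<infinity>)"

definition abs_inf :: "int \<Rightarrow> enat" where
  "abs_inf n = (if n = 0 then \<infinity> else enat (nat \<bar>n\<bar>))"

section \<open>Induced endomorphisms and their eigenvalues\<close>

text \<open>
  For a homomorphism \<open>\<phi>\<close> with \<open>\<phi> ` H \<subseteq> H\<close>, all the cosets in the union below coincide, so
  this is the map \<open>H #> x \<mapsto> H #> \<phi> x\<close>.
\<close>

definition induced_map :: "('a, 'm) monoid_scheme \<Rightarrow> 'a set \<Rightarrow> ('a \<Rightarrow> 'a) \<Rightarrow> 'a set \<Rightarrow> 'a set" where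
  "induced_map G H \<phi> X = (\<Union>x\<in>X. H #>\<^bsub>G\<^esub> \<phi> x)"

definition int_basis :: "('a, 'm) monoid_scheme \<Rightarrow> nat \<Rightarrow> (nat \<Rightarrow> 'a) \<Rightarrow> bool" where
  "int_basis A r b \<longleftrightarrow> b ` {..<r} \<subseteq> carrier A \<and>
     (\<forall>x\<in>carrier A. \<exists>!k. k \<in> {..<r} \<rightarrow>\<^sub>E (UNIV :: int set) \<and>
        x = (\<Otimes>\<^bsub>A\<^esub>i\<in>{..<r}. b i [^]\<^bsub>A\<^esub> k i))"

definition represents ::
  "('a, 'm) monoid_scheme \<Rightarrow> nat \<Rightarrow> (nat \<Rightarrow> 'a) \<Rightarrow> ('a \<Rightarrow> 'a) \<Rightarrow> int mat \<Rightarrow> bool" where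
  "represents A r b \<psi> M \<longleftrightarrow> M \<in> carrier_mat r r \<and>
     (\<forall>j<r. \<psi> (b j) = (\<Otimes>\<^bsub>A\<^esub>i\<in>{..<r}. b i [^]\<^bsub>A\<^esub> (M $$ (i, j))))"

text \<open>
  \<open>ev 0, \<dots>, ev (r - 1)\<close> are the eigenvalues of \<open>\<psi>\<close>, listed with (algebraic) multiplicity. Any two
  bases give conjugate matrices, so the choice of the basis is immaterial.
\<close>

definition has_eigenvalues ::
  "('a, 'm) monoid_scheme \<Rightarrow> nat \<Rightarrow> ('a \<Rightarrow> 'a) \<Rightarrow> (nat \<Rightarrow> complex) \<Rightarrow> bool" where
  "has_eigenvalues A r \<psi> ev \<longleftrightarrow>
     (\<exists>b M. int_basis A r b \<and> represents A r b \<psi> M \<and>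
        char_poly (map_mat complex_of_int M) = (\<Prod>i<r. [:- ev i, 1:]))"

section \<open>Symmetric polynomials\<close>

text \<open>
  A monomial is the finitely supported map of its exponents; the polynomials in
  \<open>\<int>[x\<^sub>0, \<dots>, x\<^sub>r\<^sub>-\<^sub>1]\<close> are those in which only the variables with index below \<open>r\<close> occur.
\<close>

type_synonym int_mpoly = "(nat \<Rightarrow>\<^sub>0 nat) \<Rightarrow>\<^sub>0 int"

definition mpolys :: "nat \<Rightarrow> int_mpoly set" where
  "mpolys r = {p. \<forall>m\<in>Poly_Mapping.keys p. Poly_Mapping.keys m \<subseteq> {..<r}}"

definition symmetric_mpolys :: "nat \<Rightarrow> int_mpoly set" where
  "symmetric_mpolys r = {p \<in> mpolys r. \<forall>\<pi>. \<pi> permutes {..<r} \<longrightarrow>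
     (\<forall>m. Poly_Mapping.lookup p (Poly_Mapping.map_key \<pi> m) = Poly_Mapping.lookup p m)}"

definition mpoly_eval :: "(nat \<Rightarrow> 'a::comm_ring_1) \<Rightarrow> int_mpoly \<Rightarrow> 'a" where
  "mpoly_eval x p = (\<Sum>m\<in>Poly_Mapping.keys p. of_int (Poly_Mapping.lookup p m) *
     (\<Prod>i\<in>Poly_Mapping.keys m. x i ^ Poly_Mapping.lookup m i))"

end

theory Submission
  imports Defs "HOL-Library.List_Lexorder" "Jordan_Normal_Form.Schur_Decomposition"
begin

text \<open>
  The quotients \<open>\<gamma>\<^sub>k / \<gamma>\<^bsub>k+1\<^esub>\<close> of the free group embed, by the leading form of the Magnus expansion
  \<open>x\<^sub>i \<mapsto> 1 + X\<^sub>i\<close>, onto the degree \<open>k\<close> part of the free Lie ring inside the noncommutative power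
  series. An endomorphism acts there through the linear substitution given by the matrix of \<open>\<phi>\<^sub>1\<close>,
  and since the quotients are torsion free, the twisted conjugacy classes are counted layer by layer:
  \<open>R(\<phi>)\<close> is the product of the indices \<open>\<bar>det (1 - \<phi>\<^sub>k)\<bar>\<close>. Triangularizing the matrix over the complex
  numbers gives \<open>det (1 - \<phi>\<^sub>k) = \<Prod>\<^sub>t (1 - \<Prod>\<^bsub>a \<in> t\<^esub> \<lambda>\<^sub>a)\<close>, where \<open>t\<close> runs through a basis of bracketings
  of weight \<open>k\<close>.

  The basis comes from Lazard elimination: from a prefix-free set \<open>S\<close> of bracketed words split off
  the smallest one, \<open>b\<close>, and continue with all \<open>[b, [b, \<dots>, [b, s]]]\<close> with \<open>s \<in> S - {b}\<close>. The elements that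
  are split off span both the Lie ring and, as ordered products, the group modulo \<open>\<gamma>\<^bsub>c+1\<^esub>\<close>; they are
  independent because the smallest word of each one is its unbracketed word.
\<close>

section \<open>Noncommutative power series\<close>

text \<open>Twisted conjugacy classes do not multiply along a central series in general: an element
  that fixes a class of the quotient can merge classes in the next layer. Such an element has a
  nonzero leading form fixed by the induced map on an earlier layer. As long as the determinants are
  nonzero there is no such form; once one of them vanishes, its layer has infinitely many classes
  and both sides of the formula are infinite from there on.

  All counting takes place in the free group, with relations modulo \<open>\<gamma>_{k+1}\<close>:
  an endomorphism of the nilpotent quotient lifts to the free group, where leading forms are actual
  series and no cosets have to be carried along.

  The coefficient ring is left arbitrary because three rings occur: the integers for the group, the
  complex numbers for the triangular form, and the integer polynomials for the symmetry of
  \<open>f_{r,k}\<close>, which the product over trees does not show. Series instead of polynomials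
  are needed so that \<open>1 + X_i\<close> has an inverse.\<close>

typedef 'a ncs = "UNIV :: (nat list \<Rightarrow> 'a) set"
  morphisms coef Ncs by simp

lemma coef_Ncs [simp]: "coef (Ncs f) = f"
  by (simp add: Ncs_inverse)

lemma ncs_eqI: "(\<And>w. coef f w = coef g w) \<Longrightarrow> f = g"
  by (metis coef_inject ext)

text \<open>The Cauchy product over all cuts \<open>w = u @ v\<close>, organised by the first letter
  of \<open>w\<close>: either \<open>u\<close> is empty, or that letter is absorbed into
  \<open>f\<close>. The ring laws then become inductions on the word instead of manipulations of
  double sums.\<close>

fun conv :: "(nat list \<Rightarrow> 'a::comm_ring_1) \<Rightarrow> (nat list \<Rightarrow> 'a) \<Rightarrow> nat list \<Rightarrow> 'a" where
  "conv f g [] = f [] * g []"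
| "conv f g (a # w) = f [] * g (a # w) + conv (\<lambda>v. f (a # v)) g w"

lemma conv_add_left: "conv (\<lambda>v. f v + g v) h w = conv f h w + conv g h w"
  by (induction w arbitrary: f g) (auto simp: algebra_simps)

lemma conv_add_right: "conv h (\<lambda>v. f v + g v) w = conv h f w + conv h g w"
  by (induction w arbitrary: h) (auto simp: algebra_simps)

lemma conv_scale_left: "conv (\<lambda>v. a * f v) h w = a * conv f h w"
  by (induction w arbitrary: f) (auto simp: algebra_simps)

lemma conv_scale_right: "conv h (\<lambda>v. a * f v) w = a * conv h f w"
  by (induction w arbitrary: h) (auto simp: algebra_simps)

lemma conv_zero_left: "conv (\<lambda>v. 0) h w = 0"
  by (induction w) auto

lemma conv_assoc: "conv (conv f g) h w = conv f (conv g h) w"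
proof (induction w arbitrary: f)
  case (Cons a w)
  then show ?case
    by (simp add: conv_add_left conv_scale_left algebra_simps)
qed (simp add: algebra_simps)

lemma conv_one_left: "conv (\<lambda>w. if w = [] then 1 else 0) g w = g w"
  by (cases w) (simp_all add: conv_zero_left)

lemma conv_one_right: "conv f (\<lambda>w. if w = [] then 1 else 0) w = f w"
  by (induction w arbitrary: f) auto

lemma conv_eq_0:
  "(\<And>u v. u @ v = w \<Longrightarrow> f u = 0 \<or> g v = 0) \<Longrightarrow> conv f g w = 0"
proof (induction w arbitrary: f)
  case (Cons a w)
  have "conv (\<lambda>v. f (a # v)) g w = 0"
    by (rule Cons.IH) (use Cons.prems in \<open>metis append_Cons\<close>)
  moreover have "f [] * g (a # w) = 0"
    using Cons.prems[of "[]" "a # w"] by auto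
  ultimately show ?case by simp
qed auto

text \<open>With homogeneous factors the degree dictates the cut, so that a single summand of the
  Cauchy product survives.\<close>

lemma conv_single:
  "(\<And>u v. u @ v = p @ q \<Longrightarrow> u \<noteq> p \<Longrightarrow> f u = 0 \<or> g v = 0) \<Longrightarrow> conv f g (p @ q) = f p * g q"
proof (induction p arbitrary: f)
  case Nil
  show ?case
  proof (cases q)
    case (Cons a q')
    have "conv (\<lambda>v. f (a # v)) g q' = 0"
      by (rule conv_eq_0) (use Nil Cons in auto)
    then show ?thesis using Cons by simp
  qed simp
next
  case (Cons a p)
  have "conv (\<lambda>v. f (a # v)) g (p @ q) = f (a # p) * g q"
    by (rule Cons.IH) (use Cons.prems in \<open>metis append_Cons list.inject\<close>)
  moreover have "f [] * g (a # p @ q) = 0"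
    using Cons.prems[of "[]" "a # p @ q"] by auto
  ultimately show ?case by simp
qed

instantiation ncs :: (comm_ring_1) ring_1
begin
definition "0 = Ncs (\<lambda>_. 0)"
definition "1 = Ncs (\<lambda>w. if w = [] then 1 else 0)"
definition "f + g = Ncs (\<lambda>w. coef f w + coef g w)"
definition "f - g = Ncs (\<lambda>w. coef f w - coef g w)"
definition "- f = Ncs (\<lambda>w. - coef f w)"
definition "f * g = Ncs (conv (coef f) (coef g))"
instance
proof
  show "a * b * c = a * (b * c)" for a b c :: "'a ncs"
    by (rule ncs_eqI) (simp add: times_ncs_def conv_assoc)
  show "1 * a = a" for a :: "'a ncs"
    by (rule ncs_eqI) (simp add: times_ncs_def one_ncs_def conv_one_left)
  show "a * 1 = a" for a :: "'a ncs"
    by (rule ncs_eqI) (simp add: times_ncs_def one_ncs_def conv_one_right)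
  show "(a + b) * c = a * c + b * c" for a b c :: "'a ncs"
    by (rule ncs_eqI) (simp add: times_ncs_def plus_ncs_def conv_add_left)
  show "a * (b + c) = a * b + a * c" for a b c :: "'a ncs"
    by (rule ncs_eqI) (simp add: times_ncs_def plus_ncs_def conv_add_right)
  have "coef (0 :: 'a ncs) [] \<noteq> coef 1 []"
    by (simp add: zero_ncs_def one_ncs_def)
  then show "(0 :: 'a ncs) \<noteq> 1" by metis
qed (rule ncs_eqI; simp add: plus_ncs_def zero_ncs_def minus_ncs_def uminus_ncs_def algebra_simps)+
end

lemma coef_0 [simp]: "coef 0 w = 0"
  and coef_1: "coef 1 w = (if w = [] then 1 else 0)"
  and coef_add [simp]: "coef (f + g) w = coef f w + coef g w"
  and coef_diff [simp]: "coef (f - g) w = coef f w - coef g w"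
  and coef_uminus [simp]: "coef (- f) w = - coef f w"
  and coef_mult: "coef (f * g) w = conv (coef f) (coef g) w"
  by (simp_all add: zero_ncs_def one_ncs_def plus_ncs_def minus_ncs_def uminus_ncs_def times_ncs_def)

lemma coef_sum [simp]: "coef (sum f A) w = (\<Sum>x\<in>A. coef (f x) w)"
  by (induction A rule: infinite_finite_induct) auto

section \<open>Scalars, order and homogeneous parts of series\<close>

definition scale :: "'a::comm_ring_1 \<Rightarrow> 'a ncs \<Rightarrow> 'a ncs" where
  "scale a f = Ncs (\<lambda>w. a * coef f w)"

lemma coef_scale [simp]: "coef (scale a f) w = a * coef f w"
  by (simp add: scale_def)

lemma scale_mult_left: "scale a f * g = scale a (f * g)"
  by (rule ncs_eqI) (simp add: coef_mult conv_scale_left scale_def)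

lemma scale_mult_right: "g * scale a f = scale a (g * f)"
  by (rule ncs_eqI) (simp add: coef_mult conv_scale_right scale_def)

lemma scale_add_right: "scale a (f + g) = scale a f + scale a g"
  and scale_diff_right: "scale a (f - g) = scale a f - scale a g"
  and scale_add_left: "scale (a + b) f = scale a f + scale b f"
  and scale_diff_left: "scale (a - b) f = scale a f - scale b f"
  and scale_scale: "scale a (scale b f) = scale (a * b) f"
  and scale_0_right [simp]: "scale a 0 = 0"
  and scale_0_left [simp]: "scale 0 f = 0"
  and scale_1 [simp]: "scale 1 f = f"
  by (rule ncs_eqI; simp add: algebra_simps)+

lemma scale_sum_right: "scale a (sum f A) = (\<Sum>x\<in>A. scale a (f x))"
  by (induction A rule: infinite_finite_induct) (auto simp: scale_add_right)

lemma scale_sum_left: "scale (sum f A) x = (\<Sum>y\<in>A. scale (f y) x)"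
  by (induction A rule: infinite_finite_induct) (auto simp: scale_add_left)

definition letter_series :: "nat \<Rightarrow> 'a::comm_ring_1 ncs" where
  "letter_series i = Ncs (\<lambda>w. if w = [i] then 1 else 0)"

definition order_ge :: "nat \<Rightarrow> 'a::comm_ring_1 ncs \<Rightarrow> bool" where
  "order_ge k f \<longleftrightarrow> (\<forall>w. length w < k \<longrightarrow> coef f w = 0)"

definition hom_part :: "nat \<Rightarrow> 'a::comm_ring_1 ncs \<Rightarrow> 'a ncs" where
  "hom_part k f = Ncs (\<lambda>w. if length w = k then coef f w else 0)"

lemma coef_hom_part: "coef (hom_part k f) w = (if length w = k then coef f w else 0)"
  by (simp add: hom_part_def)

lemma hom_part_add: "hom_part k (f + g) = hom_part k f + hom_part k g"
  and hom_part_diff: "hom_part k (f - g) = hom_part k f - hom_part k g"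
  and hom_part_0 [simp]: "hom_part k 0 = 0"
  by (rule ncs_eqI; simp add: coef_hom_part)+

lemma hom_part_scale: "hom_part k (scale a f) = scale a (hom_part k f)"
  by (rule ncs_eqI) (simp add: coef_hom_part)

lemma hom_part_sum: "hom_part k (sum f A) = (\<Sum>x\<in>A. hom_part k (f x))"
  by (induction A rule: infinite_finite_induct) (auto simp: hom_part_add)

lemma order_ge_add: "order_ge k f \<Longrightarrow> order_ge k g \<Longrightarrow> order_ge k (f + g)"
  and order_ge_diff: "order_ge k f \<Longrightarrow> order_ge k g \<Longrightarrow> order_ge k (f - g)"
  and order_ge_0 [simp]: "order_ge k 0"
  and order_ge_mono: "order_ge k f \<Longrightarrow> j \<le> k \<Longrightarrow> order_ge j f"
  by (auto simp: order_ge_def)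

lemma order_ge_scale: "order_ge k f \<Longrightarrow> order_ge k (scale a f)"
  by (auto simp: order_ge_def)

lemma order_ge_zero_index [simp]: "order_ge 0 f"
  by (simp add: order_ge_def)

lemma order_ge_mult:
  assumes "order_ge i f" "order_ge j g"
  shows "order_ge (i + j) (f * g)"
  unfolding order_ge_def coef_mult
proof (intro allI impI conv_eq_0)
  fix w u v :: "nat list"
  assume "length w < i + j" "u @ v = w"
  then have "length u < i \<or> length v < j" by auto
  then show "coef f u = 0 \<or> coef g v = 0"
    using assms by (auto simp: order_ge_def)
qed

lemma order_ge_Suc: "order_ge k f \<Longrightarrow> hom_part k f = 0 \<Longrightarrow> order_ge (Suc k) f"
  unfolding order_ge_def by (metis coef_0 coef_hom_part less_Suc_eq)

lemma hom_part_eq_0: "order_ge (Suc k) f \<Longrightarrow> hom_part k f = 0"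
  by (rule ncs_eqI) (auto simp: coef_hom_part order_ge_def)

text \<open>Below the orders of the factors nothing contributes, so a word of length
  \<open>i + j\<close> can only be cut after \<open>i\<close> letters. This makes leading forms
  multiplicative.\<close>

lemma hom_part_mult:
  assumes "order_ge i f" "order_ge j g"
  shows "hom_part (i + j) (f * g) = hom_part i f * hom_part j g"
proof (rule ncs_eqI)
  fix w
  show "coef (hom_part (i + j) (f * g)) w = coef (hom_part i f * hom_part j g) w"
  proof (cases "length w = i + j")
    case True
    define p q where "p = take i w" and "q = drop i w"
    have w: "w = p @ q" and len: "length p = i" "length q = j"
      using True by (auto simp: p_def q_def)
    have "conv (coef f) (coef g) (p @ q) = coef f p * coef g q"
    proof (rule conv_single)
      fix u v assume uv: "u @ v = p @ q" "u \<noteq> p"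
      have "length u \<noteq> length p" using uv by (metis append_eq_append_conv)
      moreover have "length u + length v = i + j"
        using uv(1) len by (metis length_append)
      ultimately have "length u < i \<or> length v < j" using len by linarith
      then show "coef f u = 0 \<or> coef g v = 0"
        using assms by (auto simp: order_ge_def)
    qed
    moreover have "conv (coef (hom_part i f)) (coef (hom_part j g)) (p @ q) =
        coef (hom_part i f) p * coef (hom_part j g) q"
    proof (rule conv_single)
      fix u v assume uv: "u @ v = p @ q" "u \<noteq> p"
      have "length u \<noteq> length p" using uv by (metis append_eq_append_conv)
      then show "coef (hom_part i f) u = 0 \<or> coef (hom_part j g) v = 0"
        using len by (simp add: coef_hom_part)
    qed
    ultimately show ?thesis
      using len by (simp add: w coef_hom_part coef_mult)
  next
    case False
    have "conv (coef (hom_part i f)) (coef (hom_part j g)) w = 0"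
      by (rule conv_eq_0) (use False in \<open>auto simp: coef_hom_part\<close>)
    then show ?thesis using False by (simp add: coef_hom_part coef_mult)
  qed
qed

lemma hom_part_hom_part: "hom_part j (hom_part k f) = (if j = k then hom_part k f else 0)"
  by (rule ncs_eqI) (simp add: coef_hom_part)

section \<open>Bracket trees and Lazard elimination\<close>

text \<open>Trees are kept, not just their words, because every tree is read in two ways: as an
  iterated Lie bracket (\<open>lie_poly\<close>) and as an iterated group commutator
  (\<open>tree_comm\<close>).\<close>

datatype btree = Leaf nat | Br btree btree

fun foliage :: "btree \<Rightarrow> nat list" where
  "foliage (Leaf i) = [i]"
| "foliage (Br s t) = foliage s @ foliage t"

fun lie_poly :: "btree \<Rightarrow> 'a::comm_ring_1 ncs" where
  "lie_poly (Leaf i) = letter_series i"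
| "lie_poly (Br s t) = lie_poly s * lie_poly t - lie_poly t * lie_poly s"

lemma foliage_nonempty [simp]: "foliage t \<noteq> []"
  by (induction t) auto

lemma foliage_power: "foliage ((Br b ^^ n) s) = concat (replicate n (foliage b)) @ foliage s"
  by (induction n) auto

text \<open>Bracketing only rearranges the leaves, so Lie polynomials are multihomogeneous. What is
  drawn from this later is the degree, the sum of the letters, and the product of diagonal entries
  along a word.\<close>

lemma lie_poly_support:
  "coef (lie_poly t :: 'a::comm_ring_1 ncs) w \<noteq> 0 \<Longrightarrow> mset w = mset (foliage t)"
proof (induction t arbitrary: w)
  case (Leaf i)
  then show ?case by (auto simp: letter_series_def split: if_splits)
next
  case (Br s t)
  have "conv (coef (lie_poly s :: 'a ncs)) (coef (lie_poly t)) w \<noteq> 0 \<or>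
        conv (coef (lie_poly t :: 'a ncs)) (coef (lie_poly s)) w \<noteq> 0"
    using Br.prems by (auto simp: coef_mult)
  then show ?case
  proof
    assume "conv (coef (lie_poly s :: 'a ncs)) (coef (lie_poly t)) w \<noteq> 0"
    then obtain u v where "u @ v = w" "coef (lie_poly s :: 'a ncs) u \<noteq> 0" "coef (lie_poly t :: 'a ncs) v \<noteq> 0"
      using conv_eq_0 by blast
    then show ?thesis using Br.IH by fastforce
  next
    assume "conv (coef (lie_poly t :: 'a ncs)) (coef (lie_poly s)) w \<noteq> 0"
    then obtain u v where "u @ v = w" "coef (lie_poly t :: 'a ncs) u \<noteq> 0" "coef (lie_poly s :: 'a ncs) v \<noteq> 0"
      using conv_eq_0 by blast
    then show ?thesis using Br.IH by fastforce
  qed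
qed

lemma lie_poly_length:
  "coef (lie_poly t :: 'a::comm_ring_1 ncs) w \<noteq> 0 \<Longrightarrow> length w = length (foliage t)"
  using lie_poly_support by (metis size_mset)

lemma hom_part_lie_poly:
  "hom_part k (lie_poly t) = (if k = length (foliage t) then lie_poly t else 0)"
  by (rule ncs_eqI) (use lie_poly_length in \<open>auto simp: coef_hom_part\<close>)

lemma order_ge_lie_poly: "k \<le> length (foliage t) \<Longrightarrow> order_ge k (lie_poly t)"
  using lie_poly_length by (fastforce simp: order_ge_def)

text \<open>Unlike \<open><\<close>, this order fails when \<open>u\<close> is a prefix of \<open>v\<close>, which makes it stable under appending.\<close>

fun sless :: "nat list \<Rightarrow> nat list \<Rightarrow> bool" where
  "sless (a # u) (b # v) \<longleftrightarrow> a < b \<or> a = b \<and> sless u v"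
| "sless _ _ \<longleftrightarrow> False"

lemma sless_less: "sless u v \<Longrightarrow> u < v"
  by (induction u v rule: sless.induct) auto

lemma sless_append: "sless u v \<Longrightarrow> sless (u @ x) (v @ y)"
  by (induction u v rule: sless.induct) auto

lemma sless_append_left [simp]: "sless (p @ u) (p @ v) \<longleftrightarrow> sless u v"
  by (induction p) auto

text \<open>The lexicographic order is not monotone in the left factor without equal lengths:
  \<open>[0] < [0, 0]\<close>, but \<open>[0, 1] > [0, 0, 1]\<close>. Homogeneity of Lie polynomials
  provides the equal lengths.\<close>

lemma append_mono_same_length:
  "length u = length u' \<Longrightarrow> (u :: nat list) \<le> u' \<Longrightarrow> v \<le> v' \<Longrightarrow> u @ v \<le> u' @ v'"
proof (induction u u' rule: list_induct2)
  case (Cons a u b u')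
  then show ?case by auto
qed auto

text \<open>The leading coefficient is required to be 1, so that independence holds over every
  commutative ring, zero divisors included. The type token is there because the coefficient ring
  does not occur in the tree.\<close>

definition lead :: "'a::comm_ring_1 itself \<Rightarrow> btree \<Rightarrow> bool" where
  "lead _ t \<longleftrightarrow> coef (lie_poly t :: 'a ncs) (foliage t) = 1 \<and>
     (\<forall>w. coef (lie_poly t :: 'a ncs) w \<noteq> 0 \<longrightarrow> foliage t \<le> w)"

lemma conv_lie_poly:
  assumes "length u = length (foliage s)"
  shows "conv (coef (lie_poly s :: 'a::comm_ring_1 ncs)) g (u @ v) = coef (lie_poly s) u * g v"
proof (rule conv_single)
  fix u' v' assume "u' @ v' = u @ v" "u' \<noteq> u"
  then have "length u' \<noteq> length u" by (metis append_eq_append_conv)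
  then show "coef (lie_poly s :: 'a ncs) u' = 0 \<or> g v' = 0"
    using lie_poly_length assms by metis
qed

lemma lead_product:
  assumes "lead TYPE('a::comm_ring_1) s" "lead TYPE('a) t" "coef (lie_poly s * lie_poly t :: 'a ncs) w \<noteq> 0"
  shows "foliage s @ foliage t \<le> w"
proof -
  obtain u v where uv: "u @ v = w" "coef (lie_poly s :: 'a ncs) u \<noteq> 0" "coef (lie_poly t :: 'a ncs) v \<noteq> 0"
    using conv_eq_0 assms(3) unfolding coef_mult by blast
  then have "length (foliage s) = length u" "foliage s \<le> u" "foliage t \<le> v"
    using lie_poly_length assms(1,2) by (metis, auto simp: lead_def)
  then show ?thesis using append_mono_same_length uv(1) by blast
qed

text \<open>The least words of the two products are \<open>foliage s @ foliage t\<close> and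
  \<open>foliage t @ foliage s\<close>; the smaller one cannot be cancelled. This is the mechanism
  behind Lyndon bases.\<close>

lemma lead_Br:
  assumes s: "lead TYPE('a::comm_ring_1) s" and t: "lead TYPE('a) t"
    and less: "foliage s @ foliage t < foliage t @ foliage s"
  shows "lead TYPE('a) (Br s t)"
proof -
  have "coef (lie_poly t * lie_poly s :: 'a ncs) (foliage s @ foliage t) = 0"
    using lead_product[OF t s] less by (metis leD)
  moreover have "coef (lie_poly s * lie_poly t :: 'a ncs) (foliage s @ foliage t) = 1"
    unfolding coef_mult using s t by (subst conv_lie_poly) (auto simp: lead_def)
  moreover have "foliage s @ foliage t \<le> w" if "coef (lie_poly (Br s t) :: 'a ncs) w \<noteq> 0" for w
  proof -
    have "coef (lie_poly s * lie_poly t :: 'a ncs) w \<noteq> 0 \<or> coef (lie_poly t * lie_poly s :: 'a ncs) w \<noteq> 0"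
      using that by auto
    then show ?thesis
      using lead_product[OF s t] lead_product[OF t s] less by (metis less_imp_le order.trans)
  qed
  ultimately show ?thesis by (simp add: lead_def)
qed

text \<open>Lazard's decomposition: the free Lie ring on \<open>S\<close> is the line of
  \<open>b\<close> plus the free Lie ring on all \<open>ad(b)^n s\<close> with \<open>s\<close> in
  \<open>S - {b}\<close>. The case \<open>n = 0\<close> keeps \<open>s\<close> itself, and the
  weight bound keeps a finite set finite.\<close>

definition elim_step :: "nat \<Rightarrow> btree \<Rightarrow> btree set \<Rightarrow> btree set" where
  "elim_step c b S = {t. length (foliage t) \<le> c \<and> (\<exists>s\<in>S - {b}. \<exists>n. t = (Br b ^^ n) s)}"

text \<open>Stated as a relation, since the existence of \<open>hs\<close> needs its own termination
  argument (\<open>elim_exists\<close>). Beyond minimality, \<open>sless\<close> rules out that the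
  word of \<open>b\<close> is a prefix of another word of \<open>S\<close>.\<close>

inductive elim :: "nat \<Rightarrow> btree set \<Rightarrow> btree list \<Rightarrow> bool" for c where
  elim_Nil: "elim c {} []"
| elim_Cons: "b \<in> S \<Longrightarrow> (\<And>s. s \<in> S \<Longrightarrow> s \<noteq> b \<Longrightarrow> sless (foliage b) (foliage s)) \<Longrightarrow>
    elim c (elim_step c b S) hs \<Longrightarrow> elim c S (b # hs)"

lemma elim_step_cases:
  assumes "t \<in> elim_step c b S"
  obtains s n where "s \<in> S" "s \<noteq> b" "t = (Br b ^^ n) s" "length (foliage t) \<le> c"
  using assms by (auto simp: elim_step_def)

lemma elim_step_Br:
  "t \<in> elim_step c b S \<Longrightarrow> length (foliage (Br b t)) \<le> c \<Longrightarrow> Br b t \<in> elim_step c b S"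
  unfolding elim_step_def by (auto intro!: exI[of _ "Suc _"])

lemma foliage_power_gt:
  assumes "sless (foliage b) (foliage s)"
  shows "foliage b < foliage ((Br b ^^ n) s)"
proof (cases n)
  case 0
  then show ?thesis using assms sless_less by simp
next
  case (Suc m)
  have "u < u @ v" if "v \<noteq> []" for u v :: "nat list"
    using that by (induction u) (auto simp: neq_Nil_conv)
  then show ?thesis using Suc by (simp add: foliage_power)
qed

lemma elim_step_gt:
  assumes "\<And>s. s \<in> S \<Longrightarrow> s \<noteq> b \<Longrightarrow> sless (foliage b) (foliage s)" "t \<in> elim_step c b S"
  shows "foliage b < foliage t"
  using assms by (metis elim_step_cases foliage_power_gt)

lemma elim_ge: "elim c S hs \<Longrightarrow> t \<in> set hs \<Longrightarrow> \<exists>s\<in>S. foliage s \<le> foliage t"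
proof (induction rule: elim.induct)
  case (elim_Cons b S hs)
  show ?case
  proof (cases "t = b")
    case False
    then obtain s where "s \<in> elim_step c b S" "foliage s \<le> foliage t"
      using elim_Cons by auto
    then show ?thesis using elim_step_gt[OF elim_Cons.hyps(2)] elim_Cons.hyps(1)
      by (meson less_imp_le order.trans)
  qed (use elim_Cons in auto)
qed auto

text \<open>Every generator of the next stage lies strictly above \<open>b\<close>, and all later
  choices are bounded below by such a generator (\<open>elim_ge\<close>). Hence distinct trees of
  \<open>hs\<close> have distinct words, which drives the independence proof.\<close>

lemma elim_sorted: "elim c S hs \<Longrightarrow> sorted_wrt (\<lambda>s t. foliage s < foliage t) hs"
proof (induction rule: elim.induct)
  case (elim_Cons b S hs)
  have "foliage b < foliage t" if "t \<in> set hs" for t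
    using elim_ge[OF elim_Cons.hyps(3) that] elim_step_gt[OF elim_Cons.hyps(2)]
    by (meson order.strict_trans2)
  then show ?case using elim_Cons.IH by simp
qed simp

text \<open>To apply \<open>lead_Br\<close> to \<open>b\<close> and \<open>b^n s\<close>, compare
  the words \<open>b b^n s\<close> and \<open>b^n s b\<close>. Their common prefix
  \<open>b^n\<close> drops out, leaving \<open>b s\<close> against \<open>s b\<close>, which already
  differ within \<open>b\<close> and \<open>s\<close>.\<close>

lemma elim_lead:
  "elim c S hs \<Longrightarrow> (\<And>s. s \<in> S \<Longrightarrow> lead TYPE('a::comm_ring_1) s) \<Longrightarrow> t \<in> set hs \<Longrightarrow> lead TYPE('a) t"
proof (induction rule: elim.induct)
  case (elim_Cons b S hs)
  have "lead TYPE('a) ((Br b ^^ n) s)" if "s \<in> S" "s \<noteq> b" for s n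
  proof (induction n)
    case (Suc n)
    have "sless (foliage b @ foliage s) (foliage s @ foliage b)"
      by (rule sless_append) (use elim_Cons that in auto)
    moreover have "concat (replicate n (foliage b)) @ foliage b = foliage b @ concat (replicate n (foliage b))"
      by (induction n) auto
    ultimately have "sless (foliage b @ foliage ((Br b ^^ n) s)) (foliage ((Br b ^^ n) s) @ foliage b)"
      by (metis append.assoc foliage_power sless_append_left)
    then show ?case using Suc elim_Cons.prems(1)[OF elim_Cons.hyps(1)]
      by (auto intro!: lead_Br sless_less)
  qed (use elim_Cons that in auto)
  then have "lead TYPE('a) s" if "s \<in> elim_step c b S" for s
    using that by (metis elim_step_cases)
  then show ?case using elim_Cons by auto
qed auto

lemma elim_trees:
  "elim c S hs \<Longrightarrow> (\<And>s. s \<in> S \<Longrightarrow> length (foliage s) \<le> c \<and> set (foliage s) \<subseteq> A) \<Longrightarrow> t \<in> set hs \<Longrightarrow>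
     length (foliage t) \<le> c \<and> set (foliage t) \<subseteq> A"
proof (induction rule: elim.induct)
  case (elim_Cons b S hs)
  have "length (foliage s) \<le> c \<and> set (foliage s) \<subseteq> A" if s: "s \<in> elim_step c b S" for s
  proof -
    obtain s' n where "s' \<in> S" "s = (Br b ^^ n) s'" "length (foliage s) \<le> c"
      using elim_step_cases[OF s] by metis
    then show ?thesis
      using elim_Cons.prems(1)[OF elim_Cons.hyps(1)] elim_Cons.prems(1)[of s']
      by (auto simp: foliage_power)
  qed
  then show ?case using elim_Cons by auto
qed auto

text \<open>The set \<open>S\<close> may grow at each step, so termination is measured by the words
  of length at most \<open>c\<close> that lie above some word of \<open>S\<close>: the word of
  \<open>b\<close> is lost at every step. The comparability hypothesis says that the words of
  \<open>S\<close> are distinct and prefix-free, and it has to be carried along.\<close>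

lemma elim_exists:
  assumes "finite S" "\<And>s. s \<in> S \<Longrightarrow> length (foliage s) \<le> c \<and> set (foliage s) \<subseteq> {..<r}"
    and "\<And>s t. s \<in> S \<Longrightarrow> t \<in> S \<Longrightarrow> s \<noteq> t \<Longrightarrow> sless (foliage s) (foliage t) \<or> sless (foliage t) (foliage s)"
  shows "\<exists>hs. elim c S hs"
  using assms
proof (induction "card {w. set w \<subseteq> {..<r} \<and> length w \<le> c \<and> (\<exists>s\<in>S. foliage s \<le> w)}" arbitrary: S rule: less_induct)
  case less
  let ?U = "\<lambda>S. {w. set w \<subseteq> {..<r} \<and> length w \<le> c \<and> (\<exists>s\<in>S. foliage s \<le> w)}"
  show ?case
  proof (cases "S = {}")
    case True
    then show ?thesis using elim_Nil by blast
  next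
    case False
    have "finite (foliage ` S)" "foliage ` S \<noteq> {}" using less.prems(1) False by auto
    then obtain b where b: "b \<in> S" "foliage b = Min (foliage ` S)" by (metis Min_in imageE)
    have bs: "sless (foliage b) (foliage s)" if "s \<in> S" "s \<noteq> b" for s
    proof -
      have "foliage b \<le> foliage s" using b that less.prems(1) by simp
      then show ?thesis using less.prems(3)[OF b(1) that(1)] that(2) sless_less by fastforce
    qed
    let ?S = "elim_step c b S"
    \<comment> \<open>Every application of \<open>Br b\<close> adds at least one leaf, so the weight
      bound leaves only exponents \<open>n \<le> c\<close>.\<close>
    have "length (foliage ((Br b ^^ n) s)) \<ge> n" for n s
    proof (induction n)
      case (Suc n)
      have "length (foliage b) \<ge> 1" by (simp add: Suc_le_eq)
      then show ?case using Suc by simp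
    qed simp
    then have "?S \<subseteq> (\<lambda>(n, s). (Br b ^^ n) s) ` ({..c} \<times> S)"
      by (fastforce simp: elim_step_def image_iff intro: order.trans)
    then have fin: "finite ?S" using less.prems(1) by (meson finite_SigmaI finite_atMost finite_imageI finite_subset)
    have len: "length (foliage t) \<le> c \<and> set (foliage t) \<subseteq> {..<r}" if t: "t \<in> ?S" for t
    proof -
      obtain s' n where "s' \<in> S" "t = (Br b ^^ n) s'" "length (foliage t) \<le> c"
        using elim_step_cases[OF t] by metis
      then show ?thesis
        using less.prems(2)[OF b(1)] less.prems(2)[of s'] by (auto simp: foliage_power)
    qed
    \<comment> \<open>With unequal exponents the common prefix \<open>b^n\<close> is removed; then a
      word starting with \<open>b\<close> faces the word of \<open>s\<close>.\<close>
    have cmp: "sless (foliage ((Br b ^^ m) t)) (foliage ((Br b ^^ n) s))"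
      if "s \<in> S" "s \<noteq> b" "n < m" for n m s t
    proof -
      obtain d where d: "m = n + Suc d" using \<open>n < m\<close> less_iff_Suc_add by auto
      have "sless (foliage b @ foliage ((Br b ^^ d) t)) (foliage s @ [])"
        by (rule sless_append) (use bs that in auto)
      moreover have "foliage ((Br b ^^ m) t) = concat (replicate n (foliage b)) @ foliage b @ foliage ((Br b ^^ d) t)"
        unfolding d funpow_add o_apply foliage_power[of n] by simp
      moreover have "foliage ((Br b ^^ n) s) = concat (replicate n (foliage b)) @ foliage s"
        by (rule foliage_power)
      ultimately show ?thesis by simp
    qed
    have comp: "sless (foliage s) (foliage t) \<or> sless (foliage t) (foliage s)"
      if st: "s \<in> ?S" "t \<in> ?S" "s \<noteq> t" for s t
    proof -
      obtain s' n t' m where *: "s' \<in> S" "s' \<noteq> b" "s = (Br b ^^ n) s'" "t' \<in> S" "t' \<noteq> b" "t = (Br b ^^ m) t'"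
        using st by (metis elim_step_cases)
      consider "n < m" | "m < n" | "n = m" by linarith
      then show ?thesis
      proof cases
        case 3
        then have "s' \<noteq> t'" using * st by auto
        then show ?thesis using less.prems(3)[of s' t'] * 3 by (simp add: foliage_power)
      qed (use cmp * in blast)+
    qed
    have gt: "foliage b < foliage t" if "t \<in> ?S" for t
      using elim_step_gt bs that by blast
    have "?U ?S \<subseteq> ?U S" using gt by (auto intro!: bexI[OF _ b(1)]) (meson less_imp_le order.trans)
    moreover have "foliage b \<in> ?U S" using b(1) less.prems(2)[OF b(1)] by auto
    moreover have "foliage b \<notin> ?U ?S" using gt by (auto simp: not_le[symmetric])
    ultimately have "?U ?S \<subset> ?U S" by blast
    moreover have "finite (?U S)"
      by (rule finite_subset[OF _ finite_lists_length_le[of "{..<r}" c]]) auto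
    ultimately have "card (?U ?S) < card (?U S)" by (rule psubset_card_mono[rotated])
    from less.hyps[OF this fin len comp] obtain hs where "elim c ?S hs" by blast
    then show ?thesis using elim_Cons[OF b(1) bs] by blast
  qed
qed

text \<open>The Lie algebra generated by \<open>S\<close>, with all series of order above
  \<open>c\<close> thrown in. Working modulo this ideal from the start lets brackets of excessive
  weight be discarded in every closure argument.\<close>

inductive_set lie_closure :: "nat \<Rightarrow> btree set \<Rightarrow> 'a::comm_ring_1 ncs set" for c S where
  lie_closure_gen: "t \<in> S \<Longrightarrow> lie_poly t \<in> lie_closure c S"
| lie_closure_high: "order_ge (Suc c) f \<Longrightarrow> f \<in> lie_closure c S"
| lie_closure_add: "f \<in> lie_closure c S \<Longrightarrow> g \<in> lie_closure c S \<Longrightarrow> f + g \<in> lie_closure c S"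
| lie_closure_scale: "f \<in> lie_closure c S \<Longrightarrow> scale a f \<in> lie_closure c S"
| lie_closure_bracket: "f \<in> lie_closure c S \<Longrightarrow> g \<in> lie_closure c S \<Longrightarrow> f * g - g * f \<in> lie_closure c S"

lemma lie_closure_diff: "f \<in> lie_closure c S \<Longrightarrow> g \<in> lie_closure c S \<Longrightarrow> f - g \<in> lie_closure c S"
proof -
  assume "f \<in> lie_closure c S" "g \<in> lie_closure c S"
  moreover have "f - g = f + scale (-1) g" by (rule ncs_eqI) simp
  ultimately show ?thesis by (metis lie_closure_add lie_closure_scale)
qed

lemma lie_closure_0 [simp]: "0 \<in> lie_closure c S"
  by (simp add: lie_closure_high)

lemma lie_closure_sum: "(\<And>x. x \<in> A \<Longrightarrow> f x \<in> lie_closure c S) \<Longrightarrow> sum f A \<in> lie_closure c S"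
  by (induction A rule: infinite_finite_induct) (auto intro: lie_closure_add)

text \<open>\<open>ad(b)\<close> is a derivation, so it suffices to look at generators, where it
  sends \<open>t\<close> to \<open>Br b t\<close>: either another generator or of order above
  \<open>c\<close>.\<close>

lemma lie_closure_elim_bracket:
  "f \<in> lie_closure c (elim_step c b S) \<Longrightarrow>
     lie_poly b * f - f * lie_poly b \<in> lie_closure c (elim_step c b S)"
proof (induction rule: lie_closure.induct)
  case (lie_closure_gen t)
  show ?case
  proof (cases "length (foliage (Br b t)) \<le> c")
    case True
    then show ?thesis
      using elim_step_Br[OF lie_closure_gen] lie_closure.lie_closure_gen[of "Br b t"] by simp
  next
    case False
    then have "order_ge (Suc c) (lie_poly (Br b t) :: 'a ncs)" by (intro order_ge_lie_poly) simp
    then show ?thesis by (simp add: lie_closure_high)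
  qed
next
  case (lie_closure_high f)
  then show ?case
    by (intro lie_closure.lie_closure_high order_ge_diff)
       (metis add.commute add_0 order_ge_mult order_ge_zero_index)+
next
  case (lie_closure_add f g)
  have "lie_poly b * (f + g) - (f + g) * lie_poly b =
    (lie_poly b * f - f * lie_poly b) + (lie_poly b * g - g * lie_poly b)" by (simp add: algebra_simps)
  then show ?case using lie_closure_add by (metis lie_closure.lie_closure_add)
next
  case (lie_closure_scale f a)
  have "lie_poly b * scale a f - scale a f * lie_poly b = scale a (lie_poly b * f - f * lie_poly b)"
    by (simp add: scale_mult_left scale_mult_right scale_diff_right)
  then show ?case using lie_closure_scale by (metis lie_closure.lie_closure_scale)
next
  case (lie_closure_bracket f g)
  let ?b = "lie_poly b :: 'a ncs"
  have "?b * (f * g - g * f) - (f * g - g * f) * ?b =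
    ((?b * f - f * ?b) * g - g * (?b * f - f * ?b)) + (f * (?b * g - g * ?b) - (?b * g - g * ?b) * f)"
    by (simp add: algebra_simps)
  then show ?case using lie_closure_bracket
    by (metis lie_closure.lie_closure_add lie_closure.lie_closure_bracket)
qed

text \<open>The sums of a multiple of \<open>b\<close> and an element of the smaller algebra are
  closed under brackets: \<open>[b, b] = 0\<close>, and mixed brackets are covered by
  \<open>lie_closure_elim_bracket\<close>.\<close>

lemma lie_closure_elim:
  assumes "f \<in> lie_closure c S"
  shows "\<exists>a g. g \<in> lie_closure c (elim_step c b S) \<and> f = scale a (lie_poly b) + g"
  using assms
proof (induction rule: lie_closure.induct)
  case (lie_closure_gen t)
  show ?case
  proof (cases "t = b")
    case True
    then show ?thesis by (intro exI[of _ 1] exI[of _ 0]) simp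
  next
    case False
    show ?thesis
    proof (cases "length (foliage t) \<le> c")
      case True
      then have "t \<in> elim_step c b S" using False lie_closure_gen
        unfolding elim_step_def by (auto intro!: bexI[of _ t] exI[of _ 0])
      then show ?thesis
        by (intro exI[of _ 0] exI[of _ "lie_poly t"]) (simp add: lie_closure.lie_closure_gen)
    next
      case False
      then show ?thesis
        by (intro exI[of _ 0] exI[of _ "lie_poly t"])
           (simp add: lie_closure.lie_closure_high order_ge_lie_poly)
    qed
  qed
next
  case (lie_closure_high f)
  then show ?case by (intro exI[of _ 0] exI[of _ f]) (simp add: lie_closure.lie_closure_high)
next
  case (lie_closure_add f f')
  then obtain a g a' g' where "g \<in> lie_closure c (elim_step c b S)" "f = scale a (lie_poly b) + g"
    "g' \<in> lie_closure c (elim_step c b S)" "f' = scale a' (lie_poly b) + g'" by blast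
  then show ?case
    by (intro exI[of _ "a + a'"] exI[of _ "g + g'"])
       (simp add: lie_closure.lie_closure_add scale_add_left algebra_simps)
next
  case (lie_closure_scale f x)
  then obtain a g where "g \<in> lie_closure c (elim_step c b S)" "f = scale a (lie_poly b) + g" by blast
  then show ?case
    by (intro exI[of _ "x * a"] exI[of _ "scale x g"])
       (simp add: lie_closure.lie_closure_scale scale_add_right scale_scale)
next
  case (lie_closure_bracket f f')
  then obtain a g a' g' where g: "g \<in> lie_closure c (elim_step c b S)" "f = scale a (lie_poly b) + g"
    "g' \<in> lie_closure c (elim_step c b S)" "f' = scale a' (lie_poly b) + g'" by blast
  let ?b = "lie_poly b :: 'a ncs"
  have "f * f' - f' * f =
    (scale a (?b * g' - g' * ?b) - scale a' (?b * g - g * ?b)) + (g * g' - g' * g)"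
    by (simp add: g algebra_simps scale_mult_left scale_mult_right scale_diff_right scale_add_right
        scale_scale)
  moreover have "(scale a (?b * g' - g' * ?b) - scale a' (?b * g - g * ?b)) + (g * g' - g' * g)
     \<in> lie_closure c (elim_step c b S)"
    using g by (intro lie_closure.lie_closure_add lie_closure_diff lie_closure.lie_closure_scale
        lie_closure_elim_bracket lie_closure.lie_closure_bracket)
  ultimately show ?case by (intro exI[of _ 0] exI[of _ "f * f' - f' * f"]) simp
qed

lemma lie_closure_span:
  "elim c S hs \<Longrightarrow> f \<in> lie_closure c S \<Longrightarrow>
     \<exists>a. order_ge (Suc c) (f - (\<Sum>t\<leftarrow>hs. scale (a t) (lie_poly t)))"
proof (induction arbitrary: f rule: elim.induct)
  case elim_Nil
  \<comment> \<open>Without generators only the series of order above \<open>c\<close>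
    remain.\<close>
  from elim_Nil have "order_ge (Suc c) f"
  proof (induction rule: lie_closure.induct)
    case (lie_closure_bracket f g)
    then show ?case
      by (intro order_ge_diff) (metis add.commute add_0 order_ge_mult order_ge_zero_index)+
  qed (auto intro: order_ge_add order_ge_scale)
  then show ?case by simp
next
  case (elim_Cons b S hs)
  obtain a g where g: "g \<in> lie_closure c (elim_step c b S)" "f = scale a (lie_poly b) + g"
    using lie_closure_elim[OF elim_Cons.prems] by blast
  obtain a' where a': "order_ge (Suc c) (g - (\<Sum>t\<leftarrow>hs. scale (a' t) (lie_poly t)))"
    using elim_Cons.IH[OF g(1)] by blast
  have "b \<notin> set hs"
    using elim_sorted[OF elim.elim_Cons[OF elim_Cons.hyps]] by auto
  then have "(\<Sum>t\<leftarrow>hs. scale ((a'(b := a)) t) (lie_poly t)) = (\<Sum>t\<leftarrow>hs. scale (a' t) (lie_poly t))"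
    by (intro arg_cong[where f = sum_list] map_cong) auto
  then show ?case using a' g(2) by (intro exI[of _ "a'(b := a)"]) simp
qed

text \<open>Among the trees with nonzero scalar take the one with the least word. No other term of
  the sum contains that word, so the coefficient there is the scalar itself. The indexing by
  \<open>\<tau>\<close> serves both positions in a list and sets of trees.\<close>

lemma lie_poly_independent:
  fixes \<tau> :: "'i \<Rightarrow> btree" and a :: "'i \<Rightarrow> 'a::comm_ring_1"
  assumes fin: "finite I" and inj: "inj_on (foliage \<circ> \<tau>) I"
    and lead: "\<And>i. i \<in> I \<Longrightarrow> lead TYPE('a) (\<tau> i)"
    and zero: "(\<Sum>i\<in>I. scale (a i) (lie_poly (\<tau> i))) = 0" and i: "i \<in> I"
  shows "a i = 0"
proof (rule ccontr)
  assume "a i \<noteq> 0"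
  define J where "J = {j \<in> I. a j \<noteq> 0}"
  have "finite ((foliage \<circ> \<tau>) ` J)" "(foliage \<circ> \<tau>) ` J \<noteq> {}"
    using fin i \<open>a i \<noteq> 0\<close> by (auto simp: J_def)
  then obtain j where j: "j \<in> J" "(foliage \<circ> \<tau>) j = Min ((foliage \<circ> \<tau>) ` J)"
    by (metis Min_in imageE)
  have jI: "j \<in> I" "a j \<noteq> 0" using j(1) by (auto simp: J_def)
  have "a m * coef (lie_poly (\<tau> m)) (foliage (\<tau> j)) = 0" if m: "m \<in> I - {j}" for m
  proof (cases "m \<in> J")
    case True
    then have "foliage (\<tau> j) \<le> foliage (\<tau> m)"
      using j(2) fin by (simp add: J_def)
    moreover have "foliage (\<tau> j) \<noteq> foliage (\<tau> m)"
      using inj_onD[OF inj, of j m] m jI by auto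
    ultimately have "\<not> foliage (\<tau> m) \<le> foliage (\<tau> j)" by auto
    then have "coef (lie_poly (\<tau> m) :: 'a ncs) (foliage (\<tau> j)) = 0"
      using lead[of m] m unfolding lead_def by blast
    then show ?thesis by simp
  qed (use m in \<open>auto simp: J_def\<close>)
  then have "(\<Sum>m\<in>I. a m * coef (lie_poly (\<tau> m)) (foliage (\<tau> j))) = a j"
    using lead[OF jI(1)] by (subst sum.remove[OF fin jI(1)]) (simp add: lead_def)
  moreover have "coef (\<Sum>i\<in>I. scale (a i) (lie_poly (\<tau> i))) (foliage (\<tau> j)) = 0"
    by (simp add: zero)
  ultimately show False using jI(2) by simp
qed

section \<open>Linear substitutions\<close>

text \<open>The substitution \<open>X_j \<mapsto> \<Sum>_a M(a, j) X_a\<close> on coefficient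
  functions: on words of length \<open>n\<close> it is the \<open>n\<close>-th tensor power of
  \<open>M\<close>. Letters beyond the dimensions of \<open>M\<close> go to 0.\<close>

fun lact :: "'a::comm_ring_1 mat \<Rightarrow> (nat list \<Rightarrow> 'a) \<Rightarrow> nat list \<Rightarrow> 'a" where
  "lact M f [] = f []"
| "lact M f (a # w) =
     (if a < dim_row M then \<Sum>j<dim_col M. M $$ (a, j) * lact M (\<lambda>v. f (j # v)) w else 0)"

lemma lact_add: "lact M (\<lambda>v. f v + g v) w = lact M f w + lact M g w"
  by (induction w arbitrary: f g) (auto simp: algebra_simps sum.distrib)

lemma lact_scale: "lact M (\<lambda>v. a * f v) w = a * lact M f w"
  by (induction w arbitrary: f) (auto simp: algebra_simps sum_distrib_left)

lemma lact_eq_0: "(\<And>v. length v = length w \<Longrightarrow> f v = 0) \<Longrightarrow> lact M f w = 0"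
  by (induction w arbitrary: f) auto

lemma lact_sum: "lact M (\<lambda>v. \<Sum>x\<in>A. f x v) w = (\<Sum>x\<in>A. lact M (f x) w)"
  by (induction A rule: infinite_finite_induct) (auto simp: lact_add intro: lact_eq_0)

lemma conv_sum_left: "conv (\<lambda>v. \<Sum>x\<in>A. f x v) g w = (\<Sum>x\<in>A. conv (f x) g w)"
  by (induction A rule: infinite_finite_induct) (auto simp: conv_add_left conv_zero_left)

text \<open>By this the substitution is a ring homomorphism, so it maps brackets to brackets and is
  determined in every degree by the images of the letters.\<close>

lemma lact_conv: "lact M (conv f g) w = conv (lact M f) (lact M g) w"
proof (induction w arbitrary: f)
  case (Cons a w)
  show ?case
  proof (cases "a < dim_row M")
    case True
    have "lact M (conv f g) (a # w) = (\<Sum>j<dim_col M. M $$ (a, j) *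
        (f [] * lact M (\<lambda>v. g (j # v)) w + conv (lact M (\<lambda>v. f (j # v))) (lact M g) w))"
      using True by (simp add: lact_add lact_scale Cons.IH)
    also have "\<dots> = f [] * lact M g (a # w) +
        (\<Sum>j<dim_col M. conv (\<lambda>v. M $$ (a, j) * lact M (\<lambda>v. f (j # v)) v) (lact M g) w)"
      using True by (simp add: algebra_simps sum.distrib sum_distrib_left conv_scale_left)
    also have "\<dots> = conv (lact M f) (lact M g) (a # w)"
      using True by (simp add: conv_sum_left)
    finally show ?thesis .
  qed (simp add: conv_zero_left)
qed simp

lemma lact_mult:
  assumes "dim_col A = dim_row B"
  shows "lact (A * B) f w = lact A (lact B f) w"
proof (induction w arbitrary: f)
  case (Cons a w)
  show ?case
  proof (cases "a < dim_row A")
    case True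
    have "lact (A * B) f (a # w) = (\<Sum>j<dim_col B. \<Sum>i<dim_row B.
        A $$ (a, i) * B $$ (i, j) * lact A (lact B (\<lambda>v. f (j # v))) w)"
      using True assms by (simp add: Cons.IH scalar_prod_def sum_distrib_right atLeast0LessThan)
    also have "\<dots> = (\<Sum>i<dim_row B. A $$ (a, i) *
        lact A (\<lambda>v. \<Sum>j<dim_col B. B $$ (i, j) * lact B (\<lambda>v. f (j # v)) v) w)"
      unfolding lact_sum lact_scale by (subst sum.swap) (simp add: sum_distrib_left algebra_simps)
    also have "\<dots> = lact A (lact B f) (a # w)"
      using True assms by simp
    finally show ?thesis .
  qed simp
qed simp

lemma lact_one: "lact (1\<^sub>m r) f w = (if set w \<subseteq> {..<r} then f w else 0)"
proof (induction w arbitrary: f)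
  case (Cons a w)
  show ?case
  proof (cases "a < r")
    case True
    have "(\<Sum>j<r. 1\<^sub>m r $$ (a, j) * lact (1\<^sub>m r) (\<lambda>v. f (j # v)) w) =
       (\<Sum>j<r. if j = a then lact (1\<^sub>m r) (\<lambda>v. f (j # v)) w else 0)"
      by (rule sum.cong) (use True in auto)
    then show ?thesis using True by (simp add: Cons.IH)
  qed auto
qed simp

lemma lact_outside: "\<not> set w \<subseteq> {..<dim_row M} \<Longrightarrow> lact M f w = 0"
  by (induction w arbitrary: f) auto

definition act :: "'a::comm_ring_1 mat \<Rightarrow> 'a ncs \<Rightarrow> 'a ncs" where
  "act M f = Ncs (lact M (coef f))"

lemma coef_act [simp]: "coef (act M f) w = lact M (coef f) w"
  by (simp add: act_def)

lemma act_add: "act M (f + g) = act M f + act M g"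
proof -
  have "coef (f + g) = (\<lambda>v. coef f v + coef g v)" by (rule ext) simp
  then show ?thesis by (intro ncs_eqI) (simp add: lact_add)
qed

lemma act_scale: "act M (scale a f) = scale a (act M f)"
proof -
  have "coef (scale a f) = (\<lambda>v. a * coef f v)" by (rule ext) simp
  then show ?thesis by (intro ncs_eqI) (simp add: lact_scale)
qed

lemma act_0 [simp]: "act M 0 = 0"
  by (metis act_scale scale_0_left)

lemma act_diff: "act M (f - g) = act M f - act M g"
  by (metis act_add diff_add_cancel eq_diff_eq)

lemma act_sum: "act M (sum f A) = (\<Sum>x\<in>A. act M (f x))"
  by (induction A rule: infinite_finite_induct) (auto simp: act_add)

lemma act_times: "act M (f * g) = act M f * act M g"
proof -
  have "coef (f * g) = conv (coef f) (coef g)" "coef (act M h) = lact M (coef h)" for h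
    by (auto simp: coef_mult)
  then show ?thesis by (intro ncs_eqI) (simp add: coef_mult lact_conv)
qed

lemma act_mult: "dim_col A = dim_row B \<Longrightarrow> act (A * B) f = act A (act B f)"
  by (rule ncs_eqI) (simp add: lact_mult act_def)

lemma hom_part_act: "hom_part k (act M f) = act M (hom_part k f)"
proof (rule ncs_eqI)
  fix w
  show "coef (hom_part k (act M f)) w = coef (act M (hom_part k f)) w"
  proof (cases "length w = k")
    case True
    have "lact M (coef f) w - lact M (coef (hom_part k f)) w = lact M (\<lambda>v. coef f v - coef (hom_part k f) v) w"
      using lact_add[of M "coef f" "\<lambda>v. - 1 * coef (hom_part k f) v" w] lact_scale[of M "- 1" "coef (hom_part k f)" w]
      by simp
    also have "\<dots> = 0" using True by (intro lact_eq_0) (simp add: coef_hom_part)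
    finally show ?thesis using True by (simp add: coef_hom_part)
  next
    case False
    have "lact M (coef (hom_part k f)) w = 0" using False by (intro lact_eq_0) (simp add: coef_hom_part)
    then show ?thesis using False by (simp add: coef_hom_part)
  qed
qed

lemma act_letter_series:
  assumes "M \<in> carrier_mat r r" "i < r"
  shows "act M (letter_series i) = (\<Sum>j<r. scale (M $$ (j, i)) (letter_series j))"
proof (rule ncs_eqI)
  fix w
  have eps: "lact M (\<lambda>v. if v = [] then 1 else 0) v = (if v = [] then 1 else (0::'a))" for v
  proof (cases v)
    case (Cons a list)
    then have "lact M (\<lambda>v. if v = [] then 1 else 0) v = 0" by (intro lact_eq_0) auto
    then show ?thesis using Cons by simp
  qed simp
  have *: "lact M (\<lambda>v. coef (letter_series i) (j # v)) v = (if j = i then if v = [] then 1 else 0 else 0)" for j v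
  proof -
    have "(\<lambda>v. coef (letter_series i) (j # v)) = (\<lambda>v. (if j = i then 1 else 0) * (if v = [] then 1 else (0::'a)))"
      by (auto simp: letter_series_def)
    then show ?thesis by (simp only: lact_scale eps) simp
  qed
  show "coef (act M (letter_series i)) w = coef (\<Sum>j<r. scale (M $$ (j, i)) (letter_series j)) w"
  proof (cases w)
    case Nil
    then show ?thesis by (simp add: letter_series_def)
  next
    case (Cons a v)
    have "lact M (coef (letter_series i)) (a # v) =
        (if a < r then \<Sum>j<r. M $$ (a, j) * (if j = i then if v = [] then 1 else 0 else 0) else 0)"
      using assms(1) by (simp add: *)
    also have "\<dots> = (if a < r \<and> v = [] then M $$ (a, i) else 0)"
      using assms(2) by (simp add: if_distrib[of "\<lambda>x. _ * x"] cong: if_cong)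
    also have "\<dots> = (\<Sum>j<r. if j = a then (if v = [] then M $$ (a, i) else 0) else 0)"
      by simp
    also have "\<dots> = (\<Sum>j<r. M $$ (j, i) * coef (letter_series j) (a # v))"
      by (rule sum.cong) (auto simp: letter_series_def)
    finally show ?thesis using Cons by simp
  qed
qed

section \<open>Triangular substitutions\<close>

lemma lact_triangular_0:
  assumes T: "upper_triangular T" "T \<in> carrier_mat r r"
    and "\<And>v. length v = length u \<Longrightarrow> f v \<noteq> 0 \<Longrightarrow> sum_list v < sum_list u"
  shows "lact T f u = 0"
  using assms(3)
proof (induction u arbitrary: f)
  case (Cons a u)
  have "T $$ (a, j) * lact T (\<lambda>v. f (j # v)) u = 0" if "a < r" "j < r" for j
  proof (cases "j < a")
    case True
    then show ?thesis using T that by (auto simp: upper_triangular_def)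
  next
    case False
    have "lact T (\<lambda>v. f (j # v)) u = 0"
    proof (rule Cons.IH)
      fix v assume "length v = length u" "f (j # v) \<noteq> 0"
      then show "sum_list v < sum_list u" using Cons.prems[of "j # v"] False by simp
    qed
    then show ?thesis by simp
  qed
  then show ?case using T by simp
qed auto

text \<open>An upper triangular substitution replaces each letter by letters that are not larger, so
  letter sums never increase. A word of top letter sum therefore receives a contribution only from
  itself, with the product of the diagonal entries as factor.\<close>

lemma lact_triangular:
  assumes T: "upper_triangular T" "T \<in> carrier_mat r r" and "set u \<subseteq> {..<r}"
    and "\<And>v. length v = length u \<Longrightarrow> f v \<noteq> 0 \<Longrightarrow> sum_list v \<le> sum_list u"
  shows "lact T f u = (\<Prod>a\<leftarrow>u. T $$ (a, a)) * f u"
  using assms(3,4)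
proof (induction u arbitrary: f)
  case (Cons a u)
  have a: "a < r" using Cons.prems by simp
  have "T $$ (a, j) * lact T (\<lambda>v. f (j # v)) u = 0" if "j < r" "j \<noteq> a" for j
  proof (cases "j < a")
    case True
    then show ?thesis using T that a by (auto simp: upper_triangular_def)
  next
    case False
    have "lact T (\<lambda>v. f (j # v)) u = 0"
    proof (rule lact_triangular_0[OF T])
      fix v assume "length v = length u" "f (j # v) \<noteq> 0"
      then show "sum_list v < sum_list u" using Cons.prems(2)[of "j # v"] False that by simp
    qed
    then show ?thesis by simp
  qed
  then have "(\<Sum>j<r. T $$ (a, j) * lact T (\<lambda>v. f (j # v)) u) = T $$ (a, a) * lact T (\<lambda>v. f (a # v)) u"
    using a by (subst sum.remove[of _ a]) auto
  also have "lact T (\<lambda>v. f (a # v)) u = (\<Prod>a\<leftarrow>u. T $$ (a, a)) * f (a # u)"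
    by (rule Cons.IH) (use Cons.prems in force)+
  finally show ?case using a T by (simp add: mult.assoc)
qed simp

text \<open>All words of \<open>lie_poly t\<close> share the letter sum of \<open>foliage t\<close>,
  so each of them is of top letter sum; being rearrangements of \<open>foliage t\<close>, they all
  carry the same diagonal product.\<close>

lemma act_triangular_lie_poly:
  fixes T :: "'a::comm_ring_1 mat"
  assumes T: "upper_triangular T" "T \<in> carrier_mat r r" and "set (foliage t) \<subseteq> {..<r}"
    and u: "sum_list (foliage t) \<le> sum_list u"
  shows "coef (act T (lie_poly t)) u = (\<Prod>a\<leftarrow>foliage t. T $$ (a, a)) * coef (lie_poly t) u"
proof (cases "set u \<subseteq> {..<r}")
  case True
  have "lact T (coef (lie_poly t)) u = (\<Prod>a\<leftarrow>u. T $$ (a, a)) * coef (lie_poly t) u"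
  proof (rule lact_triangular[OF T True])
    fix v assume "coef (lie_poly t :: 'a ncs) v \<noteq> 0"
    then have "sum_list v = sum_list (foliage t)" by (metis lie_poly_support sum_mset_sum_list)
    then show "sum_list v \<le> sum_list u" using u by simp
  qed
  moreover have "(\<Prod>a\<leftarrow>u. T $$ (a, a)) = (\<Prod>a\<leftarrow>foliage t. T $$ (a, a))" if "coef (lie_poly t :: 'a ncs) u \<noteq> 0"
    using arg_cong[OF lie_poly_support[OF that], of "\<lambda>m. prod_mset (image_mset (\<lambda>a. T $$ (a, a)) m)"]
    by (simp only: mset_map[symmetric] prod_mset_prod_list)
  ultimately show ?thesis by (cases "coef (lie_poly t :: 'a ncs) u = 0") auto
next
  case False
  moreover have "coef (lie_poly t :: 'a ncs) u = 0"
    using False assms(3) lie_poly_support by (metis set_mset_mset)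
  ultimately show ?thesis using T lact_outside[of u T] by auto
qed

section \<open>The action on the homogeneous components of the free Lie ring\<close>

locale hall_basis =
  fixes r c :: nat and hs :: "btree list"
  assumes elim: "elim c (Leaf ` {..<r}) hs" and c_pos: "1 \<le> c"
begin

text \<open>Sorted by letter sum, so that triangular substitutions act on the degree
  \<open>k\<close> part by triangular matrices.\<close>

definition basis :: "nat \<Rightarrow> btree list" where
  "basis k = sort_key (\<lambda>t. sum_list (foliage t)) (filter (\<lambda>t. length (foliage t) = k) hs)"

lemma hs_tree: "t \<in> set hs \<Longrightarrow> length (foliage t) \<le> c \<and> set (foliage t) \<subseteq> {..<r}"
  by (rule elim_trees[OF elim]) (use c_pos in auto)

lemma hs_lead: "t \<in> set hs \<Longrightarrow> lead TYPE('a::comm_ring_1) t"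
proof (rule elim_lead[OF elim])
  fix s assume "s \<in> Leaf ` {..<r}"
  then show "lead TYPE('a) s"
    by (auto simp: lead_def letter_series_def split: if_splits)
qed

lemma hs_inj: "inj_on foliage (set hs)"
  and hs_distinct: "distinct hs"
proof -
  have "sorted_wrt (<) (map foliage hs)"
    using elim_sorted[OF elim] by (simp add: sorted_wrt_map)
  then have "distinct (map foliage hs)" by (simp add: strict_sorted_iff)
  then show "inj_on foliage (set hs)" "distinct hs" by (simp_all add: distinct_map)
qed

lemma set_basis: "set (basis k) = {t \<in> set hs. length (foliage t) = k}"
  by (simp add: basis_def)

lemma distinct_basis: "distinct (basis k)"
  using hs_distinct by (simp add: basis_def)

lemma basis_sorted:
  "i \<le> j \<Longrightarrow> j < length (basis k) \<Longrightarrow> sum_list (foliage (basis k ! i)) \<le> sum_list (foliage (basis k ! j))"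
proof -
  assume *: "i \<le> j" "j < length (basis k)"
  have "sorted (map (\<lambda>t. sum_list (foliage t)) (basis k))" by (simp add: basis_def)
  then show ?thesis using * sorted_nth_mono[of "map (\<lambda>t. sum_list (foliage t)) (basis k)" i j] by simp
qed

lemma basis_nth:
  assumes "i < length (basis k)"
  shows "length (foliage (basis k ! i)) = k" "set (foliage (basis k ! i)) \<subseteq> {..<r}"
    "lead TYPE('a::comm_ring_1) (basis k ! i)"
  using nth_mem[OF assms] hs_tree hs_lead by (auto simp: set_basis)

lemma basis_inj: "inj_on (foliage \<circ> (!) (basis k)) {..<length (basis k)}"
proof (rule comp_inj_on)
  show "inj_on ((!) (basis k)) {..<length (basis k)}"
    using distinct_basis by (simp add: inj_on_nth)
  show "inj_on foliage ((!) (basis k) ` {..<length (basis k)})"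
    by (rule inj_on_subset[OF hs_inj]) (use nth_mem set_basis in fastforce)
qed

lemma basis_independent:
  fixes a :: "nat \<Rightarrow> 'a::comm_ring_1"
  assumes "I \<subseteq> {..<length (basis k)}" "(\<Sum>i\<in>I. scale (a i) (lie_poly (basis k ! i))) = 0" "i \<in> I"
  shows "a i = 0"
proof (rule lie_poly_independent[where \<tau> = "(!) (basis k)", OF _ _ _ assms(2) assms(3)])
  show "finite I" using assms(1) finite_subset by blast
  show "inj_on (foliage \<circ> (!) (basis k)) I" using basis_inj assms(1) by (rule inj_on_subset)
  show "lead TYPE('a) (basis k ! j)" if "j \<in> I" for j using assms(1) that basis_nth(3) by blast
qed

text \<open>The expansion along \<open>hs\<close> is cut down to degree \<open>k\<close>: each Lie
  polynomial is homogeneous, so only the trees of weight \<open>k\<close> survive.\<close>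

lemma basis_span:
  assumes "(f :: 'a::comm_ring_1 ncs) \<in> lie_closure c (Leaf ` {..<r})" "k \<le> c"
  shows "\<exists>a. hom_part k f = (\<Sum>i<length (basis k). scale (a i) (lie_poly (basis k ! i)))"
proof -
  obtain a where a: "order_ge (Suc c) (f - (\<Sum>t\<leftarrow>hs. scale (a t) (lie_poly t)))"
    using lie_closure_span[OF elim assms(1)] by blast
  have "hom_part k (f - (\<Sum>t\<leftarrow>hs. scale (a t) (lie_poly t))) = 0"
    by (rule hom_part_eq_0[OF order_ge_mono[OF a]]) (use assms(2) in simp)
  then have "hom_part k f = hom_part k (\<Sum>t\<in>set hs. scale (a t) (lie_poly t))"
    using hs_distinct by (simp add: hom_part_diff sum_list_distinct_conv_sum_set)
  also have "\<dots> = (\<Sum>t\<in>set hs. if k = length (foliage t) then scale (a t) (lie_poly t) else 0)"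
    unfolding hom_part_sum by (rule sum.cong) (auto simp: hom_part_scale hom_part_lie_poly)
  also have "\<dots> = (\<Sum>t\<in>set (basis k). scale (a t) (lie_poly t))"
    by (rule sum.mono_neutral_cong_right) (auto simp: set_basis)
  also have "\<dots> = (\<Sum>i<length (basis k). scale (a (basis k ! i)) (lie_poly (basis k ! i)))"
    using sum.reindex_bij_betw[OF bij_betw_nth[OF distinct_basis[of k] refl refl], of "\<lambda>t. scale (a t) (lie_poly t)"]
    by simp
  finally show ?thesis by (intro exI[of _ "\<lambda>i. a (basis k ! i)"])
qed

lemma act_lie_poly_closure:
  assumes M: "M \<in> carrier_mat r r" and "set (foliage t) \<subseteq> {..<r}"
  shows "act M (lie_poly t) \<in> lie_closure c (Leaf ` {..<r})"
  using assms(2)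
proof (induction t)
  case (Leaf i)
  have "scale x (letter_series j) \<in> lie_closure c (Leaf ` {..<r})" if "j < r" for j and x :: 'a
    using lie_closure_scale[OF lie_closure_gen[of "Leaf j" "Leaf ` {..<r}" c]] that by simp
  then show ?case using Leaf by (auto simp: act_letter_series[OF M] intro!: lie_closure_sum)
next
  case (Br s t)
  then show ?case by (simp add: act_diff act_times lie_closure_bracket)
qed

lemma act_basis:
  assumes "M \<in> carrier_mat r r" "k \<le> c" "j < length (basis k)"
  shows "\<exists>a. act M (lie_poly (basis k ! j)) = (\<Sum>i<length (basis k). scale (a i) (lie_poly (basis k ! i)))"
proof -
  have "hom_part k (act M (lie_poly (basis k ! j))) = act M (lie_poly (basis k ! j))"
    using basis_nth(1)[OF assms(3)] by (simp add: hom_part_act hom_part_lie_poly)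
  then show ?thesis
    using basis_span[OF act_lie_poly_closure[OF assms(1) basis_nth(2)[OF assms(3)]] assms(2)] by metis
qed

text \<open>The matrix of the substitution on the degree \<open>k\<close> part of the free Lie
  algebra. Its columns are chosen by \<open>SOME\<close>, but independence of the basis determines
  them (\<open>lie_mat_unique\<close>).\<close>

definition lie_mat :: "nat \<Rightarrow> 'a::comm_ring_1 mat \<Rightarrow> 'a mat" where
  "lie_mat k M = mat (length (basis k)) (length (basis k)) (\<lambda>(i, j).
     (SOME a. act M (lie_poly (basis k ! j)) = (\<Sum>i<length (basis k). scale (a i) (lie_poly (basis k ! i)))) i)"

lemma lie_mat_carrier [simp]: "lie_mat k M \<in> carrier_mat (length (basis k)) (length (basis k))"
  and dim_lie_mat [simp]: "dim_row (lie_mat k M) = length (basis k)" "dim_col (lie_mat k M) = length (basis k)"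
  by (simp_all add: lie_mat_def)

lemma lie_mat_col:
  assumes "M \<in> carrier_mat r r" "k \<le> c" "j < length (basis k)"
  shows "act M (lie_poly (basis k ! j)) = (\<Sum>i<length (basis k). scale (lie_mat k M $$ (i, j)) (lie_poly (basis k ! i)))"
  using someI_ex[OF act_basis[OF assms]] assms(3) by (simp add: lie_mat_def)

lemma lie_mat_unique:
  assumes "M \<in> carrier_mat r r" "k \<le> c" "A \<in> carrier_mat (length (basis k)) (length (basis k))"
    and "\<And>j. j < length (basis k) \<Longrightarrow>
      act M (lie_poly (basis k ! j)) = (\<Sum>i<length (basis k). scale (A $$ (i, j)) (lie_poly (basis k ! i)))"
  shows "lie_mat k M = A"
proof (rule eq_matI)
  fix i j assume "i < dim_row A" "j < dim_col A"
  then have ij: "i < length (basis k)" "j < length (basis k)" using assms(3) by auto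
  have "(\<Sum>i<length (basis k). scale (lie_mat k M $$ (i, j) - A $$ (i, j)) (lie_poly (basis k ! i))) = 0"
    using assms(4)[OF ij(2)] lie_mat_col[OF assms(1,2) ij(2)] by (simp add: scale_diff_left sum_subtractf)
  then have "lie_mat k M $$ (i, j) - A $$ (i, j) = 0"
    by (rule basis_independent[rotated]) (use ij in auto)
  then show "lie_mat k M $$ (i, j) = A $$ (i, j)" by simp
qed (use assms in auto)

lemma act_lie_comb:
  assumes "M \<in> carrier_mat r r" "k \<le> c" "x \<in> carrier_vec (length (basis k))"
  shows "act M (\<Sum>j<length (basis k). scale (x $ j) (lie_poly (basis k ! j))) =
    (\<Sum>i<length (basis k). scale ((lie_mat k M *\<^sub>v x) $ i) (lie_poly (basis k ! i)))"
proof -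
  let ?n = "length (basis k)"
  have "act M (\<Sum>j<?n. scale (x $ j) (lie_poly (basis k ! j))) =
    (\<Sum>j<?n. \<Sum>i<?n. scale (lie_mat k M $$ (i, j) * x $ j) (lie_poly (basis k ! i)))"
    unfolding act_sum act_scale
    by (rule sum.cong) (simp_all add: lie_mat_col[OF assms(1,2)] scale_sum_right scale_scale mult.commute)
  also have "\<dots> = (\<Sum>i<?n. \<Sum>j<?n. scale (lie_mat k M $$ (i, j) * x $ j) (lie_poly (basis k ! i)))"
    by (rule sum.swap)
  also have "\<dots> = (\<Sum>i<?n. scale ((lie_mat k M *\<^sub>v x) $ i) (lie_poly (basis k ! i)))"
    by (rule sum.cong) (use assms(3) in \<open>auto simp: scalar_prod_def scale_sum_left atLeast0LessThan\<close>)
  finally show ?thesis .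
qed

lemma lie_mat_mult:
  assumes "A \<in> carrier_mat r r" "B \<in> carrier_mat r r" "k \<le> c"
  shows "lie_mat k (A * B) = lie_mat k A * lie_mat k B"
proof (rule lie_mat_unique)
  fix j assume j: "j < length (basis k)"
  have "act (A * B) (lie_poly (basis k ! j)) = act A (act B (lie_poly (basis k ! j)))"
    by (rule act_mult) (use assms in auto)
  also have "act B (lie_poly (basis k ! j)) =
      (\<Sum>i<length (basis k). scale (col (lie_mat k B) j $ i) (lie_poly (basis k ! i)))"
    unfolding lie_mat_col[OF assms(2,3) j] using j by (intro sum.cong) auto
  also have "act A \<dots> = (\<Sum>i<length (basis k).
      scale ((lie_mat k A *\<^sub>v col (lie_mat k B) j) $ i) (lie_poly (basis k ! i)))"
    by (rule act_lie_comb[OF assms(1,3), of "col (lie_mat k B) j"]) (rule carrier_vecI, simp only: dim_col dim_lie_mat)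
  also have "\<dots> = (\<Sum>i<length (basis k). scale ((lie_mat k A * lie_mat k B) $$ (i, j)) (lie_poly (basis k ! i)))"
    using j by (intro sum.cong) auto
  finally show "act (A * B) (lie_poly (basis k ! j)) = \<dots>" .
qed (use assms in auto)

lemma lie_mat_one:
  assumes "k \<le> c"
  shows "lie_mat k (1\<^sub>m r) = (1\<^sub>m (length (basis k)) :: 'a::comm_ring_1 mat)"
proof (rule lie_mat_unique)
  fix j assume j: "j < length (basis k)"
  have "act (1\<^sub>m r) (lie_poly (basis k ! j)) = (lie_poly (basis k ! j) :: 'a ncs)"
  proof (rule ncs_eqI)
    fix w
    have "coef (lie_poly (basis k ! j) :: 'a ncs) w = 0" if "\<not> set w \<subseteq> {..<r}"
      using basis_nth(2)[OF j] that lie_poly_support by (metis set_mset_mset)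
    then show "coef (act (1\<^sub>m r) (lie_poly (basis k ! j))) w = coef (lie_poly (basis k ! j) :: 'a ncs) w"
      by (simp add: lact_one)
  qed
  also have "\<dots> = (\<Sum>i<length (basis k). if i = j then lie_poly (basis k ! i) else 0)"
    using j by simp
  also have "\<dots> = (\<Sum>i<length (basis k). scale (1\<^sub>m (length (basis k)) $$ (i, j)) (lie_poly (basis k ! i)))"
    by (rule sum.cong) (use j in auto)
  finally show "act (1\<^sub>m r) (lie_poly (basis k ! j)) = \<dots>" .
qed (use assms in auto)

text \<open>\<open>lie_mat k\<close> respects products and the identity, so conjugation by
  \<open>P\<close> turns into conjugation by \<open>lie_mat k P\<close>.\<close>

lemma det_lie_mat_similar:
  assumes "A \<in> carrier_mat r r" "similar_mat A B" "k \<le> c"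
  shows "det (1\<^sub>m (length (basis k)) - lie_mat k A) = det (1\<^sub>m (length (basis k)) - lie_mat k B)"
proof -
  let ?n = "length (basis k)"
  from similar_matD[OF assms(2)] obtain n P Q where *: "{A, B, P, Q} \<subseteq> carrier_mat n n" "P * Q = 1\<^sub>m n" "Q * P = 1\<^sub>m n" "A = P * B * Q"
    by blast
  then have n: "n = r" using assms(1) by auto
  have c: "P \<in> carrier_mat r r" "B \<in> carrier_mat r r" "Q \<in> carrier_mat r r" using * n by auto
  let ?L = "lie_mat k"
  have PQ: "?L P * ?L Q = 1\<^sub>m ?n" "?L Q * ?L P = 1\<^sub>m ?n"
    using * n lie_mat_mult[OF c(1,3) assms(3)] lie_mat_mult[OF c(3,1) assms(3)] lie_mat_one[OF assms(3), where 'a = 'a]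
    by simp_all
  have "?L A = ?L P * ?L B * ?L Q"
    using *(4) lie_mat_mult[OF c(1,2) assms(3)] lie_mat_mult[OF mult_carrier_mat[OF c(1,2)] c(3) assms(3)]
    by simp
  moreover have "?L P * (1\<^sub>m ?n - ?L B) * ?L Q = ?L P * ?L Q - ?L P * ?L B * ?L Q"
    using mult_minus_distrib_mat[OF lie_mat_carrier[of k P] one_carrier_mat lie_mat_carrier[of k B]]
      minus_mult_distrib_mat[OF lie_mat_carrier[of k P] mult_carrier_mat[OF lie_mat_carrier[of k P] lie_mat_carrier[of k B]]
        lie_mat_carrier[of k Q]]
    by simp
  ultimately have "1\<^sub>m ?n - ?L A = ?L P * (1\<^sub>m ?n - ?L B) * ?L Q" using PQ by simp
  then have "similar_mat (1\<^sub>m ?n - ?L A) (1\<^sub>m ?n - ?L B)"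
    by (intro similar_matI[OF _ PQ]) (auto intro!: minus_carrier_mat)
  then show ?thesis by (rule det_similar)
qed

text \<open>Up to Lie polynomials of smaller letter sum, \<open>T\<close> multiplies
  \<open>lie_poly t\<close> by the diagonal product along \<open>t\<close>. In the sorted basis this
  gives an upper triangular matrix, in which different trees of equal letter sum do not mix.\<close>

lemma det_lie_mat_triangular:
  fixes T :: "'a::comm_ring_1 mat"
  assumes T: "upper_triangular T" "T \<in> carrier_mat r r" and k: "k \<le> c"
  shows "det (1\<^sub>m (length (basis k)) - lie_mat k T) = (\<Prod>t\<leftarrow>basis k. 1 - (\<Prod>a\<leftarrow>foliage t. T $$ (a, a)))"
proof -
  let ?n = "length (basis k)" and ?P = "\<lambda>i. lie_poly (basis k ! i) :: 'a ncs"
  define \<sigma> where "\<sigma> i = sum_list (foliage (basis k ! i))" for i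
  define d where "d i = (\<Prod>a\<leftarrow>foliage (basis k ! i). T $$ (a, a))" for i
  have supp: "sum_list u = \<sigma> i" if "coef (?P i) u \<noteq> 0" for u i
    using lie_poly_support[OF that] by (metis \<sigma>_def sum_mset_sum_list)
  have entry: "lie_mat k T $$ (i, j) = (if i = j then d j else 0)" if ij: "i < ?n" "j \<le> i" for i j
  proof -
    have j: "j < ?n" using ij by simp
    \<comment> \<open>Words of letter sum at least \<open>\<sigma> j\<close> see only the basis
      trees in \<open>I\<close>, and on those words the difference
      \<open>act T (?P j) - scale (d j) (?P j)\<close> vanishes. Independence of the trees in
      \<open>I\<close> then forces their coefficients to be 0.\<close>
    define I where "I = {i. i < ?n \<and> \<sigma> j \<le> \<sigma> i}"
    define x where "x i = lie_mat k T $$ (i, j) - (if i = j then d j else 0)" for i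
    have g: "act T (?P j) - scale (d j) (?P j) = (\<Sum>i<?n. scale (x i) (?P i))"
    proof -
      have "scale (d j) (?P j) = (\<Sum>i<?n. if i = j then scale (d j) (?P i) else 0)" using j by simp
      also have "\<dots> = (\<Sum>i<?n. scale (if i = j then d j else 0) (?P i))" by (rule sum.cong) auto
      finally show ?thesis using lie_mat_col[OF T(2) k j] by (simp add: x_def scale_diff_left sum_subtractf)
    qed
    have "(\<Sum>i\<in>I. scale (x i) (?P i)) = 0"
    proof (rule ncs_eqI)
      fix u
      show "coef (\<Sum>i\<in>I. scale (x i) (?P i)) u = coef 0 u"
      proof (cases "\<sigma> j \<le> sum_list u")
        case True
        have "coef (\<Sum>i\<in>I. scale (x i) (?P i)) u = coef (\<Sum>i<?n. scale (x i) (?P i)) u"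
          unfolding coef_sum coef_scale
          by (rule sum.mono_neutral_left) (use True in \<open>auto simp: I_def, metis mult_zero_right supp\<close>)
        also have "\<dots> = 0"
          unfolding g[symmetric]
          using act_triangular_lie_poly[OF T basis_nth(2)[OF j], of u] True
          by (simp add: d_def \<sigma>_def)
        finally show ?thesis by simp
      next
        case False
        have "x i * coef (?P i) u = 0" if "i \<in> I" for i
          using that supp[of i u] False by (cases "coef (?P i) u = 0") (auto simp: I_def)
        then show ?thesis by simp
      qed
    qed
    then have "x i = 0"
      by (rule basis_independent[rotated]) (use ij basis_sorted in \<open>auto simp: I_def \<sigma>_def\<close>)
    then show ?thesis by (simp add: x_def)
  qed
  have "upper_triangular (1\<^sub>m ?n - lie_mat k T)"
    unfolding upper_triangular_def using entry by auto
  then have "det (1\<^sub>m ?n - lie_mat k T) = prod_list (diag_mat (1\<^sub>m ?n - lie_mat k T))"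
    by (rule det_upper_triangular) (auto intro!: minus_carrier_mat)
  also have "diag_mat (1\<^sub>m ?n - lie_mat k T) = map (\<lambda>t. 1 - (\<Prod>a\<leftarrow>foliage t. T $$ (a, a))) (basis k)"
    by (rule nth_equalityI) (auto simp: diag_mat_def entry d_def)
  finally show ?thesis .
qed

end

section \<open>Extension of scalars from the integers\<close>

lemma conv_of_int: "conv (\<lambda>v. of_int (f v)) (\<lambda>v. of_int (g v)) w = of_int (conv f g w)"
  by (induction w arbitrary: f) auto

lemma coef_lie_poly_of_int: "coef (lie_poly t :: 'a::comm_ring_1 ncs) w = of_int (coef (lie_poly t :: int ncs) w)"
proof (induction t arbitrary: w)
  case (Br s t)
  then have "coef (lie_poly s :: 'a ncs) = (\<lambda>v. of_int (coef (lie_poly s :: int ncs) v))"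
     "coef (lie_poly t :: 'a ncs) = (\<lambda>v. of_int (coef (lie_poly t :: int ncs) v))" by auto
  then show ?case by (simp add: coef_mult conv_of_int)
qed (simp add: letter_series_def)

lemma lact_of_int: "lact (map_mat of_int M) (\<lambda>v. of_int (f v)) w = of_int (lact M f w)"
  by (induction w arbitrary: f) auto

context hall_basis
begin

text \<open>The coefficients of Lie polynomials are integers that do not depend on the ring, so the
  integer matrix satisfies the defining equations over every ring.\<close>

lemma lie_mat_of_int:
  assumes "M \<in> carrier_mat r r" "k \<le> c"
  shows "lie_mat k (map_mat of_int M :: 'a::comm_ring_1 mat) = map_mat of_int (lie_mat k M)"
proof (rule lie_mat_unique)
  fix j assume j: "j < length (basis k)"
  show "act (map_mat of_int M) (lie_poly (basis k ! j) :: 'a ncs) =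
      (\<Sum>i<length (basis k). scale (map_mat of_int (lie_mat k M) $$ (i, j)) (lie_poly (basis k ! i)))"
  proof (rule ncs_eqI)
    fix w
    have "coef (lie_poly (basis k ! j) :: 'a ncs) = (\<lambda>v. of_int (coef (lie_poly (basis k ! j) :: int ncs) v))"
      by (rule ext) (rule coef_lie_poly_of_int)
    then have "coef (act (map_mat of_int M) (lie_poly (basis k ! j) :: 'a ncs)) w =
        of_int (coef (act M (lie_poly (basis k ! j))) w)"
      by (simp add: lact_of_int)
    also have "\<dots> = coef (\<Sum>i<length (basis k). scale (map_mat of_int (lie_mat k M) $$ (i, j)) (lie_poly (basis k ! i)) :: 'a ncs) w"
      unfolding lie_mat_col[OF assms j] using j
      by (simp add: coef_lie_poly_of_int[where 'a = 'a])
    finally show "coef (act (map_mat of_int M) (lie_poly (basis k ! j) :: 'a ncs)) w = \<dots>" .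
  qed
qed (use assms in auto)

text \<open>Integer matrices need not be triangularizable over the integers. The Schur form over the
  complex numbers is upper triangular with the given eigenvalues, in the given order, on the
  diagonal, and similarity preserves the determinant.\<close>

lemma det_lie_mat_eigenvalues:
  fixes M :: "int mat" and ev :: "nat \<Rightarrow> complex"
  assumes M: "M \<in> carrier_mat r r" and k: "k \<le> c"
    and cp: "char_poly (map_mat complex_of_int M) = (\<Prod>i<r. [:- ev i, 1:])"
  shows "of_int (det (1\<^sub>m (length (basis k)) - lie_mat k M)) = (\<Prod>t\<leftarrow>basis k. 1 - (\<Prod>a\<leftarrow>foliage t. ev a))"
proof -
  let ?n = "length (basis k)" and ?M = "map_mat complex_of_int M"
  have Mc: "?M \<in> carrier_mat r r" using M by simp
  have "char_poly ?M = (\<Prod>e\<leftarrow>map ev [0..<r]. [:- e, 1:])"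
    unfolding cp by (simp add: prod.list_conv_set_nth atLeast0LessThan)
  moreover obtain B P Q where BPQ: "schur_decomposition ?M (map ev [0..<r]) = (B, P, Q)"
    by (cases "schur_decomposition ?M (map ev [0..<r])") auto
  ultimately have B: "similar_mat_wit ?M B P Q" "upper_triangular B" "diag_mat B = map ev [0..<r]"
    using schur_decomposition[OF Mc _ BPQ] by auto
  have Bc: "B \<in> carrier_mat r r" using similar_mat_witD2[OF Mc B(1)] by auto
  have diag: "B $$ (a, a) = ev a" if "a < r" for a
    using B(3) Bc that by (metis (no_types, lifting) add_0 carrier_matD(1) diag_mat_def diff_zero length_map length_upt nth_map nth_upt)
  have "of_int (det (1\<^sub>m ?n - lie_mat k M)) = det (map_mat complex_of_int (1\<^sub>m ?n - lie_mat k M))"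
    by simp
  also have "map_mat complex_of_int (1\<^sub>m ?n - lie_mat k M) = 1\<^sub>m ?n - lie_mat k ?M"
    unfolding lie_mat_of_int[OF M k] by (rule eq_matI) auto
  also have "det \<dots> = det (1\<^sub>m ?n - lie_mat k B)"
    by (rule det_lie_mat_similar[OF Mc _ k]) (use B(1) in \<open>auto simp: similar_mat_def\<close>)
  also have "\<dots> = (\<Prod>t\<leftarrow>basis k. 1 - (\<Prod>a\<leftarrow>foliage t. B $$ (a, a)))"
    by (rule det_lie_mat_triangular[OF B(2) Bc k])
  also have "\<dots> = (\<Prod>t\<leftarrow>basis k. 1 - (\<Prod>a\<leftarrow>foliage t. ev a))"
  proof (intro arg_cong[where f = prod_list] map_cong refl)
    fix t assume "t \<in> set (basis k)"
    then have "set (foliage t) \<subseteq> {..<r}" using hs_tree by (auto simp: set_basis)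
    then have "map (\<lambda>a. B $$ (a, a)) (foliage t) = map ev (foliage t)"
      using diag by (intro map_cong) auto
    then show "1 - (\<Prod>a\<leftarrow>foliage t. B $$ (a, a)) = 1 - (\<Prod>a\<leftarrow>foliage t. ev a)" by (simp only:)
  qed
  finally show ?thesis .
qed

end

section \<open>Symmetry of the characteristic polynomials\<close>

definition mono_eval :: "(nat \<Rightarrow> 'a::comm_ring_1) \<Rightarrow> (nat \<Rightarrow>\<^sub>0 nat) \<Rightarrow> 'a" where
  "mono_eval x m = (\<Prod>i\<in>Poly_Mapping.keys m. x i ^ Poly_Mapping.lookup m i)"

lemma mono_eval_superset:
  assumes "finite A" "Poly_Mapping.keys m \<subseteq> A"
  shows "mono_eval x m = (\<Prod>i\<in>A. x i ^ Poly_Mapping.lookup m i)"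
  unfolding mono_eval_def
  by (rule prod.mono_neutral_left) (use assms in \<open>auto simp: in_keys_iff\<close>)

lemma mono_eval_add: "mono_eval x (m + n) = mono_eval x m * mono_eval x n"
proof -
  let ?A = "Poly_Mapping.keys m \<union> Poly_Mapping.keys n"
  have A: "finite ?A" "Poly_Mapping.keys (m + n) \<subseteq> ?A" using Poly_Mapping.keys_add[of m n] by auto
  show ?thesis
    unfolding mono_eval_superset[OF A] mono_eval_superset[OF A(1) Un_upper1] mono_eval_superset[OF A(1) Un_upper2]
    by (simp add: lookup_add power_add prod.distrib)
qed

lemma mpoly_eval_superset:
  assumes "finite A" "Poly_Mapping.keys p \<subseteq> A"
  shows "mpoly_eval x p = (\<Sum>m\<in>A. of_int (Poly_Mapping.lookup p m) * mono_eval x m)"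
  unfolding mpoly_eval_def mono_eval_def
  by (rule sum.mono_neutral_left) (use assms in \<open>auto simp: in_keys_iff\<close>)

lemma mpoly_eval_add: "mpoly_eval x (p + q) = mpoly_eval x p + mpoly_eval x q"
proof -
  let ?A = "Poly_Mapping.keys p \<union> Poly_Mapping.keys q"
  have A: "finite ?A" "Poly_Mapping.keys (p + q) \<subseteq> ?A" using Poly_Mapping.keys_add[of p q] by auto
  show ?thesis
    unfolding mpoly_eval_superset[OF A] mpoly_eval_superset[OF A(1) Un_upper1] mpoly_eval_superset[OF A(1) Un_upper2]
    by (simp add: lookup_add sum.distrib algebra_simps)
qed

lemma mpoly_eval_0 [simp]: "mpoly_eval x 0 = 0"
  by (simp add: mpoly_eval_def)

lemma mpoly_eval_diff: "mpoly_eval x (p - q) = mpoly_eval x p - mpoly_eval x q"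
  by (metis add_diff_cancel_right' diff_add_cancel mpoly_eval_add)

lemma mpoly_eval_sum: "mpoly_eval x (sum f A) = (\<Sum>a\<in>A. mpoly_eval x (f a))"
  by (induction A rule: infinite_finite_induct) (auto simp: mpoly_eval_add)

lemma mpoly_eval_single: "mpoly_eval x (Poly_Mapping.single m a) = of_int a * mono_eval x m"
  by (subst mpoly_eval_superset[of "{m}"]) auto

lemma mpoly_eval_1 [simp]: "mpoly_eval x 1 = 1"
  using mpoly_eval_single[of x 0 1] by (simp add: mono_eval_def)

lemma poly_mapping_sum_singles:
  "p = (\<Sum>m\<in>Poly_Mapping.keys p. Poly_Mapping.single m (Poly_Mapping.lookup p m))"
  by (rule poly_mapping_eqI) (simp add: lookup_sum lookup_single when_def in_keys_iff)

lemma mpoly_eval_mult: "mpoly_eval x (p * q) = mpoly_eval x p * mpoly_eval x q"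
proof -
  have single: "mpoly_eval x (Poly_Mapping.single m a * q) = mpoly_eval x (Poly_Mapping.single m a) * mpoly_eval x q" for m a
  proof -
    have "Poly_Mapping.single m a * q = (\<Sum>n\<in>Poly_Mapping.keys q. Poly_Mapping.single (m + n) (a * Poly_Mapping.lookup q n))"
      by (subst poly_mapping_sum_singles[of q]) (simp add: sum_distrib_left mult_single)
    then have "mpoly_eval x (Poly_Mapping.single m a * q) =
        (\<Sum>n\<in>Poly_Mapping.keys q. of_int a * mono_eval x m * (of_int (Poly_Mapping.lookup q n) * mono_eval x n))"
      by (simp add: mpoly_eval_sum mpoly_eval_single mono_eval_add algebra_simps)
    also have "\<dots> = mpoly_eval x (Poly_Mapping.single m a) * mpoly_eval x q"
      by (simp add: mpoly_eval_single sum_distrib_left mpoly_eval_superset[of "Poly_Mapping.keys q" q])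
    finally show ?thesis .
  qed
  have "p * q = (\<Sum>m\<in>Poly_Mapping.keys p. Poly_Mapping.single m (Poly_Mapping.lookup p m) * q)"
    by (subst poly_mapping_sum_singles[of p]) (simp add: sum_distrib_right)
  then have "mpoly_eval x (p * q) =
      (\<Sum>m\<in>Poly_Mapping.keys p. mpoly_eval x (Poly_Mapping.single m (Poly_Mapping.lookup p m))) * mpoly_eval x q"
    by (simp add: mpoly_eval_sum single sum_distrib_right)
  then show ?thesis by (metis mpoly_eval_sum poly_mapping_sum_singles)
qed

lemma mpoly_eval_prod_list: "mpoly_eval x (prod_list ps) = (\<Prod>p\<leftarrow>ps. mpoly_eval x p)"
  by (induction ps) (auto simp: mpoly_eval_mult)

definition mvar :: "nat \<Rightarrow> int_mpoly" where
  "mvar i = Poly_Mapping.single (Poly_Mapping.single i 1) 1"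

lemma mpoly_eval_mvar [simp]: "mpoly_eval x (mvar i) = x i"
  by (simp add: mvar_def mpoly_eval_single mono_eval_def)

lemma mpolys_closed:
  "1 \<in> mpolys r" "i < r \<Longrightarrow> mvar i \<in> mpolys r"
  "p \<in> mpolys r \<Longrightarrow> q \<in> mpolys r \<Longrightarrow> p - q \<in> mpolys r"
  "p \<in> mpolys r \<Longrightarrow> q \<in> mpolys r \<Longrightarrow> p * q \<in> mpolys r"
proof -
  show "1 \<in> mpolys r" "i < r \<Longrightarrow> mvar i \<in> mpolys r"
    by (auto simp: mpolys_def mvar_def)
  assume p: "p \<in> mpolys r" "q \<in> mpolys r"
  show "p - q \<in> mpolys r" using p keys_diff[of p q] by (auto simp: mpolys_def)
  show "p * q \<in> mpolys r"
    unfolding mpolys_def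
  proof safe
    fix m i assume m: "m \<in> Poly_Mapping.keys (p * q)" "i \<in> Poly_Mapping.keys m"
    then obtain a b where "m = a + b" "a \<in> Poly_Mapping.keys p" "b \<in> Poly_Mapping.keys q"
      using keys_mult[of p q] by blast
    then show "i < r" using p m(2) Poly_Mapping.keys_add[of a b] unfolding mpolys_def by blast
  qed
qed

lemma mpolys_prod_list: "set ps \<subseteq> mpolys r \<Longrightarrow> prod_list ps \<in> mpolys r"
  by (induction ps) (auto intro: mpolys_closed)

lemma lookup_map_key: "inj f \<Longrightarrow> Poly_Mapping.lookup (Poly_Mapping.map_key f p) i = Poly_Mapping.lookup p (f i)"
  by (simp add: map_key.rep_eq)

lemma prod_single_one:
  "finite A \<Longrightarrow> (\<Prod>i\<in>A. Poly_Mapping.single (f i) (1::int)) = Poly_Mapping.single (\<Sum>i\<in>A. f i) 1"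
  by (induction A rule: finite_induct) (auto simp: mult_single)

lemma mvar_power: "mvar i ^ e = Poly_Mapping.single (Poly_Mapping.single i e) 1"
  by (induction e) (auto simp: mvar_def mult_single simp flip: single_add)

lemma index_mult_mat_sum:
  "A \<in> carrier_mat n n \<Longrightarrow> B \<in> carrier_mat n n \<Longrightarrow> i < n \<Longrightarrow> j < n \<Longrightarrow>
     (A * B) $$ (i, j) = (\<Sum>m<n. A $$ (i, m) * B $$ (m, j))"
  by (simp add: scalar_prod_def atLeast0LessThan)

text \<open>The target ring of \<open>mpoly_eval\<close> may be the polynomial ring itself.
  Evaluation at permuted variables expresses there the permutation of exponents by which symmetry is
  defined.\<close>

lemma lookup_mpoly_eval_permute:
  assumes \<pi>: "bij \<pi>"
  shows "Poly_Mapping.lookup (mpoly_eval (\<lambda>i. mvar (\<pi> i)) p) n = Poly_Mapping.lookup p (Poly_Mapping.map_key \<pi> n)"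
proof -
  have inj: "inj \<pi>" "inj (inv_into UNIV \<pi>)" using \<pi> by (auto simp: bij_is_inj bij_imp_bij_inv)
  have mono: "mono_eval (\<lambda>i. mvar (\<pi> i)) m = Poly_Mapping.single (Poly_Mapping.map_key (inv_into UNIV \<pi>) m) 1" for m
  proof -
    have "mono_eval (\<lambda>i. mvar (\<pi> i)) m =
        Poly_Mapping.single (\<Sum>i\<in>Poly_Mapping.keys m. Poly_Mapping.single (\<pi> i) (Poly_Mapping.lookup m i)) 1"
      by (simp add: mono_eval_def mvar_power prod_single_one)
    also have "(\<Sum>i\<in>Poly_Mapping.keys m. Poly_Mapping.single (\<pi> i) (Poly_Mapping.lookup m i)) = Poly_Mapping.map_key (inv_into UNIV \<pi>) m"
    proof (rule poly_mapping_eqI)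
      fix j
      have "(\<pi> i = j) \<longleftrightarrow> i = inv_into UNIV \<pi> j" for i
        using \<pi> by (metis bij_inv_eq_iff)
      then show "Poly_Mapping.lookup (\<Sum>i\<in>Poly_Mapping.keys m. Poly_Mapping.single (\<pi> i) (Poly_Mapping.lookup m i)) j
          = Poly_Mapping.lookup (Poly_Mapping.map_key (inv_into UNIV \<pi>) m) j"
        by (simp add: lookup_sum lookup_single when_def lookup_map_key inj in_keys_iff)
    qed
    finally show ?thesis .
  qed
  have key: "Poly_Mapping.map_key (inv_into UNIV \<pi>) m = n \<longleftrightarrow> m = Poly_Mapping.map_key \<pi> n" for m
  proof
    assume "Poly_Mapping.map_key (inv_into UNIV \<pi>) m = n"
    then show "m = Poly_Mapping.map_key \<pi> n"
      using inj by (auto intro!: poly_mapping_eqI simp: lookup_map_key)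
  next
    assume "m = Poly_Mapping.map_key \<pi> n"
    then show "Poly_Mapping.map_key (inv_into UNIV \<pi>) m = n"
      using inj \<pi> by (auto intro!: poly_mapping_eqI simp: lookup_map_key bij_is_surj surj_f_inv_f)
  qed
  have "mpoly_eval (\<lambda>i. mvar (\<pi> i)) p =
      (\<Sum>m\<in>Poly_Mapping.keys p. of_int (Poly_Mapping.lookup p m) * mono_eval (\<lambda>i. mvar (\<pi> i)) m)"
    by (rule mpoly_eval_superset) auto
  also have "\<dots> = (\<Sum>m\<in>Poly_Mapping.keys p.
      Poly_Mapping.single (Poly_Mapping.map_key (inv_into UNIV \<pi>) m) (Poly_Mapping.lookup p m))"
    unfolding mono by (rule sum.cong) (auto simp: mult_single simp flip: single_of_int)
  also have "Poly_Mapping.lookup \<dots> n = Poly_Mapping.lookup p (Poly_Mapping.map_key \<pi> n)"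
    by (simp add: lookup_sum lookup_single when_def key in_keys_iff)
  finally show ?thesis .
qed

context hall_basis
begin

text \<open>The polynomial \<open>f_{r,k}\<close>: the determinant of 1 minus the action in degree
  \<open>k\<close> of the generic diagonal matrix \<open>diag(x_0, x_1, ...)\<close>. The product is
  taken over the chosen trees, so its symmetry is not evident.\<close>

definition lie_char :: "nat \<Rightarrow> int_mpoly" where
  "lie_char k = (\<Prod>t\<leftarrow>basis k. 1 - (\<Prod>a\<leftarrow>foliage t. mvar a))"

lemma mpoly_eval_lie_char: "mpoly_eval x (lie_char k) = (\<Prod>t\<leftarrow>basis k. 1 - (\<Prod>a\<leftarrow>foliage t. x a))"
  by (simp add: lie_char_def mpoly_eval_prod_list mpoly_eval_diff o_def)

text \<open>A permutation of the variables conjugates the generic diagonal matrix, so it does not change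
  the determinant, computed over the polynomial ring itself.\<close>

lemma lie_char_permute:
  assumes \<pi>: "\<pi> permutes {..<r}" and k: "k \<le> c"
  shows "(\<Prod>t\<leftarrow>basis k. 1 - (\<Prod>a\<leftarrow>foliage t. mvar (\<pi> a))) = lie_char k"
proof -
  define D where "D x = mat r r (\<lambda>(i, j). if i = j then x i else 0)" for x :: "nat \<Rightarrow> int_mpoly"
  have D: "upper_triangular (D x)" "D x \<in> carrier_mat r r" for x
    by (auto simp: D_def upper_triangular_def)
  have det: "det (1\<^sub>m (length (basis k)) - lie_mat k (D x)) = (\<Prod>t\<leftarrow>basis k. 1 - (\<Prod>a\<leftarrow>foliage t. x a))" for x
  proof -
    have "(\<Prod>a\<leftarrow>foliage t. D x $$ (a, a)) = (\<Prod>a\<leftarrow>foliage t. x a)" if "t \<in> set (basis k)" for t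
    proof -
      have "set (foliage t) \<subseteq> {..<r}" using that hs_tree by (auto simp: set_basis)
      then have "map (\<lambda>a. D x $$ (a, a)) (foliage t) = map x (foliage t)"
        by (intro map_cong) (auto simp: D_def)
      then show ?thesis by (simp only:)
    qed
    then have "map (\<lambda>t. 1 - (\<Prod>a\<leftarrow>foliage t. D x $$ (a, a))) (basis k) = map (\<lambda>t. 1 - (\<Prod>a\<leftarrow>foliage t. x a)) (basis k)"
      by (intro map_cong) auto
    then show ?thesis using det_lie_mat_triangular[OF D k] by (simp only:)
  qed
  define P where "P = mat r r (\<lambda>(i, j). if j = \<pi> i then 1 else 0 :: int_mpoly)"
  define Q where "Q = mat r r (\<lambda>(i, j). if i = \<pi> j then 1 else 0 :: int_mpoly)"
  have PQc: "P \<in> carrier_mat r r" "Q \<in> carrier_mat r r" by (auto simp: P_def Q_def)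
  have \<pi>r: "\<pi> i < r \<longleftrightarrow> i < r" for i using permutes_in_image[OF \<pi>, of i] by simp
  have \<pi>i: "\<pi> i = \<pi> j \<longleftrightarrow> i = j" for i j using permutes_inj[OF \<pi>] by (auto dest: injD)
  have PDQ: "P * D x * Q = D (\<lambda>i. x (\<pi> i))" for x
  proof (rule eq_matI)
    fix i j assume "i < dim_row (D (\<lambda>i. x (\<pi> i)))" "j < dim_col (D (\<lambda>i. x (\<pi> i)))"
    then have ij: "i < r" "j < r" by (auto simp: D_def)
    have PD: "(P * D x) $$ (i, m) = (if m = \<pi> i then x m else 0)" if "m < r" for m
    proof -
      have "(P * D x) $$ (i, m) = (\<Sum>l<r. P $$ (i, l) * D x $$ (l, m))"
        using ij that PQc D(2)[of x] by (simp add: scalar_prod_def atLeast0LessThan)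
      also have "\<dots> = (\<Sum>l<r. if l = m then if m = \<pi> i then x m else 0 else 0)"
        by (rule sum.cong) (use ij that in \<open>auto simp: P_def D_def\<close>)
      finally show ?thesis using that by simp
    qed
    have "(P * D x * Q) $$ (i, j) = (\<Sum>m<r. (P * D x) $$ (i, m) * Q $$ (m, j))"
      by (rule index_mult_mat_sum) (use ij PQc D(2)[of x] in auto)
    also have "\<dots> = (\<Sum>m<r. if m = \<pi> i then (if i = j then x m else 0) else 0)"
      by (rule sum.cong) (use ij \<pi>i in \<open>auto simp: PD Q_def\<close>)
    finally show "(P * D x * Q) $$ (i, j) = D (\<lambda>i. x (\<pi> i)) $$ (i, j)"
      using ij \<pi>r by (simp add: D_def)
  qed (auto simp: D_def P_def Q_def)
  \<comment> \<open>The identity for \<open>P * D x * Q\<close> with all diagonal entries 1 already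
    contains \<open>P * Q = 1\<close>.\<close>
  have D1: "D (\<lambda>i. 1) = 1\<^sub>m r" by (rule eq_matI) (auto simp: D_def)
  have PQ: "P * Q = 1\<^sub>m r" using PDQ[of "\<lambda>i. 1"] PQc by (simp add: D1)
  have QP: "Q * P = 1\<^sub>m r"
  proof (rule eq_matI)
    fix i j assume "i < dim_row (1\<^sub>m r :: int_mpoly mat)" "j < dim_col (1\<^sub>m r :: int_mpoly mat)"
    then have ij: "i < r" "j < r" by auto
    obtain l where l: "\<pi> l = i" using permutes_surj[OF \<pi>] by (metis surjD)
    have "(Q * P) $$ (i, j) = (\<Sum>m<r. Q $$ (i, m) * P $$ (m, j))"
      by (rule index_mult_mat_sum) (use ij PQc in auto)
    also have "\<dots> = (\<Sum>m<r. if m = l then if i = j then 1 else 0 else 0)"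
      by (rule sum.cong) (use ij \<pi>i l in \<open>auto simp: P_def Q_def\<close>)
    finally show "(Q * P) $$ (i, j) = 1\<^sub>m r $$ (i, j)" using ij l \<pi>r by auto
  qed (auto simp: P_def Q_def)
  have "similar_mat (D (\<lambda>i. mvar (\<pi> i))) (D mvar)"
    by (rule similar_matI[OF _ PQ QP]) (use PDQ PQc D in auto)
  from det_lie_mat_similar[OF D(2) this k] show ?thesis by (simp add: det lie_char_def)
qed

lemma lie_char_symmetric:
  assumes "k \<le> c"
  shows "lie_char k \<in> symmetric_mpolys r"
proof -
  have "(\<Prod>a\<leftarrow>foliage t. mvar a) \<in> mpolys r" if "t \<in> set (basis k)" for t
  proof (rule mpolys_prod_list)
    have "set (foliage t) \<subseteq> {..<r}" using that hs_tree by (auto simp: set_basis)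
    then show "set (map mvar (foliage t)) \<subseteq> mpolys r" by (auto intro: mpolys_closed)
  qed
  then have "lie_char k \<in> mpolys r"
    unfolding lie_char_def by (intro mpolys_prod_list) (auto intro: mpolys_closed)
  moreover have "Poly_Mapping.lookup (lie_char k) (Poly_Mapping.map_key \<pi> m) = Poly_Mapping.lookup (lie_char k) m"
    if "\<pi> permutes {..<r}" for \<pi> m
    using lookup_mpoly_eval_permute[OF permutes_bij[OF that], of "lie_char k" m]
    by (simp add: mpoly_eval_lie_char lie_char_permute[OF that assms])
  ultimately show ?thesis by (simp add: symmetric_mpolys_def)
qed

end

section \<open>Lower central series\<close>

definition commutator :: "('a, 'm) monoid_scheme \<Rightarrow> 'a \<Rightarrow> 'a \<Rightarrow> 'a" where
  "commutator G x y = x \<otimes>\<^bsub>G\<^esub> y \<otimes>\<^bsub>G\<^esub> inv\<^bsub>G\<^esub> x \<otimes>\<^bsub>G\<^esub> inv\<^bsub>G\<^esub> y"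

lemma lower_central_Suc_Suc:
  "lower_central G (Suc (Suc i)) =
     generate G {commutator G h k | h k. h \<in> lower_central G (Suc i) \<and> k \<in> carrier G}"
proof -
  have "(\<Union>h\<in>lower_central G (Suc i). \<Union>k\<in>carrier G.
      {h \<otimes>\<^bsub>G\<^esub> k \<otimes>\<^bsub>G\<^esub> inv\<^bsub>G\<^esub> h \<otimes>\<^bsub>G\<^esub> inv\<^bsub>G\<^esub> k}) =
      {commutator G h k | h k. h \<in> lower_central G (Suc i) \<and> k \<in> carrier G}"
    unfolding commutator_def by blast
  then show ?thesis by (simp add: commutator_subgroup_def)
qed

context group
begin

lemma inv_cancel_left: "x \<in> carrier G \<Longrightarrow> y \<in> carrier G \<Longrightarrow> inv x \<otimes> (x \<otimes> y) = y"
  and inv_cancel_right: "x \<in> carrier G \<Longrightarrow> y \<in> carrier G \<Longrightarrow> x \<otimes> (inv x \<otimes> y) = y"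
  by (simp_all flip: m_assoc)

lemmas group_simps = m_assoc inv_mult_group inv_cancel_left inv_cancel_right

lemma commutator_closed [simp]: "x \<in> carrier G \<Longrightarrow> y \<in> carrier G \<Longrightarrow> commutator G x y \<in> carrier G"
  by (simp add: commutator_def)

lemma commutator_mult_commute: "x \<in> carrier G \<Longrightarrow> y \<in> carrier G \<Longrightarrow> commutator G x y \<otimes> (y \<otimes> x) = x \<otimes> y"
  by (simp add: commutator_def group_simps)

lemma commutator_eq_one_iff:
  assumes "x \<in> carrier G" "y \<in> carrier G"
  shows "commutator G x y = \<one> \<longleftrightarrow> x \<otimes> y = y \<otimes> x"
proof
  assume "commutator G x y = \<one>"
  then show "x \<otimes> y = y \<otimes> x" using commutator_mult_commute[OF assms] assms by simp
next
  assume *: "x \<otimes> y = y \<otimes> x"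
  have "commutator G x y = (x \<otimes> y) \<otimes> (inv x \<otimes> inv y)" using assms by (simp add: commutator_def m_assoc)
  then show "commutator G x y = \<one>" unfolding * using assms by (simp add: group_simps)
qed

lemma conj_commutator:
  assumes "x \<in> carrier G" "y \<in> carrier G" "z \<in> carrier G"
  shows "z \<otimes> commutator G x y \<otimes> inv z = commutator G (z \<otimes> x \<otimes> inv z) (z \<otimes> y \<otimes> inv z)"
  using assms by (simp add: commutator_def group_simps)

lemma lower_central_normal: "lower_central G i \<lhd> G"
proof -
  have carrier: "carrier G \<lhd> G"
    by (simp add: normal_inv_iff subgroup_self)
  show ?thesis
  proof (induction i)
    case (Suc n)
    note IH = Suc.IH
    show ?case
    proof (cases n)
      case (Suc i)
      note step = IH[unfolded Suc]
      show ?thesis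
        unfolding Suc lower_central_Suc_Suc
      proof (rule normal_generateI)
        have sub: "lower_central G (Suc i) \<subseteq> carrier G"
          using step normal_imp_subgroup subgroup.subset by blast
        then show "{commutator G h k |h k. h \<in> lower_central G (Suc i) \<and> k \<in> carrier G} \<subseteq> carrier G"
          by auto
        fix h g assume "h \<in> {commutator G h k |h k. h \<in> lower_central G (Suc i) \<and> k \<in> carrier G}" and g: "g \<in> carrier G"
        then obtain a b where *: "h = commutator G a b" "a \<in> lower_central G (Suc i)" "b \<in> carrier G" by blast
        have "g \<otimes> a \<otimes> inv g \<in> lower_central G (Suc i)"
          using step * g by (meson normal.inv_op_closed2)
        moreover have "g \<otimes> h \<otimes> inv g = commutator G (g \<otimes> a \<otimes> inv g) (g \<otimes> b \<otimes> inv g)"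
          unfolding *(1) using * g sub by (intro conj_commutator) auto
        moreover have "g \<otimes> b \<otimes> inv g \<in> carrier G" using * g by simp
        ultimately show "g \<otimes> h \<otimes> inv g \<in> {commutator G h k |h k. h \<in> lower_central G (Suc i) \<and> k \<in> carrier G}"
          by blast
      qed
    qed (use carrier in simp)
  qed (use carrier in simp)
qed

lemma lower_central_subgroup: "subgroup (lower_central G i) G"
  using lower_central_normal normal_imp_subgroup by blast

lemma lower_central_carrier: "x \<in> lower_central G i \<Longrightarrow> x \<in> carrier G"
  by (rule subgroup.mem_carrier[OF lower_central_subgroup])

lemma commutator_lower_central_carrier:
  "1 \<le> i \<Longrightarrow> x \<in> lower_central G i \<Longrightarrow> y \<in> carrier G \<Longrightarrow> commutator G x y \<in> lower_central G (Suc i)"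
  by (cases i) (simp_all only: lower_central_Suc_Suc, simp, blast intro: generate.incl)

lemma lower_central_Suc_subset: "lower_central G (Suc i) \<subseteq> lower_central G i"
proof (cases i)
  case 0
  then show ?thesis by simp
next
  case (Suc j)
  have "commutator G h k \<in> lower_central G (Suc j)" if "h \<in> lower_central G (Suc j)" "k \<in> carrier G" for h k
  proof -
    have h: "h \<in> carrier G" using that lower_central_carrier by blast
    have "k \<otimes> inv h \<otimes> inv k \<in> lower_central G (Suc j)"
      by (rule normal.inv_op_closed2[OF lower_central_normal that(2) subgroup.m_inv_closed[OF lower_central_subgroup that(1)]])
    then have "h \<otimes> (k \<otimes> inv h \<otimes> inv k) \<in> lower_central G (Suc j)"
      by (rule subgroup.m_closed[OF lower_central_subgroup that(1)])
    then show ?thesis using h that by (simp add: commutator_def m_assoc)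
  qed
  then show ?thesis
    unfolding Suc lower_central_Suc_Suc
    by (intro generate_subgroup_incl[OF _ lower_central_subgroup]) auto
qed

lemma lower_central_antimono: "i \<le> j \<Longrightarrow> lower_central G j \<subseteq> lower_central G i"
  using lower_central_Suc_subset by (rule lift_Suc_antimono_le)

text \<open>If conjugation by \<open>u\<close> and \<open>x\<close> multiplies \<open>g\<close> by elements \<open>t\<close> and \<open>s\<close> that are sufficiently
  central, then the two orders of conjugating agree, so a commutator of \<open>u\<close> and \<open>x\<close> fixes \<open>g\<close>.\<close>

lemma commute_commutator_aux:
  assumes [simp]: "u \<in> carrier G" "x \<in> carrier G" "g \<in> carrier G" "s \<in> carrier G" "t \<in> carrier G"
    and ug: "u \<otimes> g = t \<otimes> (g \<otimes> u)" and xg: "x \<otimes> g = s \<otimes> (g \<otimes> x)"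
    and su: "u \<otimes> s = s \<otimes> u" and tx: "x \<otimes> t = t \<otimes> x" and ts: "t \<otimes> s = s \<otimes> t"
  shows "commutator G (inv u) (inv x) \<otimes> g = g \<otimes> commutator G (inv u) (inv x)"
proof -
  have "u \<otimes> x \<otimes> g = u \<otimes> s \<otimes> g \<otimes> x" by (simp add: m_assoc xg)
  also have "\<dots> = s \<otimes> t \<otimes> g \<otimes> (u \<otimes> x)" by (simp add: su) (simp add: m_assoc ug flip: m_assoc[of u g x])
  finally have 1: "u \<otimes> x \<otimes> g = s \<otimes> t \<otimes> g \<otimes> (u \<otimes> x)" .
  have "x \<otimes> u \<otimes> g = x \<otimes> t \<otimes> g \<otimes> u" by (simp add: m_assoc ug)
  also have "\<dots> = t \<otimes> s \<otimes> g \<otimes> (x \<otimes> u)" by (simp add: tx) (simp add: m_assoc xg flip: m_assoc[of x g u])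
  finally have 2: "x \<otimes> u \<otimes> g = s \<otimes> t \<otimes> g \<otimes> (x \<otimes> u)" by (simp add: ts)
  have c: "commutator G (inv u) (inv x) = inv (x \<otimes> u) \<otimes> (u \<otimes> x)"
    by (simp add: commutator_def group_simps)
  have "(x \<otimes> u) \<otimes> (commutator G (inv u) (inv x) \<otimes> g) = u \<otimes> x \<otimes> g"
    by (simp add: c group_simps)
  also have "\<dots> = s \<otimes> t \<otimes> g \<otimes> (x \<otimes> u) \<otimes> commutator G (inv u) (inv x)"
    unfolding 1 by (simp add: c group_simps)
  also have "\<dots> = (x \<otimes> u) \<otimes> (g \<otimes> commutator G (inv u) (inv x))"
    unfolding 2[symmetric] by (simp add: m_assoc)
  finally show ?thesis by (simp del: m_assoc)
qed

end

lemma (in group_hom) hom_commutator: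
  "x \<in> carrier G \<Longrightarrow> y \<in> carrier G \<Longrightarrow> h (commutator G x y) = commutator H (h x) (h y)"
  by (simp add: commutator_def)

lemma (in group) r_coset_eq_one_iff:
  assumes "K \<lhd> G" "x \<in> carrier G"
  shows "K #> x = \<one>\<^bsub>G Mod K\<^esub> \<longleftrightarrow> x \<in> K"
proof -
  have "subgroup K G" using assms normal_imp_subgroup by blast
  then show ?thesis
    using assms coset_join1[of K x] coset_join2[of x K] by (auto simp: FactGroup_def subgroup.subset)
qed

text \<open>A concrete form of the three subgroups lemma. Modulo \<open>\<gamma>_{i+j+1}\<close> it
  has to be shown that \<open>g\<close> commutes with \<open>[h, k]\<close> for \<open>h\<close> in
  \<open>\<gamma>_j\<close>. The commutators of \<open>g\<close> with \<open>h\<close> and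
  \<open>k\<close> are central enough for \<open>commute_commutator_aux\<close>, by the induction
  hypothesis for the pairs \<open>(i, j)\<close> and \<open>(i + 1, j)\<close>.\<close>

lemma (in group) commutator_lower_central:
  assumes "1 \<le> i" "1 \<le> j" "g \<in> lower_central G i" "v \<in> lower_central G j"
  shows "commutator G g v \<in> lower_central G (i + j)"
  using assms(2,1,3,4)
proof (induction j arbitrary: i g v rule: nat_induct_at_least)
  case base
  then show ?case using commutator_lower_central_carrier[of i g v] by simp
next
  case (Suc j)
  define K where "K = lower_central G (i + Suc j)"
  have K: "K \<lhd> G" by (simp add: K_def lower_central_normal del: lower_central.simps)
  define Q where "Q = G Mod K"
  define p where "p = (#>) K"
  interpret Q: group Q unfolding Q_def by (rule normal.factorgroup_is_group[OF K])
  interpret p: group_hom G Q p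
    by (intro group_hom.intro group_hom_axioms.intro)
       (simp_all add: Q.group_axioms group_axioms, use normal.r_coset_hom_Mod[OF K] in \<open>simp add: Q_def p_def\<close>)
  have comm: "p x \<otimes>\<^bsub>Q\<^esub> p y = p y \<otimes>\<^bsub>Q\<^esub> p x \<longleftrightarrow> commutator G x y \<in> K"
    if "x \<in> carrier G" "y \<in> carrier G" for x y
    using Q.commutator_eq_one_iff[of "p x" "p y"] r_coset_eq_one_iff[OF K, of "commutator G x y"] that
    by (simp add: p.hom_commutator flip: p_def Q_def)
  obtain m where m: "j = Suc m" using \<open>1 \<le> j\<close> by (cases j) auto
  have g: "g \<in> carrier G" using Suc.prems lower_central_carrier by blast
  have base: "p g \<otimes>\<^bsub>Q\<^esub> p (commutator G h k) = p (commutator G h k) \<otimes>\<^bsub>Q\<^esub> p g"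
    if hk: "h \<in> lower_central G j" "k \<in> carrier G" for h k
  proof -
    \<comment> \<open>Inverses, since \<open>commute_commutator_aux\<close> speaks about the
      commutator of \<open>inv u\<close> and \<open>inv x\<close>.\<close>
    define u x where "u = inv h" and "x = inv k"
    have u: "u \<in> lower_central G j" "u \<in> carrier G" "x \<in> carrier G"
      using hk lower_central_subgroup lower_central_carrier
      by (auto simp: u_def x_def subgroup.m_inv_closed)
    define s t where "s = commutator G x g" and "t = commutator G u g"
    have inv_comm: "inv (commutator G g y) = commutator G y g" if "y \<in> carrier G" for y
      using that g by (simp add: commutator_def group_simps)
    have "commutator G g x \<in> lower_central G (Suc i)"
      using Suc.prems u by (intro commutator_lower_central_carrier) auto
    then have s: "s \<in> lower_central G (Suc i)"
      using inv_comm[OF u(3)] lower_central_subgroup by (metis s_def subgroup.m_inv_closed)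
    have "commutator G g u \<in> lower_central G (i + j)" using Suc.IH Suc.prems u by blast
    then have t: "t \<in> lower_central G (i + j)"
      using inv_comm[OF u(2)] lower_central_subgroup by (metis t_def subgroup.m_inv_closed)
    have st: "s \<in> carrier G" "t \<in> carrier G" using s t lower_central_carrier by blast+
    have t_central: "p t \<otimes>\<^bsub>Q\<^esub> p y = p y \<otimes>\<^bsub>Q\<^esub> p t" if "y \<in> carrier G" for y
      using commutator_lower_central_carrier[OF _ t that] that st Suc.prems by (subst comm) (auto simp: K_def simp del: lower_central.simps)
    have su: "p s \<otimes>\<^bsub>Q\<^esub> p u = p u \<otimes>\<^bsub>Q\<^esub> p s"
      using Suc.IH[of "Suc i" s u] s u st by (subst comm) (auto simp: K_def simp del: lower_central.simps)
    have "commutator Q (inv\<^bsub>Q\<^esub> (p u)) (inv\<^bsub>Q\<^esub> (p x)) \<otimes>\<^bsub>Q\<^esub> p g = p g \<otimes>\<^bsub>Q\<^esub> commutator Q (inv\<^bsub>Q\<^esub> (p u)) (inv\<^bsub>Q\<^esub> (p x))"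
    proof (rule Q.commute_commutator_aux[where s = "p s" and t = "p t"])
      show "p u \<otimes>\<^bsub>Q\<^esub> p g = p t \<otimes>\<^bsub>Q\<^esub> (p g \<otimes>\<^bsub>Q\<^esub> p u)"
        using commutator_mult_commute[of u g] u g st by (simp add: t_def flip: p.hom_mult)
      show "p x \<otimes>\<^bsub>Q\<^esub> p g = p s \<otimes>\<^bsub>Q\<^esub> (p g \<otimes>\<^bsub>Q\<^esub> p x)"
        using commutator_mult_commute[of x g] u g st by (simp add: s_def flip: p.hom_mult)
    qed (use su t_central u g st in auto)
    moreover have "h \<in> carrier G" using hk lower_central_carrier by blast
    ultimately show ?thesis using hk by (simp add: u_def x_def p.hom_commutator)
  qed
  \<comment> \<open>The elements commuting with \<open>g\<close> modulo \<open>K\<close> form a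
    subgroup, so generators suffice.\<close>
  have "p g \<otimes>\<^bsub>Q\<^esub> p v = p v \<otimes>\<^bsub>Q\<^esub> p g \<and> v \<in> carrier G"
    using Suc.prems(3) unfolding m lower_central_Suc_Suc
  proof (induction v rule: generate.induct)
    case one
    then show ?case using g by simp
  next
    case (incl v)
    then show ?case using base lower_central_carrier m by auto
  next
    case (inv v)
    then have v: "p g \<otimes>\<^bsub>Q\<^esub> p v = p v \<otimes>\<^bsub>Q\<^esub> p g" "v \<in> carrier G" using base lower_central_carrier m by auto
    have "p v \<otimes>\<^bsub>Q\<^esub> (inv\<^bsub>Q\<^esub> p v \<otimes>\<^bsub>Q\<^esub> p g) \<otimes>\<^bsub>Q\<^esub> p v = p v \<otimes>\<^bsub>Q\<^esub> (p g \<otimes>\<^bsub>Q\<^esub> inv\<^bsub>Q\<^esub> p v) \<otimes>\<^bsub>Q\<^esub> p v"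
      using v g by (simp add: Q.group_simps)
    then show ?case using v g by (simp del: Q.m_assoc)
  next
    case (eng v w)
    then have *: "v \<in> carrier G" "w \<in> carrier G" "p g \<otimes>\<^bsub>Q\<^esub> p v = p v \<otimes>\<^bsub>Q\<^esub> p g" "p g \<otimes>\<^bsub>Q\<^esub> p w = p w \<otimes>\<^bsub>Q\<^esub> p g" by auto
    have "p g \<otimes>\<^bsub>Q\<^esub> (p v \<otimes>\<^bsub>Q\<^esub> p w) = (p g \<otimes>\<^bsub>Q\<^esub> p v) \<otimes>\<^bsub>Q\<^esub> p w" using *(1,2) g by (simp add: Q.m_assoc)
    also have "\<dots> = p v \<otimes>\<^bsub>Q\<^esub> (p g \<otimes>\<^bsub>Q\<^esub> p w)" unfolding *(3) using *(1,2) g by (simp add: Q.m_assoc)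
    also have "\<dots> = (p v \<otimes>\<^bsub>Q\<^esub> p w) \<otimes>\<^bsub>Q\<^esub> p g" unfolding *(4) using *(1,2) g by (simp add: Q.m_assoc)
    finally show ?case using * by simp
  qed
  then show ?case using comm[OF g] by (auto simp: K_def simp del: lower_central.simps)
qed


lemma (in group_hom) hom_lower_central:
  "x \<in> lower_central G i \<Longrightarrow> h x \<in> lower_central H i"
proof (induction i arbitrary: x)
  case (Suc n)
  note IH = Suc.IH and prems = Suc.prems
  show ?case
  proof (cases n)
    case (Suc i)
    note step = IH[unfolded Suc]
    from prems[unfolded Suc] have "x \<in> carrier G \<and> h x \<in> lower_central H (Suc (Suc i))"
      unfolding lower_central_Suc_Suc[of G]
    proof (induction x rule: generate.induct)
      case one
      then show ?case using subgroup.one_closed[OF H.lower_central_subgroup] by (simp del: lower_central.simps)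
    next
      case (incl v)
      then obtain a b where ab: "v = commutator G a b" "a \<in> lower_central G (Suc i)" "b \<in> carrier G" by blast
      then have "a \<in> carrier G" using G.lower_central_carrier by blast
      then show ?case using ab step H.commutator_lower_central_carrier[of "Suc i" "h a" "h b"]
        by (auto simp: hom_commutator simp del: lower_central.simps)
    next
      case (inv v)
      then obtain a b where ab: "v = commutator G a b" "a \<in> lower_central G (Suc i)" "b \<in> carrier G" by blast
      then have "a \<in> carrier G" using G.lower_central_carrier by blast
      then show ?case using ab step H.commutator_lower_central_carrier[of "Suc i" "h a" "h b"]
          subgroup.m_inv_closed[OF H.lower_central_subgroup, of "h v" "Suc (Suc i)"]
        by (auto simp: hom_commutator simp del: lower_central.simps)
    next
      case (eng v w)
      then show ?case
        using subgroup.m_closed[OF H.lower_central_subgroup, of "h v" "Suc (Suc i)" "h w"]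
        by (auto simp del: lower_central.simps)
    qed
    then show ?thesis unfolding Suc by blast
  qed (use prems in simp)
qed simp

section \<open>Elimination in groups\<close>

fun tree_comm :: "('a, 'm) monoid_scheme \<Rightarrow> (nat \<Rightarrow> 'a) \<Rightarrow> btree \<Rightarrow> 'a" where
  "tree_comm G x (Leaf i) = x i"
| "tree_comm G x (Br s t) = commutator G (tree_comm G x s) (tree_comm G x t)"

definition ordered_product :: "('a, 'm) monoid_scheme \<Rightarrow> (btree \<Rightarrow> 'a) \<Rightarrow> btree list \<Rightarrow> (btree \<Rightarrow> int) \<Rightarrow> 'a" where
  "ordered_product G f hs e = foldr (\<lambda>t y. f t [^]\<^bsub>G\<^esub> e t \<otimes>\<^bsub>G\<^esub> y) hs \<one>\<^bsub>G\<^esub>"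

lemma ordered_product_Nil [simp]: "ordered_product G f [] e = \<one>\<^bsub>G\<^esub>"
  and ordered_product_Cons [simp]:
    "ordered_product G f (t # hs) e = f t [^]\<^bsub>G\<^esub> e t \<otimes>\<^bsub>G\<^esub> ordered_product G f hs e"
  by (simp_all add: ordered_product_def)

lemma ordered_product_cong:
  "(\<And>t. t \<in> set hs \<Longrightarrow> e t = e' t) \<Longrightarrow> ordered_product G f hs e = ordered_product G f hs e'"
  by (induction hs) auto

context group
begin

lemma tree_comm_closed [simp]: "(\<And>i. x i \<in> carrier G) \<Longrightarrow> tree_comm G x t \<in> carrier G"
  by (induction t) auto

lemma ordered_product_closed [simp]:
  "(\<And>t. f t \<in> carrier G) \<Longrightarrow> ordered_product G f hs e \<in> carrier G"
  by (induction hs) auto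

lemma tree_comm_lower_central:
  assumes "\<And>i. x i \<in> carrier G"
  shows "tree_comm G x t \<in> lower_central G (length (foliage t))"
proof (induction t)
  case (Br s t)
  have "1 \<le> length (foliage s)" "1 \<le> length (foliage t)" by (simp_all add: Suc_le_eq)
  then show ?case using commutator_lower_central Br by simp
qed (use assms in simp)

text \<open>Both conjugations are demanded, since \<open>g K g^-1 \<subseteq> K\<close> alone is in
  general not inherited by the inverse of \<open>g\<close> in an infinite group.\<close>

lemma normalizer_subgroup:
  assumes "subgroup K G"
  shows "subgroup {g \<in> carrier G. \<forall>k\<in>K. g \<otimes> k \<otimes> inv g \<in> K \<and> inv g \<otimes> k \<otimes> g \<in> K} G"
proof (rule subgroupI)
  have K: "k \<in> carrier G" if "k \<in> K" for k by (rule subgroup.mem_carrier[OF assms that])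
  have "\<one> \<in> {g \<in> carrier G. \<forall>k\<in>K. g \<otimes> k \<otimes> inv g \<in> K \<and> inv g \<otimes> k \<otimes> g \<in> K}"
    using K by simp
  then show "{g \<in> carrier G. \<forall>k\<in>K. g \<otimes> k \<otimes> inv g \<in> K \<and> inv g \<otimes> k \<otimes> g \<in> K} \<noteq> {}" by blast
  fix a b
  assume a: "a \<in> {g \<in> carrier G. \<forall>k\<in>K. g \<otimes> k \<otimes> inv g \<in> K \<and> inv g \<otimes> k \<otimes> g \<in> K}"
    and b: "b \<in> {g \<in> carrier G. \<forall>k\<in>K. g \<otimes> k \<otimes> inv g \<in> K \<and> inv g \<otimes> k \<otimes> g \<in> K}"
  have "a \<otimes> b \<otimes> k \<otimes> inv (a \<otimes> b) = a \<otimes> (b \<otimes> k \<otimes> inv b) \<otimes> inv a"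
    "inv (a \<otimes> b) \<otimes> k \<otimes> (a \<otimes> b) = inv b \<otimes> (inv a \<otimes> k \<otimes> a) \<otimes> b" if "k \<in> K" for k
    using a b K[OF that] by (simp_all add: group_simps)
  then show "a \<otimes> b \<in> {g \<in> carrier G. \<forall>k\<in>K. g \<otimes> k \<otimes> inv g \<in> K \<and> inv g \<otimes> k \<otimes> g \<in> K}"
    using a b by auto
qed auto

lemma generate_conj_closed:
  assumes "A \<subseteq> carrier G" "g \<in> carrier G" "\<And>a. a \<in> A \<Longrightarrow> g \<otimes> a \<otimes> inv g \<in> generate G A" "k \<in> generate G A"
  shows "g \<otimes> k \<otimes> inv g \<in> generate G A"
  using assms(4)
proof (induction k rule: generate.induct)
  case one
  then show ?case using assms(2) generate.one by (simp add: m_assoc)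
next
  case (inv a)
  then have "inv (g \<otimes> a \<otimes> inv g) \<in> generate G A"
    using assms(3) generate_m_inv_closed[OF assms(1)] by blast
  moreover have "inv (g \<otimes> a \<otimes> inv g) = g \<otimes> inv a \<otimes> inv g"
    using inv assms(1,2) by (simp add: group_simps subset_iff)
  ultimately show ?case by simp
next
  case (eng k l)
  then have kl: "k \<in> carrier G" "l \<in> carrier G" using generate_in_carrier[OF assms(1)] by auto
  have "g \<otimes> (k \<otimes> l) \<otimes> inv g = (g \<otimes> k \<otimes> inv g) \<otimes> (g \<otimes> l \<otimes> inv g)"
    using kl assms(2) by (simp add: group_simps)
  then show ?case using eng generate.eng by metis
qed (use assms(3) in blast)

text \<open>The group counterpart of \<open>lie_closure_elim\<close>: the subgroup \<open>K\<close>
  generated by \<open>Z\<close> and the commutators of the next stage is normalized by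
  \<open>C b\<close>, so every element of the larger subgroup is a power of \<open>C b\<close> times
  an element of \<open>K\<close>.\<close>

lemma elim_generate:
  assumes x: "\<And>i. x i \<in> carrier G" and Z: "Z \<lhd> G"
    and high: "\<And>t. length (foliage t) > c \<Longrightarrow> tree_comm G x t \<in> Z"
  shows "elim c S hs \<Longrightarrow> g \<in> generate G (tree_comm G x ` S \<union> Z) \<Longrightarrow>
    \<exists>e. \<exists>z\<in>Z. g = ordered_product G (tree_comm G x) hs e \<otimes> z"
proof (induction arbitrary: g rule: elim.induct)
  case elim_Nil
  have "subgroup Z G" using Z normal_imp_subgroup by blast
  then have "generate G Z \<subseteq> Z" by (intro generate_subgroup_incl) auto
  then have "g \<in> Z" "g \<in> carrier G" using elim_Nil subgroup.mem_carrier[OF \<open>subgroup Z G\<close>] by auto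
  then show ?case by (intro exI[of _ "\<lambda>_. 0"] bexI[of _ g]) auto
next
  case (elim_Cons b S hs)
  define S' where "S' = elim_step c b S"
  define C where "C = tree_comm G x"
  define A where "A = C ` S' \<union> Z"
  define K where "K = generate G A"
  have C: "C t \<in> carrier G" for t unfolding C_def by (simp add: x)
  have Zsub: "subgroup Z G" using Z normal_imp_subgroup by blast
  have Zc: "z \<in> carrier G" if "z \<in> Z" for z by (rule subgroup.mem_carrier[OF Zsub that])
  have A: "A \<subseteq> carrier G" using C Zc by (auto simp: A_def)
  have Ksub: "subgroup K G" unfolding K_def by (rule generate_is_subgroup[OF A])
  have Kc: "k \<in> carrier G" if "k \<in> K" for k by (rule subgroup.mem_carrier[OF Ksub that])
  have KZ: "z \<in> K" if "z \<in> Z" for z using that by (auto simp: K_def A_def intro: generate.incl)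
  have KC: "C t \<in> K" if "t \<in> S'" for t using that by (auto simp: K_def A_def intro: generate.incl)
  have KBr: "C (Br b t) \<in> K \<and> (Br b t \<in> S' \<or> C (Br b t) \<in> Z)" if "t \<in> S'" for t
  proof (cases "length (foliage (Br b t)) \<le> c")
    case True
    then have "Br b t \<in> S'" using that elim_step_Br by (simp add: S'_def)
    then show ?thesis using KC by blast
  next
    case False
    then show ?thesis using high[of "Br b t"] KZ unfolding C_def by simp
  qed
  have conj_step: "C b \<otimes> C t = C (Br b t) \<otimes> C t \<otimes> C b" for t
    using commutator_mult_commute[OF C[of b] C[of t]] C by (simp add: C_def x m_assoc)
  have conj: "C b \<otimes> k \<otimes> inv (C b) \<in> K" if "k \<in> K" for k
    using that unfolding K_def
  proof (rule generate_conj_closed[OF A C, rotated])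
    fix a assume "a \<in> A"
    then consider t where "t \<in> S'" "a = C t" | "a \<in> Z" by (auto simp: A_def)
    then show "C b \<otimes> a \<otimes> inv (C b) \<in> generate G A"
    proof cases
      case 1
      have "C b \<otimes> a \<otimes> inv (C b) = C (Br b t) \<otimes> C t"
        unfolding 1 conj_step using C by (simp add: m_assoc)
      then show ?thesis using KBr[OF 1(1)] KC[OF 1(1)] subgroup.m_closed[OF Ksub] by (simp add: K_def)
    next
      case 2
      then show ?thesis using normal.inv_op_closed2[OF Z C] KZ by (simp add: K_def)
    qed
  qed
  \<comment> \<open>Conjugation by the inverse of \<open>b\<close> cannot be read off a generator.
    The relation \<open>b^-1 t b = (b^-1 [b, t] b)^-1 t\<close> passes to \<open>[b, t]\<close>,
    which has larger weight, until the bound \<open>c\<close> is exceeded and \<open>Z\<close> is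
    reached.\<close>
  have conj_inv_tree: "inv (C b) \<otimes> C t \<otimes> C b \<in> K" if "t \<in> S'" for t
    using that
  proof (induction "c - length (foliage t)" arbitrary: t rule: less_induct)
    case less
    have "inv (C b) \<otimes> C (Br b t) \<otimes> C b \<in> K"
    proof (cases "Br b t \<in> S'")
      case True
      then have "length (foliage (Br b t)) \<le> c" by (auto simp: S'_def elim_step_def)
      moreover have "0 < length (foliage b)" by simp
      ultimately have "c - length (foliage (Br b t)) < c - length (foliage t)"
        by (simp del: length_greater_0_conv)
      then show ?thesis using less.hyps[OF _ True] by blast
    next
      case False
      then have "C (Br b t) \<in> Z" using KBr[OF less.prems] by blast
      then show ?thesis using normal.inv_op_closed1[OF Z C] KZ by simp
    qed
    then have "inv (inv (C b) \<otimes> C (Br b t) \<otimes> C b) \<otimes> C t \<in> K"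
      using KC[OF less.prems] subgroup.m_closed[OF Ksub] subgroup.m_inv_closed[OF Ksub] by blast
    moreover have "inv (inv (C b) \<otimes> C (Br b t) \<otimes> C b) \<otimes> C t = inv (C b) \<otimes> C t \<otimes> C b"
    proof -
      have "(inv (C b) \<otimes> C (Br b t) \<otimes> C b) \<otimes> (inv (C b) \<otimes> C t \<otimes> C b) = inv (C b) \<otimes> (C (Br b t) \<otimes> C t \<otimes> C b)"
        using C by (simp add: group_simps)
      also have "\<dots> = C t" using C conj_step[of t] by (simp add: group_simps flip: conj_step)
      finally show ?thesis using C by (metis inv_solve_left m_closed inv_closed)
    qed
    ultimately show ?case by simp
  qed
  have conj_inv: "inv (C b) \<otimes> k \<otimes> C b \<in> K" if "k \<in> K" for k
  proof -
    have "inv (C b) \<otimes> k \<otimes> inv (inv (C b)) \<in> K"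
      using that unfolding K_def
    proof (rule generate_conj_closed[OF A, rotated 2])
      fix a assume "a \<in> A"
      then consider t where "t \<in> S'" "a = C t" | "a \<in> Z" by (auto simp: A_def)
      then show "inv (C b) \<otimes> a \<otimes> inv (inv (C b)) \<in> generate G A"
      proof cases
        case 1
        then show ?thesis using conj_inv_tree C by (simp add: K_def)
      next
        case 2
        then show ?thesis using normal.inv_op_closed1[OF Z C] KZ C by (simp add: K_def)
      qed
    qed (use C in simp)
    then show ?thesis using C by simp
  qed
  have norm: "C b [^] (n :: int) \<in> {g \<in> carrier G. \<forall>k\<in>K. g \<otimes> k \<otimes> inv g \<in> K \<and> inv g \<otimes> k \<otimes> g \<in> K}" for n
    by (rule subgroup_int_pow_closed[OF normalizer_subgroup[OF Ksub]]) (use C conj conj_inv in auto)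
  \<comment> \<open>As \<open>C b\<close> normalizes \<open>K\<close>, these products form a
    subgroup, and it contains all generators.\<close>
  have "g \<in> {C b [^] (n :: int) \<otimes> k | n k. k \<in> K}"
  proof -
    have "subgroup {C b [^] (n :: int) \<otimes> k | n k. k \<in> K} G"
    proof (rule subgroupI)
      show "{C b [^] (n :: int) \<otimes> k | n k. k \<in> K} \<subseteq> carrier G" using C Kc by auto
      show "{C b [^] (n :: int) \<otimes> k | n k. k \<in> K} \<noteq> {}" using subgroup.one_closed[OF Ksub] by blast
      fix u v
      assume "u \<in> {C b [^] (n :: int) \<otimes> k | n k. k \<in> K}" "v \<in> {C b [^] (n :: int) \<otimes> k | n k. k \<in> K}"
      then obtain n k m l where u: "u = C b [^] (n :: int) \<otimes> k" "k \<in> K" and v: "v = C b [^] (m :: int) \<otimes> l" "l \<in> K" by blast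
      have "u \<otimes> v = C b [^] (n + m) \<otimes> ((inv (C b [^] m) \<otimes> k \<otimes> C b [^] m) \<otimes> l)"
        using C Kc u v by (simp add: group_simps int_pow_mult)
      moreover have "(inv (C b [^] m) \<otimes> k \<otimes> C b [^] m) \<otimes> l \<in> K"
        using norm u v subgroup.m_closed[OF Ksub] by blast
      ultimately show "u \<otimes> v \<in> {C b [^] (n :: int) \<otimes> k | n k. k \<in> K}" by blast
      have "inv u = C b [^] (- n) \<otimes> (C b [^] n \<otimes> inv k \<otimes> inv (C b [^] n))"
        using C Kc u by (simp add: group_simps int_pow_neg)
      moreover have "C b [^] n \<otimes> inv k \<otimes> inv (C b [^] n) \<in> K"
        using norm u subgroup.m_inv_closed[OF Ksub] by blast
      ultimately show "inv u \<in> {C b [^] (n :: int) \<otimes> k | n k. k \<in> K}" by blast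
    qed
    moreover have "tree_comm G x ` S \<union> Z \<subseteq> {C b [^] (n :: int) \<otimes> k | n k. k \<in> K}"
    proof
      fix u assume "u \<in> tree_comm G x ` S \<union> Z"
      then consider "u = C b" | t where "t \<in> S" "t \<noteq> b" "u = C t" | "u \<in> Z" by (auto simp: C_def)
      then show "u \<in> {C b [^] (n :: int) \<otimes> k | n k. k \<in> K}"
      proof cases
        case 1
        then have "u = C b [^] (1 :: int) \<otimes> \<one>" using C by (simp add: int_pow_1)
        then show ?thesis using subgroup.one_closed[OF Ksub] by blast
      next
        case 2
        have "u \<in> K"
        proof (cases "length (foliage t) \<le> c")
          case True
          then have "t \<in> S'" using 2 unfolding S'_def elim_step_def by (auto intro!: bexI[of _ t] exI[of _ 0])
          then show ?thesis using KC 2 by simp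
        next
          case False
          then show ?thesis using high[of t] KZ 2 by (simp add: C_def)
        qed
        then have "u = C b [^] (0 :: int) \<otimes> u \<and> u \<in> K" using Kc by simp
        then show ?thesis by blast
      next
        case 3
        then have "u = C b [^] (0 :: int) \<otimes> u \<and> u \<in> K" using Kc KZ by simp
        then show ?thesis by blast
      qed
    qed
    ultimately show ?thesis using elim_Cons.prems generate_subgroup_incl by blast
  qed
  then obtain n k where gk: "g = C b [^] (n :: int) \<otimes> k" "k \<in> K" by blast
  then obtain e z where ez: "z \<in> Z" "k = ordered_product G (tree_comm G x) hs e \<otimes> z"
    using elim_Cons.IH[of k] by (auto simp: K_def A_def S'_def C_def)
  have "b \<notin> set hs" using elim_sorted[OF elim.elim_Cons[OF elim_Cons.hyps]] by auto
  then have "ordered_product G (tree_comm G x) hs (e(b := n)) = ordered_product G (tree_comm G x) hs e"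
    by (intro ordered_product_cong) auto
  then have "g = ordered_product G (tree_comm G x) (b # hs) (e(b := n)) \<otimes> z"
    using gk ez C Zc x by (simp add: C_def m_assoc)
  then show ?case using ez(1) by blast
qed

end

section \<open>The free group\<close>

lemma inv_letter_inv_letter [simp]: "inv_letter (inv_letter a) = a"
  and fst_inv_letter [simp]: "fst (inv_letter a) = fst a"
  by (auto simp: inv_letter_def prod_eq_iff)

lemma reduced_Cons: "reduced (a # w) \<longleftrightarrow> reduced w \<and> (w = [] \<or> hd w \<noteq> inv_letter a)"
  by (cases w) (auto simp: reduced_def)

lemma reduced_Nil [simp]: "reduced []"
  by (simp add: reduced_def)

lemma reduced_single [simp]: "reduced [a]"
  by (simp add: reduced_def)

lemma push_reduced: "reduced (a # w) \<Longrightarrow> push a w = a # w"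
  by (cases w) (auto simp: reduced_Cons)

lemma reduced_push: "reduced w \<Longrightarrow> reduced (push a w)"
  by (cases w) (auto simp: reduced_Cons)

text \<open>Van der Waerden's argument: pushing a letter permutes the reduced words, with inverse
  the push of the inverse letter. Associativity of the product is then composition of such
  maps.\<close>

lemma push_push_inv: "reduced w \<Longrightarrow> push a (push (inv_letter a) w) = w"
  by (cases w) (auto simp: push_reduced reduced_Cons)

lemma reduced_foldr_push: "reduced v \<Longrightarrow> reduced (foldr push u v)"
  by (induction u) (auto simp: reduced_push)

lemma set_push: "set (push a w) \<subseteq> insert a (set w)"
  by (cases w) auto

lemma set_foldr_push: "set (foldr push u v) \<subseteq> set u \<union> set v"
  by (induction u) (use set_push in fastforce)+

lemma fst_foldr_push: "fst ` set u \<subseteq> A \<Longrightarrow> fst ` set v \<subseteq> A \<Longrightarrow> fst ` set (foldr push u v) \<subseteq> A"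
  using set_foldr_push[of u v] by blast

lemma foldr_push_push:
  "reduced w \<Longrightarrow> foldr push (push a u) w = push a (foldr push u w)"
proof (cases u)
  case (Cons b u')
  assume "reduced w"
  then show ?thesis using Cons push_push_inv[of "foldr push u' w" a] by (simp add: reduced_foldr_push)
qed simp

lemma foldr_push_assoc:
  "reduced w \<Longrightarrow> foldr push (foldr push u v) w = foldr push u (foldr push v w)"
  by (induction u) (auto simp: foldr_push_push)

lemma free_group_simps [simp]:
  "carrier (free_group r) = {w. fst ` set w \<subseteq> {..<r} \<and> reduced w}"
  "u \<otimes>\<^bsub>free_group r\<^esub> v = foldr push u v"
  "\<one>\<^bsub>free_group r\<^esub> = []"
  by (simp_all add: free_group_def)

lemma free_group_is_group: "group (free_group r)"
proof (rule groupI)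
  fix x assume "x \<in> carrier (free_group r)"
  then show "\<exists>y\<in>carrier (free_group r). y \<otimes>\<^bsub>free_group r\<^esub> x = \<one>\<^bsub>free_group r\<^esub>"
  proof (induction x)
    case (Cons a w)
    then obtain y where y: "fst ` set y \<subseteq> {..<r}" "reduced y" "foldr push y w = []"
      by (auto simp: reduced_Cons)
    define y' where "y' = foldr push y [inv_letter a]"
    have "fst ` set y' \<subseteq> {..<r}"
      unfolding y'_def using y(1) Cons.prems by (intro fst_foldr_push) auto
    moreover have "reduced y'" by (simp add: y'_def reduced_foldr_push reduced_Cons)
    moreover have "foldr push y' (a # w) = []"
      using Cons.prems y(3) by (simp add: y'_def foldr_push_assoc)
    ultimately show ?case by auto
  qed (auto intro: exI[of _ "[]"])
next
  fix x y assume xy: "x \<in> carrier (free_group r)" "y \<in> carrier (free_group r)"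
  then show "x \<otimes>\<^bsub>free_group r\<^esub> y \<in> carrier (free_group r)"
    using fst_foldr_push[of x "{..<r}" y] by (simp add: reduced_foldr_push)
qed (auto simp: foldr_push_assoc)

lemma inv_generator:
  assumes "i < r"
  shows "inv\<^bsub>free_group r\<^esub> [(i, True)] = [(i, False)]"
proof -
  interpret group "free_group r" by (rule free_group_is_group)
  show ?thesis
    by (rule inv_equality) (use assms in \<open>auto simp: inv_letter_def reduced_Cons\<close>)
qed

definition word_eval :: "('a, 'm) monoid_scheme \<Rightarrow> (nat \<Rightarrow> 'a) \<Rightarrow> letter list \<Rightarrow> 'a" where
  "word_eval G x w = foldr (\<lambda>a y. (if snd a then x (fst a) else inv\<^bsub>G\<^esub> (x (fst a))) \<otimes>\<^bsub>G\<^esub> y) w \<one>\<^bsub>G\<^esub>"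

text \<open>The universal property of the free group; the point to check is that a cancellation in
  \<open>push\<close> is matched by one in \<open>G\<close>.\<close>

lemma word_eval_hom:
  assumes "group G" and x: "\<And>i. i < r \<Longrightarrow> x i \<in> carrier G"
  shows "word_eval G x \<in> hom (free_group r) G"
proof -
  interpret group G by fact
  let ?l = "\<lambda>a. if snd a then x (fst a) else inv\<^bsub>G\<^esub> (x (fst a))"
  have closed: "word_eval G x w \<in> carrier G" if "fst ` set w \<subseteq> {..<r}" for w
    using that by (induction w) (auto simp: word_eval_def x)
  have Cons: "word_eval G x (a # w) = ?l a \<otimes>\<^bsub>G\<^esub> word_eval G x w" for a w
    by (simp add: word_eval_def)
  have push: "word_eval G x (push a w) = ?l a \<otimes>\<^bsub>G\<^esub> word_eval G x w"
    if "fst a < r" "fst ` set w \<subseteq> {..<r}" for a w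
  proof (cases w)
    case (Cons b v)
    then show ?thesis
      using that closed[of v] x[of "fst a"] by (auto simp: word_eval_def inv_letter_def inv_cancel_left inv_cancel_right)
  qed (simp add: word_eval_def)
  have "word_eval G x (foldr push u v) = word_eval G x u \<otimes>\<^bsub>G\<^esub> word_eval G x v"
    if "fst ` set u \<subseteq> {..<r}" "fst ` set v \<subseteq> {..<r}" for u v
    using that
  proof (induction u)
    case Nil
    then show ?case using closed by (simp add: word_eval_def)
  next
    case (Cons a u)
    have "fst ` set (foldr push u v) \<subseteq> {..<r}" using Cons.prems by (simp add: fst_foldr_push)
    then show ?case using Cons closed x by (simp add: push \<open>word_eval G x (a # u) = _\<close> m_assoc)
  qed
  then show ?thesis using closed by (auto intro!: homI)
qed

lemma word_eval_generator:
  assumes "group G" "x i \<in> carrier G"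
  shows "word_eval G x [(i, True)] = x i"
proof -
  interpret group G by fact
  show ?thesis using assms by (simp add: word_eval_def)
qed

lemma generator_carrier [simp]: "i < r \<Longrightarrow> [(i, b)] \<in> carrier (free_group r)"
  by (simp add: reduced_Cons)

lemma free_group_generate: "carrier (free_group r) = generate (free_group r) ((\<lambda>i. [(i, True)]) ` {..<r})"
proof
  interpret group "free_group r" by (rule free_group_is_group)
  show "generate (free_group r) ((\<lambda>i. [(i, True)]) ` {..<r}) \<subseteq> carrier (free_group r)"
    by (rule generate_incl) auto
  show "carrier (free_group r) \<subseteq> generate (free_group r) ((\<lambda>i. [(i, True)]) ` {..<r})"
  proof
    fix w assume "w \<in> carrier (free_group r)"
    then show "w \<in> generate (free_group r) ((\<lambda>i. [(i, True)]) ` {..<r})"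
    proof (induction w)
      case Nil
      then show ?case using generate.one[of "free_group r"] by simp
    next
      case (Cons a w)
      then have w: "w \<in> generate (free_group r) ((\<lambda>i. [(i, True)]) ` {..<r})" "reduced (a # w)" "fst a < r"
        by (auto simp: reduced_Cons)
      have "[a] \<in> generate (free_group r) ((\<lambda>i. [(i, True)]) ` {..<r})"
      proof (cases "snd a")
        case True
        then have "[a] = [(fst a, True)]" by (simp add: prod_eq_iff)
        then show ?thesis using w by (auto intro: generate.incl)
      next
        case False
        then have "[a] = inv\<^bsub>free_group r\<^esub> [(fst a, True)]" using w by (simp add: inv_generator prod_eq_iff)
        then show ?thesis using w by (auto intro: generate.inv)
      qed
      from generate.eng[OF this w(1)] show ?case using w by (simp add: push_reduced)
    qed
  qed
qed

lemma free_group_hom_eqI: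
  assumes G: "group G" and hom: "f \<in> hom (free_group r) G" "g \<in> hom (free_group r) G"
    and eq: "\<And>i. i < r \<Longrightarrow> f [(i, True)] = g [(i, True)]" and w: "w \<in> carrier (free_group r)"
  shows "f w = g w"
proof -
  interpret F: group "free_group r" by (rule free_group_is_group)
  interpret f: group_hom "free_group r" G f
    using hom(1) G by (simp add: group_hom_def group_hom_axioms_def F.group_axioms)
  interpret g: group_hom "free_group r" G g
    using hom(2) G by (simp add: group_hom_def group_hom_axioms_def F.group_axioms)
  have sub: "(\<lambda>i. [(i, True)]) ` {..<r} \<subseteq> carrier (free_group r)" by (auto simp: reduced_Cons)
  have "w \<in> generate (free_group r) ((\<lambda>i. [(i, True)]) ` {..<r})" using w free_group_generate by blast
  then have "w \<in> carrier (free_group r) \<and> f w = g w"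
  proof (induction w rule: generate.induct)
    case (inv h)
    then show ?case using sub eq F.inv_closed by (metis (no_types, lifting) f.hom_inv g.hom_inv imageE lessThan_iff subsetD)
  next
    case (eng h k)
    then show ?case using F.m_closed f.hom_mult g.hom_mult by metis
  qed (use sub eq f.hom_one g.hom_one in \<open>auto\<close>)
  then show ?thesis by blast
qed

section \<open>The Magnus embedding\<close>

text \<open>The inverse of \<open>1 + X_i\<close>, that is the alternating sum of the powers of
  \<open>X_i\<close>; the condition on \<open>set w\<close> says that \<open>w\<close> is such a
  power.\<close>

definition geometric_series :: "nat \<Rightarrow> int ncs" where
  "geometric_series i = Ncs (\<lambda>w. if set w \<subseteq> {i} then (- 1) ^ length w else 0)"

lemma coef_letter_series: "coef (letter_series i) w = (if w = [i] then 1 else 0)"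
  by (simp add: letter_series_def)

lemma coef_geometric_series: "coef (geometric_series i) w = (if set w \<subseteq> {i} then (- 1) ^ length w else 0)"
  by (simp add: geometric_series_def)

lemma conv_letter_Cons: "conv (coef (letter_series i)) g (a # v) = (if a = i then g v else 0)"
proof -
  have "(\<lambda>u. coef (letter_series i) (a # u)) = (\<lambda>u. (if a = i then 1 else 0) * (if u = [] then 1 else (0::'a)))"
    by (auto simp: letter_series_def)
  then have "conv (\<lambda>u. coef (letter_series i) (a # u)) g v = (if a = i then 1 else 0) * g v"
    by (simp only: conv_scale_left conv_one_left)
  then show ?thesis by (simp add: letter_series_def)
qed

lemma conv_letter_snoc: "conv g (coef (letter_series i)) (v @ [a]) = (if a = i then g v else 0)"
proof -
  have "conv g (coef (letter_series i)) (v @ [a]) = g v * coef (letter_series i) [a]"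
  proof (rule conv_single)
    fix u u' assume "u @ u' = v @ [a]" "u \<noteq> v"
    then have "u' \<noteq> [i]" by auto
    then show "g u = 0 \<or> coef (letter_series i) u' = 0" by (simp add: letter_series_def)
  qed
  then show ?thesis by (simp add: letter_series_def)
qed

lemma one_plus_letter_mult_geometric: "(1 + letter_series i) * geometric_series i = 1"
proof (rule ncs_eqI)
  fix w
  show "coef ((1 + letter_series i) * geometric_series i) w = coef 1 w"
    by (cases w) (auto simp: distrib_right coef_mult conv_letter_Cons coef_1 coef_letter_series coef_geometric_series
        simp del: conv.simps(2))
qed

lemma geometric_mult_one_plus_letter: "geometric_series i * (1 + letter_series i) = 1"
proof (rule ncs_eqI)
  fix w
  show "coef (geometric_series i * (1 + letter_series i)) w = coef 1 w"
    by (cases w rule: rev_cases)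
       (auto simp: distrib_left coef_mult conv_letter_snoc coef_1 coef_letter_series coef_geometric_series)
qed

definition letter_magnus :: "letter \<Rightarrow> int ncs" where
  "letter_magnus a = (if snd a then 1 + letter_series (fst a) else geometric_series (fst a))"

definition magnus :: "letter list \<Rightarrow> int ncs" where
  "magnus w = foldr (\<lambda>a f. letter_magnus a * f) w 1"

lemma magnus_Nil [simp]: "magnus [] = 1"
  and magnus_Cons: "magnus (a # w) = letter_magnus a * magnus w"
  by (simp_all add: magnus_def)

lemma letter_magnus_inv: "letter_magnus a * letter_magnus (inv_letter a) = 1"
  by (simp add: letter_magnus_def inv_letter_def one_plus_letter_mult_geometric geometric_mult_one_plus_letter)

lemma magnus_push: "magnus (push a w) = letter_magnus a * magnus w"
proof (cases w)
  case (Cons b v)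
  then show ?thesis using letter_magnus_inv[of a] by (auto simp: magnus_Cons simp flip: mult.assoc)
qed (simp add: magnus_Cons)

lemma magnus_mult: "magnus (foldr push u v) = magnus u * magnus v"
  by (induction u) (auto simp: magnus_push magnus_Cons mult.assoc)

lemma magnus_order: "order_ge 1 (magnus w - 1)"
proof -
  have "coef (letter_magnus a) [] = 1" for a
    by (simp add: letter_magnus_def coef_1 letter_series_def geometric_series_def)
  then have "coef (magnus w) [] = 1" by (induction w) (auto simp: magnus_Cons coef_1 coef_mult)
  then show ?thesis by (simp add: order_ge_def coef_1)
qed

text \<open>The dimension subgroups are written through the order of \<open>magnus g - 1\<close>; \<open>lead_part k g\<close> is
  the leading form of \<open>g\<close> when \<open>g\<close> has order at least \<open>k\<close>.\<close>

definition lead_part :: "nat \<Rightarrow> letter list \<Rightarrow> int ncs" where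
  "lead_part k g = hom_part k (magnus g - 1)"

definition dim_ge :: "nat \<Rightarrow> letter list \<Rightarrow> bool" where
  "dim_ge k g \<longleftrightarrow> order_ge k (magnus g - 1)"

lemma dim_ge_1: "dim_ge 1 g"
  unfolding dim_ge_def by (rule magnus_order)

lemma dim_ge_mono: "dim_ge k g \<Longrightarrow> j \<le> k \<Longrightarrow> dim_ge j g"
  unfolding dim_ge_def by (rule order_ge_mono)

lemma dim_ge_Suc_iff: "dim_ge (Suc k) g \<longleftrightarrow> dim_ge k g \<and> lead_part k g = 0"
  unfolding dim_ge_def lead_part_def
  using order_ge_Suc hom_part_eq_0 order_ge_mono by (metis le_SucI order_refl)

lemma lead_part_eq_0: "dim_ge k g \<Longrightarrow> j < k \<Longrightarrow> lead_part j g = 0"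
  using dim_ge_mono[of k g "Suc j"] by (simp add: dim_ge_Suc_iff)

lemma dim_ge_Nil [simp]: "dim_ge k []"
  and lead_part_Nil [simp]: "lead_part k [] = 0"
  by (simp_all add: dim_ge_def lead_part_def)

text \<open>From \<open>(1 + a) (1 + b) - 1 = a + b + a b\<close>, where \<open>a b\<close> has
  order at least \<open>2 k > k\<close> because \<open>k \<ge> 1\<close>.\<close>

lemma dim_ge_mult:
  assumes "1 \<le> k" "dim_ge k g" "dim_ge k h"
  shows "dim_ge k (foldr push g h)" "lead_part k (foldr push g h) = lead_part k g + lead_part k h"
proof -
  have *: "magnus (foldr push g h) - 1 =
      (magnus g - 1) + (magnus h - 1) + (magnus g - 1) * (magnus h - 1)"
    by (simp add: magnus_mult algebra_simps)
  have "order_ge (k + k) ((magnus g - 1) * (magnus h - 1))"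
    using assms by (intro order_ge_mult) (auto simp: dim_ge_def)
  then have o: "order_ge (Suc k) ((magnus g - 1) * (magnus h - 1))"
    using assms(1) order_ge_mono by (metis Suc_eq_plus1 add_le_cancel_left)
  then show "dim_ge k (foldr push g h)"
    using assms order_ge_mono[OF o, of k] unfolding dim_ge_def * by (auto intro: order_ge_add)
  show "lead_part k (foldr push g h) = lead_part k g + lead_part k h"
    unfolding lead_part_def * by (simp add: hom_part_add hom_part_eq_0[OF o])
qed

lemma magnus_inv:
  assumes "g \<in> carrier (free_group r)"
  shows "magnus g * magnus (inv\<^bsub>free_group r\<^esub> g) = 1"
proof -
  interpret group "free_group r" by (rule free_group_is_group)
  show ?thesis using r_inv[OF assms] by (metis free_group_simps(2,3) magnus_Nil magnus_mult)
qed

lemma dim_ge_inv: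
  assumes "1 \<le> k" "dim_ge k g" "g \<in> carrier (free_group r)"
  shows "dim_ge k (inv\<^bsub>free_group r\<^esub> g)" "lead_part k (inv\<^bsub>free_group r\<^esub> g) = - lead_part k g"
proof -
  interpret group "free_group r" by (rule free_group_is_group)
  have "magnus g + (magnus g - 1) * (magnus (inv\<^bsub>free_group r\<^esub> g) - 1) = 2 - magnus (inv\<^bsub>free_group r\<^esub> g)"
    using magnus_inv[OF assms(3)] by (simp add: algebra_simps)
  then have *: "magnus (inv\<^bsub>free_group r\<^esub> g) - 1 = - ((magnus g - 1) * magnus (inv\<^bsub>free_group r\<^esub> g))"
    using magnus_inv[OF assms(3)] by (simp add: algebra_simps)
  have "order_ge (k + 0) ((magnus g - 1) * magnus (inv\<^bsub>free_group r\<^esub> g))"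
    using assms(2) by (intro order_ge_mult) (auto simp: dim_ge_def)
  then show d: "dim_ge k (inv\<^bsub>free_group r\<^esub> g)"
    unfolding dim_ge_def * by (simp add: order_ge_def)
  have "lead_part k g + lead_part k (inv\<^bsub>free_group r\<^esub> g) = 0"
    using dim_ge_mult(2)[OF assms(1,2) d] r_inv[OF assms(3)] by (simp del: r_inv)
  then show "lead_part k (inv\<^bsub>free_group r\<^esub> g) = - lead_part k g"
    by (metis add_eq_0_iff)
qed

text \<open>If \<open>magnus g = 1 + a\<close> and \<open>magnus h = 1 + b\<close>, then
  \<open>magnus [g, h] = 1 + (a b - b a) magnus (g\<^sup>-\<^sup>1 h\<^sup>-\<^sup>1)\<close>.\<close>

lemma dim_ge_commutator:
  assumes "dim_ge i g" "dim_ge j h" "g \<in> carrier (free_group r)" "h \<in> carrier (free_group r)"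
  shows "dim_ge (i + j) (commutator (free_group r) g h)"
    "lead_part (i + j) (commutator (free_group r) g h) = lead_part i g * lead_part j h - lead_part j h * lead_part i g"
proof -
  interpret group "free_group r" by (rule free_group_is_group)
  define a b where "a = magnus g - 1" and "b = magnus h - 1"
  define g' h' where "g' = inv\<^bsub>free_group r\<^esub> g" and "h' = inv\<^bsub>free_group r\<^esub> h"
  have ord: "order_ge i a" "order_ge j b" using assms by (auto simp: dim_ge_def a_def b_def)
  have gg: "magnus g * magnus g' = 1" "magnus h * magnus h' = 1"
    using assms(3,4) by (auto simp: g'_def h'_def magnus_inv)
  have comm: "magnus (commutator (free_group r) g h) = magnus g * magnus h * magnus g' * magnus h'"
    by (simp add: commutator_def magnus_mult g'_def h'_def)
  have "magnus g * magnus h = magnus h * magnus g + (a * b - b * a)"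
    by (simp add: a_def b_def algebra_simps)
  then have "magnus (commutator (free_group r) g h) =
      magnus h * (magnus g * magnus g') * magnus h' + (a * b - b * a) * (magnus g' * magnus h')"
    unfolding comm by (simp add: distrib_right mult.assoc)
  then have *: "magnus (commutator (free_group r) g h) - 1 = (a * b - b * a) * (magnus g' * magnus h')"
    by (simp add: gg)
  have o: "order_ge (i + j) (a * b - b * a)"
    using order_ge_mult[OF ord] order_ge_mult[OF ord(2,1)] by (simp add: order_ge_diff add.commute)
  have m: "order_ge 1 (magnus g' * magnus h' - 1)"
    using magnus_order[of "foldr push g' h'"] by (simp add: magnus_mult)
  have e: "(a * b - b * a) * (magnus g' * magnus h') =
      (a * b - b * a) + (a * b - b * a) * (magnus g' * magnus h' - 1)"
    by (simp add: algebra_simps)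
  have o': "order_ge (Suc (i + j)) ((a * b - b * a) * (magnus g' * magnus h' - 1))"
    using order_ge_mult[OF o m] by simp
  show "dim_ge (i + j) (commutator (free_group r) g h)"
    unfolding dim_ge_def * e using o order_ge_mono[OF o', of "i + j"] by (auto intro: order_ge_add)
  have "hom_part (i + j) (a * b - b * a) = hom_part i a * hom_part j b - hom_part j b * hom_part i a"
    using hom_part_mult[OF ord] hom_part_mult[OF ord(2,1)] by (simp add: hom_part_diff add.commute)
  then show "lead_part (i + j) (commutator (free_group r) g h) =
      lead_part i g * lead_part j h - lead_part j h * lead_part i g"
    unfolding lead_part_def * e by (simp add: hom_part_add hom_part_eq_0[OF o'] flip: a_def b_def)
qed

lemma lead_part_generator: "lead_part k [(i, True)] = (if k = 1 then letter_series i else 0)"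
  by (rule ncs_eqI) (auto simp: lead_part_def magnus_Cons letter_magnus_def coef_hom_part letter_series_def)

text \<open>The set \<open>L\<close> is left open, as three additive groups are put in: all series,
  the Lie closure, and the linear forms in the first \<open>r\<close> letters.\<close>

lemma dim_ge_generate:
  assumes "1 \<le> k" "A \<subseteq> carrier (free_group r)" "\<And>a. a \<in> A \<Longrightarrow> dim_ge k a \<and> lead_part k a \<in> L"
    and L: "0 \<in> L" "\<And>f g. f \<in> L \<Longrightarrow> g \<in> L \<Longrightarrow> f + g \<in> L" "\<And>f. f \<in> L \<Longrightarrow> - f \<in> L"
    and g: "g \<in> generate (free_group r) A"
  shows "dim_ge k g \<and> lead_part k g \<in> L"
proof -
  interpret group "free_group r" by (rule free_group_is_group)
  from g show ?thesis
  proof (induction g rule: generate.induct)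
    case one
    then show ?case using L by simp
  next
    case (inv h)
    then show ?case using assms dim_ge_inv[of k h r] by auto
  next
    case (eng g h)
    then show ?case using dim_ge_mult[of k g h] assms(1) L by auto
  qed (use assms in blast)
qed

text \<open>The easy inclusion between lower central and dimension subgroups; the converse is
  \<open>dim_ge_lower_central\<close>.\<close>

lemma lower_central_dim_ge:
  assumes "1 \<le> k" "g \<in> lower_central (free_group r) k"
  shows "dim_ge k g"
  using assms
proof (induction k arbitrary: g rule: nat_induct_at_least)
  case base
  then show ?case using dim_ge_1 by simp
next
  case (Suc k)
  interpret group "free_group r" by (rule free_group_is_group)
  obtain m where m: "k = Suc m" using \<open>1 \<le> k\<close> by (cases k) auto
  define A where "A = {commutator (free_group r) h x |h x. h \<in> lower_central (free_group r) k \<and> x \<in> carrier (free_group r)}"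
  have A: "dim_ge (Suc k) a" "a \<in> carrier (free_group r)" if "a \<in> A" for a
  proof -
    from that obtain h x where *: "a = commutator (free_group r) h x" "h \<in> lower_central (free_group r) k" "x \<in> carrier (free_group r)"
      unfolding A_def by blast
    have h: "h \<in> carrier (free_group r)" by (rule lower_central_carrier[OF *(2)])
    show "dim_ge (Suc k) a" using dim_ge_commutator(1)[OF Suc.IH[OF *(2)] dim_ge_1 h *(3)] unfolding *(1) Suc_eq_plus1 .
    show "a \<in> carrier (free_group r)" unfolding *(1) by (rule commutator_closed[OF h *(3)])
  qed
  have "g \<in> generate (free_group r) A"
    using Suc.prems unfolding m lower_central_Suc_Suc A_def .
  then have "dim_ge (Suc k) g \<and> lead_part (Suc k) g \<in> UNIV"
  proof (rule dim_ge_generate[where A = A and r = r and L = UNIV, rotated -1])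
    show "A \<subseteq> carrier (free_group r)" using A(2) by blast
  qed (simp_all add: A(1))
  then show ?case by blast
qed

text \<open>The value \<open>[]\<close> beyond \<open>r\<close> is a default that makes every tree,
  whatever its letters, evaluate inside the free group.\<close>

definition free_gen :: "nat \<Rightarrow> nat \<Rightarrow> letter list" where
  "free_gen r i = (if i < r then [(i, True)] else [])"

lemma free_gen_carrier: "free_gen r i \<in> carrier (free_group r)"
  by (simp add: free_gen_def)

abbreviation free_comm :: "nat \<Rightarrow> btree \<Rightarrow> letter list" where
  "free_comm r \<equiv> tree_comm (free_group r) (free_gen r)"

text \<open>The bridge between the two readings of a tree: the group commutator has the Lie bracket
  as its leading form.\<close>

lemma free_comm_lead_part:
  assumes "set (foliage t) \<subseteq> {..<r}"
  shows "dim_ge (length (foliage t)) (free_comm r t) \<and> lead_part (length (foliage t)) (free_comm r t) = lie_poly t"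
  using assms
proof (induction t)
  case (Leaf i)
  then show ?case using dim_ge_1[of "[(i, True)]"] by (simp add: free_gen_def lead_part_generator)
next
  case (Br s t)
  interpret group "free_group r" by (rule free_group_is_group)
  have "free_comm r s \<in> carrier (free_group r)" "free_comm r t \<in> carrier (free_group r)"
    using tree_comm_closed free_gen_carrier by blast+
  then show ?case using dim_ge_commutator Br by simp
qed

lemma dim_ge_nat_pow:
  assumes "1 \<le> k" "dim_ge k g" "g \<in> carrier (free_group r)"
  shows "dim_ge k (g [^]\<^bsub>free_group r\<^esub> (n :: nat)) \<and>
    lead_part k (g [^]\<^bsub>free_group r\<^esub> n) = scale (of_nat n) (lead_part k g)"
proof (induction n)
  case (Suc n)
  interpret group "free_group r" by (rule free_group_is_group)
  have "g [^]\<^bsub>free_group r\<^esub> Suc n = foldr push (g [^]\<^bsub>free_group r\<^esub> n) g" by simp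
  then show ?case using Suc dim_ge_mult[OF assms(1) _ assms(2)] by (simp add: scale_add_left add.commute)
qed simp

lemma dim_ge_int_pow:
  assumes "1 \<le> k" "dim_ge k g" "g \<in> carrier (free_group r)"
  shows "dim_ge k (g [^]\<^bsub>free_group r\<^esub> (n :: int)) \<and>
    lead_part k (g [^]\<^bsub>free_group r\<^esub> n) = scale n (lead_part k g)"
proof (cases n rule: int_cases2)
  case (nonneg m)
  interpret group "free_group r" by (rule free_group_is_group)
  show ?thesis using dim_ge_nat_pow[OF assms, of m] by (simp add: nonneg int_pow_int)
next
  case (nonpos m)
  interpret group "free_group r" by (rule free_group_is_group)
  have *: "g [^]\<^bsub>free_group r\<^esub> n = inv\<^bsub>free_group r\<^esub> (g [^]\<^bsub>free_group r\<^esub> m)"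
    using assms(3) by (simp add: nonpos int_pow_neg int_pow_int)
  have "g [^]\<^bsub>free_group r\<^esub> m \<in> carrier (free_group r)" using assms(3) by (rule nat_pow_closed)
  then show ?thesis
    using dim_ge_nat_pow[OF assms, of m] dim_ge_inv[OF assms(1)] unfolding *
    by (auto simp: nonpos intro!: ncs_eqI)
qed

lemma ordered_product_lead_part:
  assumes "1 \<le> k" and "\<And>t. t \<in> set hs \<Longrightarrow> f t \<in> carrier (free_group r) \<and> dim_ge k (f t [^]\<^bsub>free_group r\<^esub> e t)"
  shows "dim_ge k (ordered_product (free_group r) f hs e) \<and>
    lead_part k (ordered_product (free_group r) f hs e) = (\<Sum>t\<leftarrow>hs. lead_part k (f t [^]\<^bsub>free_group r\<^esub> e t))"
  using assms(2)
proof (induction hs)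
  case (Cons t hs)
  then show ?case using dim_ge_mult[OF assms(1)] by auto
qed simp

text \<open>Magnus' theorem. Modulo \<open>\<gamma>\<^bsub>k+1\<^esub>\<close> every element is an ordered product of powers of the tree commutators of
  weight at most \<open>k\<close>, and the leading form of such a product sees its exponents of lowest weight.\<close>

theorem dim_ge_lower_central:
  assumes "1 \<le> k" "dim_ge (Suc k) g" "g \<in> carrier (free_group r)"
  shows "g \<in> lower_central (free_group r) (Suc k)"
proof -
  let ?F = "free_group r" and ?Z = "lower_central (free_group r) (Suc k)"
  interpret group ?F by (rule free_group_is_group)
  have "\<exists>hs. elim k (Leaf ` {..<r}) hs"
    by (rule elim_exists[where r = r]) (use assms(1) in auto)
  then obtain hs where hs: "elim k (Leaf ` {..<r}) hs" by blast
  \<comment> \<open>Commutators of weight above \<open>k\<close> already lie in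
    \<open>\<gamma>_{k+1}\<close>, so the elimination is run with the bound
    \<open>k\<close>.\<close>
  interpret hall_basis r k hs using hs assms(1) by unfold_locales
  have C: "free_comm r t \<in> carrier ?F" for t using tree_comm_closed free_gen_carrier by blast
  have "free_comm r t \<in> ?Z" if "k < length (foliage t)" for t
    using tree_comm_lower_central[of "free_gen r" t] free_gen_carrier
      lower_central_antimono[of "Suc k" "length (foliage t)"] that by (meson Suc_leI subsetD)
  moreover have "g \<in> generate ?F (free_comm r ` Leaf ` {..<r} \<union> ?Z)"
  proof -
    have "free_comm r ` Leaf ` {..<r} = (\<lambda>i. [(i, True)]) ` {..<r}"
      by (auto simp: image_image free_gen_def intro!: image_eqI)
    moreover have "g \<in> generate ?F ((\<lambda>i. [(i, True)]) ` {..<r})"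
      using assms(3) unfolding free_group_generate[of r] .
    ultimately show ?thesis using mono_generate[OF Un_upper1] by (metis subsetD)
  qed
  ultimately obtain e z where ez: "z \<in> ?Z" "g = ordered_product ?F (free_comm r) hs e \<otimes>\<^bsub>?F\<^esub> z"
    using elim_generate[where x = "free_gen r", OF free_gen_carrier lower_central_normal _ hs] by blast
  define w where "w = ordered_product ?F (free_comm r) hs e"
  have wc: "w \<in> carrier ?F" unfolding w_def by (rule ordered_product_closed[OF C])
  have zc: "z \<in> carrier ?F" by (rule lower_central_carrier[OF ez(1)])
  have z: "dim_ge (Suc k) z" using ez(1) lower_central_dim_ge by (metis le_add1 plus_1_eq_Suc)
  have "w = g \<otimes>\<^bsub>?F\<^esub> inv\<^bsub>?F\<^esub> z"
    using ez(2) wc zc assms(3) unfolding w_def[symmetric] by (metis inv_solve_right)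
  then have w: "dim_ge (Suc k) w"
    using dim_ge_mult(1)[of "Suc k" g "inv\<^bsub>?F\<^esub> z"] dim_ge_inv(1)[OF _ z zc] assms(2) by simp
  \<comment> \<open>Induction on the weight \<open>d\<close>: lighter trees have exponent 0, heavier
    ones have no part of degree \<open>d\<close>, and \<open>w\<close> has order above
    \<open>k \<ge> d\<close>. So the Lie polynomials of weight \<open>d\<close> satisfy a linear
    relation whose coefficients are the exponents.\<close>
  have zero: "e t = 0" if "t \<in> set hs" for t
    using that
  proof (induction "length (foliage t)" arbitrary: t rule: less_induct)
    case less
    define d where "d = length (foliage t)"
    have d: "1 \<le> d" "d \<le> k" using less.prems hs_tree[of t] by (auto simp: d_def Suc_le_eq)
    have pow: "dim_ge d (free_comm r s [^]\<^bsub>?F\<^esub> e s) \<and>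
        lead_part d (free_comm r s [^]\<^bsub>?F\<^esub> e s) = (if length (foliage s) = d then scale (e s) (lie_poly s) else 0)"
      if s: "s \<in> set hs" for s
    proof (cases "length (foliage s) < d")
      case True
      then have "e s = 0" using less.hyps s by (simp add: d_def)
      then show ?thesis using True by simp
    next
      case False
      have lp: "dim_ge (length (foliage s)) (free_comm r s)" "lead_part (length (foliage s)) (free_comm r s) = lie_poly s"
        using free_comm_lead_part[of s r] hs_tree[OF s] by auto
      then have "dim_ge d (free_comm r s)" using False dim_ge_mono by (meson not_le_imp_less less_imp_le)
      moreover have "lead_part d (free_comm r s) = (if length (foliage s) = d then lie_poly s else 0)"
        using lp lead_part_eq_0[of "length (foliage s)" "free_comm r s" d] False by auto
      ultimately show ?thesis using dim_ge_int_pow[OF d(1) _ C, of s "e s"] by auto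
    qed
    have "0 = lead_part d w" using lead_part_eq_0[OF w] d by simp
    also have "\<dots> = (\<Sum>s\<leftarrow>hs. if length (foliage s) = d then scale (e s) (lie_poly s) else 0)"
    proof -
      have "lead_part d w = (\<Sum>s\<leftarrow>hs. lead_part d (free_comm r s [^]\<^bsub>?F\<^esub> e s))"
        using ordered_product_lead_part[OF d(1), of hs "free_comm r" r e] pow C unfolding w_def by blast
      also have "map (\<lambda>s. lead_part d (free_comm r s [^]\<^bsub>?F\<^esub> e s)) hs =
          map (\<lambda>s. if length (foliage s) = d then scale (e s) (lie_poly s) else 0) hs"
        using pow by (intro map_cong) auto
      finally show ?thesis .
    qed
    also have "\<dots> = (\<Sum>s\<in>set (basis d). scale (e s) (lie_poly s))"
      unfolding sum_list_distinct_conv_sum_set[OF hs_distinct]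
      by (rule sum.mono_neutral_cong_right) (auto simp: set_basis)
    finally have "(\<Sum>s\<in>set (basis d). scale (e s) (lie_poly s)) = 0" by simp
    then show "e t = 0"
      by (rule lie_poly_independent[where \<tau> = id, simplified, rotated 3])
         (use less.prems hs_lead hs_inj in \<open>auto simp: set_basis d_def intro: inj_on_subset\<close>)
  qed
  then have "w = ordered_product ?F (free_comm r) hs (\<lambda>_. 0)"
    unfolding w_def by (intro ordered_product_cong) auto
  also have "\<dots> = []"
    by (induction hs) auto
  finally have "g = z" using ez(2) by (simp flip: w_def)
  then show ?thesis using ez(1) by simp
qed

section \<open>Counting twisted conjugacy classes along a central filtration\<close>

definition card_inf :: "'a set \<Rightarrow> enat" where
  "card_inf A = (if finite A then enat (card A) else \<infinity>)"

lemma card_inf_bij_betw: "bij_betw f A B \<Longrightarrow> card_inf A = card_inf B"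
  by (simp add: card_inf_def bij_betw_finite bij_betw_same_card)

lemma card_inf_eq_0_iff: "card_inf A = 0 \<longleftrightarrow> A = {}"
  by (auto simp: card_inf_def zero_enat_def)

lemma card_inf_times:
  assumes "A \<noteq> {}" "B \<noteq> {}"
  shows "card_inf (A \<times> B) = card_inf A * card_inf B"
proof (cases "finite A \<and> finite B")
  case True
  then show ?thesis by (simp add: card_inf_def card_cartesian_product)
next
  case False
  then have "infinite (A \<times> B)" using assms by (simp add: finite_cartesian_product_iff)
  moreover have "card_inf A * card_inf B = \<infinity>"
    using False assms card_inf_eq_0_iff[of A] card_inf_eq_0_iff[of B]
    by (auto simp: card_inf_def imult_is_infinity split: if_splits)
  ultimately show ?thesis by (simp add: card_inf_def)
qed

text \<open>Zero factors have to be excluded because \<open>0 * \<infinity> = 0\<close> in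
  \<open>enat\<close>.\<close>

lemma prod_enat_eq_infinity:
  fixes f :: "'a \<Rightarrow> enat"
  assumes "finite A" "\<And>a. a \<in> A \<Longrightarrow> f a \<noteq> 0" "a \<in> A" "f a = \<infinity>"
  shows "prod f A = \<infinity>"
proof -
  have nz: "prod f B \<noteq> 0" if "finite B" "\<And>a. a \<in> B \<Longrightarrow> f a \<noteq> 0" for B
    using that by (induction B rule: finite_induct) (auto simp: imult_is_0)
  have "prod f (A - {a}) \<noteq> 0" by (rule nz) (use assms in auto)
  then show ?thesis using assms by (simp add: prod.remove[of A a] imult_is_infinity)
qed

text \<open>Congruence modulo the image of \<open>V\<close> under \<open>\<delta>\<close>. The set
  \<open>V\<close> is explicit, as a layer is only a subgroup of its type.\<close>

definition coset_rel :: "('v::ab_group_add \<Rightarrow> 'v) \<Rightarrow> 'v set \<Rightarrow> ('v \<times> 'v) set" where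
  "coset_rel \<delta> V = {(u, v). u \<in> V \<and> v \<in> V \<and> (\<exists>z\<in>V. u - v = \<delta> z)}"

text \<open>An abstract setting because it is instantiated twice: by the lower central series of a
  free group, and by integer vectors with a growing number of leading zeros. The map
  \<open>lf k\<close> presents \<open>N k\<close> modulo \<open>N (Suc k)\<close> as an additive
  group; \<open>lf_conj\<close> says that this factor is central, and \<open>\<psi> k\<close> is the
  map that \<open>\<phi>\<close> induces on it.\<close>

locale central_filtration = group G for G (structure) +
  fixes \<phi> :: "'a \<Rightarrow> 'a" and N :: "nat \<Rightarrow> 'a set" and c :: nat
    and lf :: "nat \<Rightarrow> 'a \<Rightarrow> 'v::ab_group_add" and \<psi> :: "nat \<Rightarrow> 'v \<Rightarrow> 'v"
  assumes \<phi>: "\<phi> \<in> hom G G"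
    and N_0: "N 0 = carrier G"
    and N_subgroup: "k \<le> c \<Longrightarrow> subgroup (N k) G"
    and N_Suc: "k < c \<Longrightarrow> N (Suc k) = {x \<in> N k. lf k x = 0}"
    and lf_mult: "k < c \<Longrightarrow> x \<in> N k \<Longrightarrow> y \<in> N k \<Longrightarrow> lf k (x \<otimes> y) = lf k x + lf k y"
    and N_conj: "k \<le> c \<Longrightarrow> x \<in> N k \<Longrightarrow> y \<in> carrier G \<Longrightarrow> y \<otimes> x \<otimes> inv y \<in> N k"
    and lf_conj: "k < c \<Longrightarrow> x \<in> N k \<Longrightarrow> y \<in> carrier G \<Longrightarrow> lf k (y \<otimes> x \<otimes> inv y) = lf k x"
    and N_\<phi>: "k \<le> c \<Longrightarrow> x \<in> N k \<Longrightarrow> \<phi> x \<in> N k"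
    and lf_\<phi>: "k < c \<Longrightarrow> x \<in> N k \<Longrightarrow> lf k (\<phi> x) = \<psi> k (lf k x)"
begin

sublocale \<phi>: group_hom G G \<phi>
  using \<phi> by (simp add: group_hom_def group_hom_axioms_def group_axioms)

lemma N_carrier: "k \<le> c \<Longrightarrow> x \<in> N k \<Longrightarrow> x \<in> carrier G"
  by (rule subgroup.mem_carrier[OF N_subgroup])

lemma N_closed: "k \<le> c \<Longrightarrow> x \<in> N k \<Longrightarrow> y \<in> N k \<Longrightarrow> x \<otimes> y \<in> N k"
  and N_inv: "k \<le> c \<Longrightarrow> x \<in> N k \<Longrightarrow> inv x \<in> N k"
  and N_one: "k \<le> c \<Longrightarrow> \<one> \<in> N k"
  using subgroup.m_closed[OF N_subgroup] subgroup.m_inv_closed[OF N_subgroup] subgroup.one_closed[OF N_subgroup]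
  by blast+

lemma N_conj': "k \<le> c \<Longrightarrow> x \<in> N k \<Longrightarrow> y \<in> carrier G \<Longrightarrow> inv y \<otimes> x \<otimes> y \<in> N k"
  using N_conj[of k x "inv y"] by simp

lemma lf_conj': "k < c \<Longrightarrow> x \<in> N k \<Longrightarrow> y \<in> carrier G \<Longrightarrow> lf k (inv y \<otimes> x \<otimes> y) = lf k x"
  using lf_conj[of k x "inv y"] by simp

lemma N_antimono: "i \<le> j \<Longrightarrow> j \<le> c \<Longrightarrow> N j \<subseteq> N i"
proof (induction j rule: dec_induct)
  case (step j)
  then show ?case using N_Suc[of j] by auto
qed simp

lemma lf_one: "k < c \<Longrightarrow> lf k \<one> = 0"
  using lf_mult[of k \<one> \<one>] N_one[of k] by simp

lemma lf_inv: "k < c \<Longrightarrow> x \<in> N k \<Longrightarrow> lf k (inv x) = - lf k x"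
  using lf_mult[of k x "inv x"] N_inv[of k x] N_carrier[of k x] lf_one[of k]
  by (simp add: eq_neg_iff_add_eq_0 add.commute)

text \<open>Twisted conjugacy in the quotient by \<open>N k\<close>, pulled back to \<open>G\<close>
  so that no cosets are needed.\<close>

definition twisted :: "nat \<Rightarrow> ('a \<times> 'a) set" where
  "twisted k = {(x, y). x \<in> carrier G \<and> y \<in> carrier G \<and>
     (\<exists>z\<in>carrier G. \<exists>n\<in>N k. x = z \<otimes> y \<otimes> inv (\<phi> z) \<otimes> n)}"

definition layer :: "nat \<Rightarrow> 'v set" where
  "layer k = lf k ` N k"

abbreviation layer_rel :: "nat \<Rightarrow> ('v \<times> 'v) set" where
  "layer_rel k \<equiv> coset_rel (\<lambda>z. z - \<psi> k z) (layer k)"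

lemma twisted_equiv: "k \<le> c \<Longrightarrow> equiv (carrier G) (twisted k)"
proof (rule equivI)
  assume k: "k \<le> c"
  show "twisted k \<subseteq> carrier G \<times> carrier G" by (auto simp: twisted_def)
  show "refl_on (carrier G) (twisted k)"
  proof (rule refl_onI)
    fix x assume x: "x \<in> carrier G"
    then have "x = \<one> \<otimes> x \<otimes> inv (\<phi> \<one>) \<otimes> \<one>" by simp
    then show "(x, x) \<in> twisted k" using x N_one[OF k] one_closed unfolding twisted_def by blast
  qed
  show "sym (twisted k)"
  proof (rule symI)
    fix x y assume "(x, y) \<in> twisted k"
    then obtain z n where z: "x \<in> carrier G" "y \<in> carrier G" "z \<in> carrier G" "n \<in> N k" "x = z \<otimes> y \<otimes> inv (\<phi> z) \<otimes> n"
      by (auto simp: twisted_def)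
    have n: "n \<in> carrier G" using N_carrier[OF k] z by blast
    have "y = inv z \<otimes> x \<otimes> inv (\<phi> (inv z)) \<otimes> (inv (\<phi> z) \<otimes> inv n \<otimes> \<phi> z)"
      unfolding z(5) using z(2,3) n by (simp add: group_simps)
    moreover have "inv (\<phi> z) \<otimes> inv n \<otimes> \<phi> z \<in> N k"
      using N_conj'[OF k N_inv[OF k z(4)]] z(3) by simp
    ultimately show "(y, x) \<in> twisted k" using z(1,2,3) unfolding twisted_def by blast
  qed
  show "trans (twisted k)"
  proof (rule transI)
    fix x y u assume "(x, y) \<in> twisted k" "(y, u) \<in> twisted k"
    then obtain z n w m where z: "x \<in> carrier G" "y \<in> carrier G" "u \<in> carrier G" "z \<in> carrier G" "n \<in> N k"
       "w \<in> carrier G" "m \<in> N k" "x = z \<otimes> y \<otimes> inv (\<phi> z) \<otimes> n" "y = w \<otimes> u \<otimes> inv (\<phi> w) \<otimes> m"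
      by (auto simp: twisted_def)
    have nm: "n \<in> carrier G" "m \<in> carrier G" using N_carrier[OF k] z by blast+
    have "x = (z \<otimes> w) \<otimes> u \<otimes> inv (\<phi> (z \<otimes> w)) \<otimes> ((\<phi> z \<otimes> m \<otimes> inv (\<phi> z)) \<otimes> n)"
      unfolding z(8,9) using z(3,4,6) nm by (simp add: group_simps)
    moreover have "(\<phi> z \<otimes> m \<otimes> inv (\<phi> z)) \<otimes> n \<in> N k"
      using N_closed[OF k N_conj[OF k z(7)] z(5)] z(4) by simp
    ultimately show "(x, u) \<in> twisted k" using z(1,3,4,6) m_closed unfolding twisted_def by blast
  qed
qed

lemma layer_closed: "k < c \<Longrightarrow> 0 \<in> layer k"
  "k < c \<Longrightarrow> u \<in> layer k \<Longrightarrow> v \<in> layer k \<Longrightarrow> u + v \<in> layer k"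
  "k < c \<Longrightarrow> u \<in> layer k \<Longrightarrow> - u \<in> layer k"
proof -
  assume k: "k < c"
  have kc: "k \<le> c" using k by simp
  show "0 \<in> layer k" using lf_one[OF k] N_one[OF kc] unfolding layer_def by (metis imageI)
  show "- u \<in> layer k" if "u \<in> layer k"
    using that lf_inv[OF k] N_inv[OF kc] unfolding layer_def by (auto intro!: image_eqI simp: lf_inv[OF k, symmetric])
  show "u + v \<in> layer k" if "u \<in> layer k" "v \<in> layer k"
    using that N_closed[OF kc] unfolding layer_def by (auto intro!: image_eqI simp: lf_mult[OF k, symmetric])
qed

lemma \<psi>_add: "k < c \<Longrightarrow> u \<in> layer k \<Longrightarrow> v \<in> layer k \<Longrightarrow> \<psi> k (u + v) = \<psi> k u + \<psi> k v"
proof -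
  assume k: "k < c" and "u \<in> layer k" "v \<in> layer k"
  then obtain x y where xy: "x \<in> N k" "y \<in> N k" "u = lf k x" "v = lf k y" by (auto simp: layer_def)
  have kc: "k \<le> c" using k by simp
  have "\<psi> k (u + v) = lf k (\<phi> (x \<otimes> y))"
    using lf_\<phi>[OF k N_closed[OF kc xy(1,2)]] lf_mult[OF k xy(1,2)] xy by simp
  also have "\<dots> = \<psi> k u + \<psi> k v"
    using lf_mult[OF k N_\<phi>[OF kc xy(1)] N_\<phi>[OF kc xy(2)]] lf_\<phi>[OF k] xy N_carrier[OF kc] by simp
  finally show ?thesis .
qed

lemma layer_equiv:
  assumes k: "k < c"
  shows "equiv (layer k) (layer_rel k)"
proof (rule equivI)
  note cl = layer_closed[OF k]
  have \<psi>0: "\<psi> k 0 = 0" using \<psi>_add[OF k cl(1) cl(1)] by simp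
  have \<psi>m: "\<psi> k (- u) = - \<psi> k u" if "u \<in> layer k" for u
    using \<psi>_add[OF k that cl(3)[OF that]] \<psi>0 by (simp add: eq_neg_iff_add_eq_0 add.commute)
  show "layer_rel k \<subseteq> layer k \<times> layer k" by (auto simp: coset_rel_def)
  show "refl_on (layer k) (layer_rel k)"
    by (rule refl_onI) (use cl(1) \<psi>0 in \<open>auto simp: coset_rel_def intro!: bexI[of _ 0]\<close>)
  show "sym (layer_rel k)"
  proof (rule symI)
    fix u v assume "(u, v) \<in> layer_rel k"
    then obtain z where z: "u \<in> layer k" "v \<in> layer k" "z \<in> layer k" "u - v = z - \<psi> k z" by (auto simp: coset_rel_def)
    have "v - u = - z - \<psi> k (- z)" using z(4) \<psi>m[OF z(3)] by (simp add: algebra_simps)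
    then show "(v, u) \<in> layer_rel k" using z cl(3) by (auto simp: coset_rel_def)
  qed
  show "trans (layer_rel k)"
  proof (rule transI)
    fix u v w assume "(u, v) \<in> layer_rel k" "(v, w) \<in> layer_rel k"
    then obtain z y where z: "u \<in> layer k" "v \<in> layer k" "w \<in> layer k" "z \<in> layer k" "y \<in> layer k"
      "u - v = z - \<psi> k z" "v - w = y - \<psi> k y" by (auto simp: coset_rel_def)
    have "u - w = (u - v) + (v - w)" by simp
    also have "\<dots> = (z + y) - \<psi> k (z + y)" unfolding z(6,7) \<psi>_add[OF k z(4,5)] by simp
    finally have "u - w = (z + y) - \<psi> k (z + y)" .
    then show "(u, w) \<in> layer_rel k" using z cl(2) by (auto simp: coset_rel_def)
  qed
qed

text \<open>Injectivity of \<open>1 - \<psi> k\<close> on the layer, which is what pins down the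
  conjugating element in \<open>twisted_layer_iff\<close>.\<close>

definition separated :: "nat \<Rightarrow> bool" where
  "separated k \<longleftrightarrow> (\<forall>z\<in>layer k. z = \<psi> k z \<longrightarrow> z = 0)"

text \<open>Suppose \<open>z\<close> conjugates one element to the other. In a layer
  \<open>j < k\<close> the elements \<open>n\<close> and \<open>n'\<close> are invisible, so
  \<open>lf j z\<close> is fixed by \<open>\<psi> j\<close> and must be 0. Descending through the
  layers puts \<open>z\<close> into \<open>N k\<close>, where the relation reads
  \<open>lf k n - lf k n' = lf k z - \<psi> k (lf k z)\<close>.\<close>

lemma twisted_layer_iff:
  assumes k: "k < c" and sep: "\<And>j. j < k \<Longrightarrow> separated j"
    and y: "y \<in> carrier G" and n: "n \<in> N k" "n' \<in> N k"
  shows "(y \<otimes> n, y \<otimes> n') \<in> twisted (Suc k) \<longleftrightarrow> (lf k n, lf k n') \<in> layer_rel k"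
proof
  have kc: "k \<le> c" "Suc k \<le> c" using k by auto
  have nc: "n \<in> carrier G" "n' \<in> carrier G" using n N_carrier[OF kc(1)] by auto
  assume "(y \<otimes> n, y \<otimes> n') \<in> twisted (Suc k)"
  then obtain z m where z: "z \<in> carrier G" "m \<in> N (Suc k)" "y \<otimes> n = z \<otimes> (y \<otimes> n') \<otimes> inv (\<phi> z) \<otimes> m"
    by (auto simp: twisted_def)
  have mk: "m \<in> N k" "lf k m = 0" using z(2) N_Suc[OF k] by auto
  have mc: "m \<in> carrier G" using mk N_carrier[OF kc(1)] by blast
  have eq: "n = (inv y \<otimes> z \<otimes> y) \<otimes> (n' \<otimes> (inv (\<phi> z) \<otimes> m))"
  proof -
    have "n = inv y \<otimes> (y \<otimes> n)" using y nc by (simp add: group_simps)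
    then show ?thesis unfolding z(3) using y z(1) nc mc by (simp add: group_simps)
  qed
  \<comment> \<open>Valid in every layer that \<open>z\<close> has reached; conjugation by
    \<open>y\<close> is invisible to \<open>lf j\<close>.\<close>
  have val: "lf j n = lf j z + (lf j n' + (- \<psi> j (lf j z) + lf j m))" if "j \<le> k" "z \<in> N j" for j
  proof -
    have j: "j < c" "j \<le> c" using that k by auto
    have in_N: "n \<in> N j" "n' \<in> N j" "m \<in> N j" using N_antimono[OF that(1) kc(1)] n mk by auto
    note mem = N_conj'[OF j(2) that(2) y] N_inv[OF j(2) N_\<phi>[OF j(2) that(2)]]
    have "lf j n = lf j (inv y \<otimes> z \<otimes> y) + (lf j n' + (lf j (inv (\<phi> z)) + lf j m))"
      by (subst eq) (simp add: lf_mult[OF j(1)] N_closed[OF j(2)] mem in_N)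
    then show ?thesis
      using lf_conj'[OF j(1) that(2) y] lf_inv[OF j(1) N_\<phi>[OF j(2) that(2)]] lf_\<phi>[OF j(1) that(2)] by simp
  qed
  have "z \<in> N j" if "j \<le> k" for j
    using that
  proof (induction j)
    case (Suc j)
    then have j: "j < k" "z \<in> N j" "j < c" using k by auto
    have "x \<in> N (Suc j)" if "x \<in> N k" for x using N_antimono[of "Suc j" k] j kc that by auto
    then have "lf j n = 0" "lf j n' = 0" "lf j m = 0" using n mk N_Suc[OF j(3)] by auto
    then have "lf j z = \<psi> j (lf j z)" using val[of j] j by (simp add: algebra_simps)
    moreover have "lf j z \<in> layer j" using j(2) by (simp add: layer_def)
    ultimately have "lf j z = 0" using sep[OF j(1)] by (auto simp: separated_def)
    then show ?case using N_Suc[OF j(3)] j(2) by simp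
  qed (use z(1) N_0 in simp)
  then have zk: "z \<in> N k" by simp
  then have "lf k n - lf k n' = lf k z - \<psi> k (lf k z)" using val[of k] mk by (simp add: algebra_simps)
  then show "(lf k n, lf k n') \<in> layer_rel k" using n zk by (auto simp: coset_rel_def layer_def)
next
  have kc: "k \<le> c" using k by auto
  have nc: "n \<in> carrier G" "n' \<in> carrier G" using n N_carrier[OF kc] by auto
  assume "(lf k n, lf k n') \<in> layer_rel k"
  then obtain z where z: "z \<in> N k" "lf k n - lf k n' = lf k z - \<psi> k (lf k z)"
    by (auto simp: coset_rel_def layer_def)
  have zc: "z \<in> carrier G" using z N_carrier[OF kc] by blast
  \<comment> \<open>The equation \<open>y n = z y n' \<phi>(z)^-1 m\<close> solved for
    \<open>m\<close>; the choice of \<open>z\<close> makes the leading form of \<open>m\<close>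
    vanish.\<close>
  define m where "m = \<phi> z \<otimes> (inv n' \<otimes> ((inv y \<otimes> inv z \<otimes> y) \<otimes> n))"
  note mem = N_conj'[OF kc N_inv[OF kc z(1)] y] N_\<phi>[OF kc z(1)] N_inv[OF kc n(2)] n(1)
  have mk: "m \<in> N k" unfolding m_def by (simp add: N_closed[OF kc] mem)
  have "lf k m = lf k (\<phi> z) + (lf k (inv n') + (lf k (inv y \<otimes> inv z \<otimes> y) + lf k n))"
    unfolding m_def by (simp add: lf_mult[OF k] N_closed[OF kc] mem)
  also have "\<dots> = 0"
    using lf_\<phi>[OF k z(1)] lf_inv[OF k n(2)] lf_conj'[OF k N_inv[OF kc z(1)] y] lf_inv[OF k z(1)] z(2)
    by (simp add: algebra_simps)
  finally have "m \<in> N (Suc k)" using mk N_Suc[OF k] by simp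
  moreover have "y \<otimes> n = z \<otimes> (y \<otimes> n') \<otimes> inv (\<phi> z) \<otimes> m"
    unfolding m_def using y zc nc by (simp add: group_simps)
  ultimately show "(y \<otimes> n, y \<otimes> n') \<in> twisted (Suc k)" using y zc nc unfolding twisted_def by blast
qed

lemma twisted_coarsen:
  assumes k: "k < c" and y: "y \<in> carrier G" "y' \<in> carrier G" and n: "n \<in> N k" "n' \<in> N k"
    and rel: "(y \<otimes> n, y' \<otimes> n') \<in> twisted (Suc k)"
  shows "(y, y') \<in> twisted k"
proof -
  have kc: "k \<le> c" using k by auto
  have nc: "n \<in> carrier G" "n' \<in> carrier G" using n N_carrier[OF kc] by auto
  from rel obtain z m where z: "z \<in> carrier G" "m \<in> N (Suc k)" "y \<otimes> n = z \<otimes> (y' \<otimes> n') \<otimes> inv (\<phi> z) \<otimes> m"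
    by (auto simp: twisted_def)
  have mk: "m \<in> N k" using z(2) N_Suc[OF k] by auto
  have mc: "m \<in> carrier G" using mk N_carrier[OF kc] by blast
  have "y = (y \<otimes> n) \<otimes> inv n" using y nc by (simp add: group_simps)
  then have "y = z \<otimes> y' \<otimes> inv (\<phi> z) \<otimes> ((\<phi> z \<otimes> n' \<otimes> inv (\<phi> z)) \<otimes> m \<otimes> inv n)"
    unfolding z(3) using y(2) z(1) nc mc by (simp add: group_simps)
  moreover have "(\<phi> z \<otimes> n' \<otimes> inv (\<phi> z)) \<otimes> m \<otimes> inv n \<in> N k"
    using N_closed[OF kc N_closed[OF kc N_conj[OF kc n(2)] mk] N_inv[OF kc n(1)]] z(1) by simp
  ultimately show ?thesis using y z(1) unfolding twisted_def by blast
qed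

lemma twisted_refine:
  assumes k: "k < c" and "(x, y) \<in> twisted k"
  shows "\<exists>n\<in>N k. (x, y \<otimes> n) \<in> twisted (Suc k)"
proof -
  have kc: "k \<le> c" "Suc k \<le> c" using k by auto
  from assms(2) obtain z n where z: "x \<in> carrier G" "y \<in> carrier G" "z \<in> carrier G" "n \<in> N k" "x = z \<otimes> y \<otimes> inv (\<phi> z) \<otimes> n"
    by (auto simp: twisted_def)
  have nc: "n \<in> carrier G" using N_carrier[OF kc(1)] z by blast
  define n' where "n' = inv (\<phi> z) \<otimes> n \<otimes> \<phi> z"
  have n': "n' \<in> N k" "n' \<in> carrier G"
    using N_conj'[OF kc(1) z(4)] z(3) nc by (simp_all add: n'_def)
  have "x = z \<otimes> (y \<otimes> n') \<otimes> inv (\<phi> z) \<otimes> \<one>"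
    unfolding z(5) n'_def using z(2,3) nc by (simp add: group_simps)
  then have "(x, y \<otimes> n') \<in> twisted (Suc k)"
    using z(1,2,3) n' N_one[OF kc(2)] m_closed[OF z(2) n'(2)] unfolding twisted_def by blast
  then show ?thesis using n' by blast
qed

text \<open>Over every class modulo \<open>N k\<close> lie equally many finer classes: after
  choosing a base point \<open>y C\<close>, they are parametrized by the cosets in the layer, and
  separation below \<open>k\<close> makes this independent of the base point.\<close>

lemma card_inf_twisted_Suc:
  assumes k: "k < c" and sep: "\<And>j. j < k \<Longrightarrow> separated j"
  shows "card_inf (carrier G // twisted (Suc k)) =
    card_inf (carrier G // twisted k) * card_inf (layer k // layer_rel k)"
proof -
  have kc: "k \<le> c" "Suc k \<le> c" using k by auto
  note eqv = twisted_equiv[OF kc(1)] and eqv' = twisted_equiv[OF kc(2)] and eqvl = layer_equiv[OF k]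
  define y where "y C = (SOME y. y \<in> C)" for C :: "'a set"
  define v where "v D = (SOME v. v \<in> D)" for D :: "'v set"
  define n where "n u = (SOME x. x \<in> N k \<and> lf k x = u)" for u
  have y: "y C \<in> C" "y C \<in> carrier G" if "C \<in> carrier G // twisted k" for C
  proof -
    have "C \<noteq> {}" using in_quotient_imp_non_empty[OF eqv that] .
    then show "y C \<in> C" unfolding y_def by (simp add: some_in_eq)
    then show "y C \<in> carrier G" using in_quotient_imp_subset[OF eqv that] by blast
  qed
  have v: "v D \<in> D" "v D \<in> layer k" if "D \<in> layer k // layer_rel k" for D
  proof -
    have "D \<noteq> {}" using in_quotient_imp_non_empty[OF eqvl that] .
    then show "v D \<in> D" unfolding v_def by (simp add: some_in_eq)
    then show "v D \<in> layer k" using in_quotient_imp_subset[OF eqvl that] by blast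
  qed
  have n: "n u \<in> N k" "lf k (n u) = u" if "u \<in> layer k" for u
  proof -
    have "\<exists>x. x \<in> N k \<and> lf k x = u" using that by (auto simp: layer_def)
    from someI_ex[OF this] show "n u \<in> N k" "lf k (n u) = u" by (simp_all add: n_def)
  qed
  define f where "f p = twisted (Suc k) `` {y (fst p) \<otimes> n (v (snd p))}" for p
  have "bij_betw f ((carrier G // twisted k) \<times> (layer k // layer_rel k)) (carrier G // twisted (Suc k))"
    unfolding bij_betw_def
  proof
    show "inj_on f ((carrier G // twisted k) \<times> (layer k // layer_rel k))"
    proof (rule inj_onI; clarify)
      fix C D C' D'
      assume C: "C \<in> carrier G // twisted k" "C' \<in> carrier G // twisted k"
        and D: "D \<in> layer k // layer_rel k" "D' \<in> layer k // layer_rel k"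
        and "f (C, D) = f (C', D')"
      then have "twisted (Suc k) `` {y C \<otimes> n (v D)} = twisted (Suc k) `` {y C' \<otimes> n (v D')}"
        by (simp add: f_def)
      note n1 = n[OF v(2)[OF D(1)]] and n2 = n[OF v(2)[OF D(2)]]
      have rel: "(y C \<otimes> n (v D), y C' \<otimes> n (v D')) \<in> twisted (Suc k)"
        using \<open>twisted (Suc k) `` {y C \<otimes> n (v D)} = _\<close> eq_equiv_class[OF _ eqv'] y(2)[OF C(2)] N_carrier[OF kc(1) n2(1)]
        by blast
      have "(y C, y C') \<in> twisted k"
        by (rule twisted_coarsen[OF k y(2)[OF C(1)] y(2)[OF C(2)] n1(1) n2(1) rel])
      then have CC: "C = C'" using quotient_eqI[OF eqv C y(1)[OF C(1)] y(1)[OF C(2)]] by blast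
      then have "(v D, v D') \<in> layer_rel k"
        using twisted_layer_iff[OF k sep y(2)[OF C(1)] n1(1) n2(1)] rel n1(2) n2(2) by simp
      then have "D = D'" by (rule quotient_eqI[OF eqvl D v(1)[OF D(1)] v(1)[OF D(2)]])
      then show "C = C' \<and> D = D'" using CC by simp
    qed
    show "f ` ((carrier G // twisted k) \<times> (layer k // layer_rel k)) = carrier G // twisted (Suc k)"
    proof
      have "f (C, D) \<in> carrier G // twisted (Suc k)"
        if "C \<in> carrier G // twisted k" "D \<in> layer k // layer_rel k" for C D
        using y(2)[OF that(1)] N_carrier[OF kc(1) n(1)[OF v(2)[OF that(2)]]]
        by (auto simp: f_def intro: quotientI)
      then show "f ` ((carrier G // twisted k) \<times> (layer k // layer_rel k)) \<subseteq> carrier G // twisted (Suc k)" by auto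
      show "carrier G // twisted (Suc k) \<subseteq> f ` ((carrier G // twisted k) \<times> (layer k // layer_rel k))"
      proof
        fix E assume "E \<in> carrier G // twisted (Suc k)"
        then obtain x where x: "x \<in> carrier G" "E = twisted (Suc k) `` {x}" by (auto elim: quotientE)
        define C where "C = twisted k `` {x}"
        have C: "C \<in> carrier G // twisted k" using x by (auto simp: C_def intro: quotientI)
        have "(x, y C) \<in> twisted k" using y(1)[OF C] by (simp add: C_def)
        then obtain m where m: "m \<in> N k" "(x, y C \<otimes> m) \<in> twisted (Suc k)" using twisted_refine[OF k] by blast
        define D where "D = layer_rel k `` {lf k m}"
        have lm: "lf k m \<in> layer k" using m by (simp add: layer_def)
        have D: "D \<in> layer k // layer_rel k" using lm by (auto simp: D_def intro: quotientI)
        note nD = n[OF v(2)[OF D]]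
        have "(lf k m, v D) \<in> layer_rel k" using v(1)[OF D] by (simp add: D_def)
        then have "(y C \<otimes> m, y C \<otimes> n (v D)) \<in> twisted (Suc k)"
          using twisted_layer_iff[OF k sep y(2)[OF C] m(1) nD(1)] nD(2) by simp
        then have "(x, y C \<otimes> n (v D)) \<in> twisted (Suc k)"
          using m(2) eqv' by (meson equivE transE)
        then have "E = f (C, D)" using equiv_class_eq[OF eqv'] x(2) by (simp add: f_def)
        then show "E \<in> f ` ((carrier G // twisted k) \<times> (layer k // layer_rel k))" using C D by auto
      qed
    qed
  qed
  then have "card_inf (carrier G // twisted (Suc k)) = card_inf ((carrier G // twisted k) \<times> (layer k // layer_rel k))"
    by (rule card_inf_bij_betw[symmetric])
  also have "\<dots> = card_inf (carrier G // twisted k) * card_inf (layer k // layer_rel k)"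
  proof (rule card_inf_times)
    show "carrier G // twisted k \<noteq> {}" using one_closed by (auto simp: quotient_def)
    show "layer k // layer_rel k \<noteq> {}" using layer_closed(1)[OF k] by (auto simp: quotient_def)
  qed
  finally show ?thesis .
qed

text \<open>The layers are multiplied up as long as they are separated. A layer that is not has
  infinite index by hypothesis, and from there on both sides are infinite.\<close>

theorem card_inf_twisted:
  assumes sep: "\<And>k. k < c \<Longrightarrow> card_inf (layer k // layer_rel k) \<noteq> \<infinity> \<Longrightarrow> separated k"
  shows "card_inf (carrier G // twisted c) = (\<Prod>k<c. card_inf (layer k // layer_rel k))"
proof -
  have pos: "card_inf (layer k // layer_rel k) \<noteq> 0" if "k < c" for k
    using layer_closed(1)[OF that] by (auto simp: card_inf_eq_0_iff quotient_def)
  have "card_inf (carrier G // twisted k) = (\<Prod>j<k. card_inf (layer j // layer_rel j))" if "k \<le> c" for k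
    using that
  proof (induction k)
    case 0
    have "(x, y) \<in> twisted 0" if "x \<in> carrier G" "y \<in> carrier G" for x y
    proof -
      have "x = \<one> \<otimes> y \<otimes> inv (\<phi> \<one>) \<otimes> (inv y \<otimes> x)" using that by (simp add: group_simps)
      moreover have "inv y \<otimes> x \<in> N 0" using that N_0 by simp
      ultimately show ?thesis using that one_closed unfolding twisted_def by blast
    qed
    then have "twisted 0 = carrier G \<times> carrier G" by (auto simp: twisted_def)
    then have "carrier G // twisted 0 = {carrier G}" using one_closed by (auto simp: quotient_def)
    then show ?case by (simp add: card_inf_def one_enat_def)
  next
    case (Suc k)
    then have k: "k < c" and IH: "card_inf (carrier G // twisted k) = (\<Prod>j<k. card_inf (layer j // layer_rel j))" by auto
    show ?case
    proof (cases "\<forall>j<k. separated j")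
      case True
      then show ?thesis using card_inf_twisted_Suc[OF k] IH by simp
    next
      case False
      then obtain j where j: "j < k" "card_inf (layer j // layer_rel j) = \<infinity>" using sep k by (meson order.strict_trans)
      have inf: "(\<Prod>j<m. card_inf (layer j // layer_rel j)) = \<infinity>" if "j < m" "m \<le> c" for m
        by (rule prod_enat_eq_infinity[of _ _ j]) (use that j pos in auto)
      have "infinite (carrier G // twisted k)"
        using IH inf[of k] j k by (auto simp: card_inf_def split: if_splits)
      \<comment> \<open>A finer relation has at least as many classes.\<close>
      moreover have "twisted (Suc k) \<subseteq> twisted k" unfolding twisted_def using N_Suc[OF k] by auto
      ultimately have "infinite (carrier G // twisted (Suc k))"
        using finite_refines_finite[OF _ _ twisted_equiv[of "Suc k"] twisted_equiv[of k]] k by auto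
      then show ?thesis using inf[of "Suc k"] j k by (simp add: card_inf_def)
    qed
  qed
  then show ?thesis by simp
qed

end

section \<open>The index of the image of an integer matrix\<close>

text \<open>Compatible with \<open>0 * \<infinity> = 0\<close> because \<open>abs_inf\<close> never
  takes the value 0.\<close>

lemma abs_inf_mult: "abs_inf (a * b) = abs_inf a * abs_inf b"
  by (auto simp: abs_inf_def abs_mult nat_mult_distrib zero_enat_def[symmetric])

lemma abs_inf_1: "abs_inf 1 = 1"
  by (simp add: abs_inf_def one_enat_def)

lemma abs_inf_prod: "abs_inf (prod f A) = (\<Prod>x\<in>A. abs_inf (f x))"
  by (induction A rule: infinite_finite_induct) (simp_all add: abs_inf_mult abs_inf_1)

lemma card_inf_residues: "card_inf (UNIV // coset_rel (\<lambda>z. d * z) UNIV) = abs_inf (d :: int)"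
proof -
  let ?R = "coset_rel (\<lambda>z. d * z) UNIV"
  have R: "(u, v) \<in> ?R \<longleftrightarrow> d dvd u - v" for u v by (auto simp: coset_rel_def dvd_def)
  have eqv: "equiv UNIV ?R"
  proof (rule equivI)
    show "sym ?R" unfolding sym_def R by (simp add: dvd_diff_commute)
    show "trans ?R" unfolding trans_def R by (metis diff_add_cancel dvd_add add_diff_eq)
  qed (auto simp: refl_on_def R)
  show ?thesis
  proof (cases "d = 0")
    case True
    have "p \<in> ?R \<longleftrightarrow> p \<in> Id" for p
      by (cases p, simp only: R) (simp add: True)
    then have "?R = Id" by blast
    then have "UNIV // ?R = range (\<lambda>x. {x})" by (auto simp: quotient_def)
    moreover have "infinite (range (\<lambda>x :: int. {x}))"
      using finite_imageD[of "\<lambda>x::int. {x}" UNIV] infinite_UNIV_int by auto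
    ultimately show ?thesis by (simp add: card_inf_def abs_inf_def True)
  next
    case False
    have "bij_betw (\<lambda>x. ?R `` {x}) {0..<\<bar>d\<bar>} (UNIV // ?R)"
      unfolding bij_betw_def
    proof
      show "inj_on (\<lambda>x. ?R `` {x}) {0..<\<bar>d\<bar>}"
      proof (rule inj_onI)
        fix x y assume *: "x \<in> {0..<\<bar>d\<bar>}" "y \<in> {0..<\<bar>d\<bar>}" "?R `` {x} = ?R `` {y}"
        then have "(x, y) \<in> ?R" using eq_equiv_class[OF _ eqv] by blast
        then have "\<bar>d\<bar> dvd x - y" by (simp add: R)
        then have "x mod \<bar>d\<bar> = y mod \<bar>d\<bar>" by (simp add: mod_eq_dvd_iff)
        then show "x = y" using * by simp
      qed
      have "\<exists>y\<in>{0..<\<bar>d\<bar>}. ?R `` {x} = ?R `` {y}" for x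
      proof (rule bexI[of _ "x mod \<bar>d\<bar>"])
        have "(x, x mod \<bar>d\<bar>) \<in> ?R" unfolding R by (metis abs_dvd_iff dvd_minus_mod)
        then show "?R `` {x} = ?R `` {x mod \<bar>d\<bar>}" by (rule equiv_class_eq[OF eqv])
      qed (use False in simp)
      then show "(\<lambda>x. ?R `` {x}) ` {0..<\<bar>d\<bar>} = UNIV // ?R" by (auto simp: quotient_def)
    qed
    then have "card_inf (UNIV // ?R) = card_inf {0..<\<bar>d\<bar>}" using card_inf_bij_betw by metis
    then show ?thesis using False by (simp add: card_inf_def abs_inf_def)
  qed
qed

section \<open>The index of a column lattice\<close>

definition mat_coset_rel :: "nat \<Rightarrow> int mat \<Rightarrow> (int vec \<times> int vec) set" where
  "mat_coset_rel n B = {(x, y). x \<in> carrier_vec n \<and> y \<in> carrier_vec n \<and> (\<exists>z\<in>carrier_vec n. x = y + B *\<^sub>v z)}"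

definition vec_group :: "nat \<Rightarrow> int vec monoid" where
  "vec_group n = \<lparr>carrier = carrier_vec n, monoid.mult = (+), one = 0\<^sub>v n\<rparr>"

lemma vec_group_simps [simp]:
  "carrier (vec_group n) = carrier_vec n" "x \<otimes>\<^bsub>vec_group n\<^esub> y = x + y" "\<one>\<^bsub>vec_group n\<^esub> = 0\<^sub>v n"
  by (simp_all add: vec_group_def)

lemma vec_group_is_group: "group (vec_group n)"
proof (rule groupI)
  fix x assume "x \<in> carrier (vec_group n)"
  then show "\<exists>y\<in>carrier (vec_group n). y \<otimes>\<^bsub>vec_group n\<^esub> x = \<one>\<^bsub>vec_group n\<^esub>"
    by (intro bexI[of _ "- x"]) auto
qed (auto simp: assoc_add_vec[of _ n])

lemma vec_group_inv: "x \<in> carrier_vec n \<Longrightarrow> inv\<^bsub>vec_group n\<^esub> x = - x"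
  by (rule group.inv_equality[OF vec_group_is_group]) auto

text \<open>The counting theorem is applied to \<open>\<phi> = 1 - T\<close> on integer vectors:
  \<open>z + y - \<phi> z = y + T z\<close>, so twisted conjugacy is congruence modulo the image of
  \<open>T\<close>. A lower triangular \<open>T\<close> preserves the filtration by the vanishing of
  the first \<open>k\<close> coordinates, and on such vectors it multiplies the next coordinate by a
  diagonal entry.\<close>

lemma card_inf_lower_triangular:
  assumes T: "T \<in> carrier_mat n n" and low: "\<And>i j. i < j \<Longrightarrow> j < n \<Longrightarrow> T $$ (i, j) = 0"
  shows "card_inf (carrier_vec n // mat_coset_rel n T) = abs_inf (det T)"
proof -
  define N where "N k = {v :: int vec. v \<in> carrier_vec n \<and> (\<forall>i<k. v $ i = 0)}" for k
  define \<phi> where "\<phi> v = v - T *\<^sub>v v" for v :: "int vec"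
  have Tv: "(T *\<^sub>v v) $ k = T $$ (k, k) * v $ k" if "v \<in> N k" "k < n" for v k
  proof -
    have "(T *\<^sub>v v) $ k = (\<Sum>j<n. T $$ (k, j) * v $ j)"
      using that T by (auto simp: scalar_prod_def N_def atLeast0LessThan intro!: sum.cong)
    also have "\<dots> = (\<Sum>j<n. if j = k then T $$ (k, k) * v $ k else 0)"
      by (rule sum.cong) (use that low in \<open>auto simp: N_def neq_iff\<close>)
    finally show ?thesis using that by simp
  qed
  have TN: "T *\<^sub>v v \<in> N k" if "v \<in> N k" "k \<le> n" for v k
  proof -
    have "(T *\<^sub>v v) $ i = 0" if "i < k" for i
      using Tv[of v i] \<open>v \<in> N k\<close> \<open>k \<le> n\<close> that by (auto simp: N_def)
    then show ?thesis using that T by (auto simp: N_def)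
  qed
  have Tadd: "T *\<^sub>v (x + y) = T *\<^sub>v x + T *\<^sub>v y" if "x \<in> carrier_vec n" "y \<in> carrier_vec n" for x y
    using mult_add_distrib_mat_vec[OF T that] .
  interpret group "vec_group n" by (rule vec_group_is_group)
  interpret central_filtration "vec_group n" \<phi> N n "\<lambda>k v. v $ k" "\<lambda>k a. a - T $$ (k, k) * a"
  proof (intro central_filtration.intro central_filtration_axioms.intro)
    show "group (vec_group n)" by (rule vec_group_is_group)
    show "\<phi> \<in> hom (vec_group n) (vec_group n)"
    proof (rule homI)
      fix x y assume "x \<in> carrier (vec_group n)" "y \<in> carrier (vec_group n)"
      then show "\<phi> (x \<otimes>\<^bsub>vec_group n\<^esub> y) = \<phi> x \<otimes>\<^bsub>vec_group n\<^esub> \<phi> y"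
        using T by (intro eq_vecI) (auto simp: \<phi>_def Tadd)
    qed (use T in \<open>auto simp: \<phi>_def\<close>)
    show "N 0 = carrier (vec_group n)" by (simp add: N_def)
    show "subgroup (N k) (vec_group n)" if "k \<le> n" for k
      by (rule subgroupI) (use that in \<open>auto simp: N_def vec_group_inv intro!: exI[of _ "0\<^sub>v n"]\<close>)
    show "y \<otimes>\<^bsub>vec_group n\<^esub> x \<otimes>\<^bsub>vec_group n\<^esub> inv\<^bsub>vec_group n\<^esub> y \<in> N k" if "k \<le> n" "x \<in> N k" "y \<in> carrier (vec_group n)" for k x y
      using that by (auto simp: N_def vec_group_inv)
    show "(y \<otimes>\<^bsub>vec_group n\<^esub> x \<otimes>\<^bsub>vec_group n\<^esub> inv\<^bsub>vec_group n\<^esub> y) $ k = x $ k" if "k < n" "x \<in> N k" "y \<in> carrier (vec_group n)" for k x y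
      using that by (auto simp: N_def vec_group_inv)
    show "\<phi> x \<in> N k" if "k \<le> n" "x \<in> N k" for k x
      using TN[OF that(2,1)] that T by (auto simp: \<phi>_def N_def)
    show "\<phi> x $ k = x $ k - T $$ (k, k) * x $ k" if "k < n" "x \<in> N k" for k x
      using Tv[OF that(2,1)] that T by (auto simp: \<phi>_def)
  qed (auto simp: N_def less_Suc_eq)
  have layer: "layer k = UNIV" if "k < n" for k
  proof -
    have "a \<in> layer k" for a
      unfolding layer_def by (rule image_eqI[of _ _ "a \<cdot>\<^sub>v unit_vec n k"]) (use that in \<open>auto simp: N_def\<close>)
    then show ?thesis by auto
  qed
  have rel: "layer_rel k = coset_rel (\<lambda>z. T $$ (k, k) * z) UNIV" if "k < n" for k
    by (simp add: layer[OF that] coset_rel_def)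
  have sep: "separated k" if "k < n" "card_inf (layer k // layer_rel k) \<noteq> \<infinity>" for k
  proof -
    have "T $$ (k, k) \<noteq> 0" using that card_inf_residues[of "T $$ (k, k)"] by (auto simp: rel layer abs_inf_def)
    then show ?thesis by (auto simp: separated_def)
  qed
  have "twisted n = mat_coset_rel n T"
  proof -
    have N: "N n = {0\<^sub>v n}" by (auto simp: N_def)
    have "z + y + - (z - T *\<^sub>v z) + 0\<^sub>v n = y + T *\<^sub>v z" if "y \<in> carrier_vec n" "z \<in> carrier_vec n" for y z
      using that T by (intro eq_vecI) auto
    moreover have "\<phi> z \<in> carrier_vec n" if "z \<in> carrier_vec n" for z using that T by (simp add: \<phi>_def)
    moreover have "y + T *\<^sub>v z + 0\<^sub>v n = y + T *\<^sub>v z" if "y \<in> carrier_vec n" "z \<in> carrier_vec n" for y z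
      using that T by simp
    ultimately show ?thesis by (fastforce simp: twisted_def mat_coset_rel_def N vec_group_inv \<phi>_def)
  qed
  then have "card_inf (carrier_vec n // mat_coset_rel n T) = (\<Prod>k<n. abs_inf (T $$ (k, k)))"
    using card_inf_twisted[OF sep] by (simp add: rel layer card_inf_residues)
  also have "\<dots> = abs_inf (det T)"
    using det_lower_triangular[OF low T] T by (simp add: diag_mat_def prod.list_conv_set_nth atLeast0LessThan flip: abs_inf_prod)
  finally show ?thesis .
qed

text \<open>Column operations only: multiplication by a unimodular matrix on the right keeps the
  image lattice and changes the determinant at most by a sign.\<close>

definition column_equiv :: "nat \<Rightarrow> int mat \<Rightarrow> int mat \<Rightarrow> bool" where
  "column_equiv n A B \<longleftrightarrow> A \<in> carrier_mat n n \<and> (\<exists>V W. V \<in> carrier_mat n n \<and> W \<in> carrier_mat n n \<and>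
     V * W = 1\<^sub>m n \<and> W * V = 1\<^sub>m n \<and> B = A * V)"

lemma column_equiv_refl: "A \<in> carrier_mat n n \<Longrightarrow> column_equiv n A A"
  unfolding column_equiv_def by (intro conjI exI[of _ "1\<^sub>m n"]) auto

lemma column_equiv_carrier: "column_equiv n A B \<Longrightarrow> B \<in> carrier_mat n n"
  by (auto simp: column_equiv_def)

lemma column_equiv_trans:
  assumes "column_equiv n A B" "column_equiv n B C"
  shows "column_equiv n A C"
proof -
  obtain V W V' W' where *: "A \<in> carrier_mat n n" "V \<in> carrier_mat n n" "W \<in> carrier_mat n n" "V * W = 1\<^sub>m n" "W * V = 1\<^sub>m n" "B = A * V"
    "V' \<in> carrier_mat n n" "W' \<in> carrier_mat n n" "V' * W' = 1\<^sub>m n" "W' * V' = 1\<^sub>m n" "C = B * V'"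
    using assms by (auto simp: column_equiv_def)
  have "V' * (W' * W) = W" "W * (V * V') = V'"
    using assoc_mult_mat[of V' n n W' n W n] assoc_mult_mat[of W n n V n V' n] * by simp_all
  then have 1: "(V * V') * (W' * W) = 1\<^sub>m n" and 2: "(W' * W) * (V * V') = 1\<^sub>m n"
    using assoc_mult_mat[of V n n V' n "W' * W" n] assoc_mult_mat[of W' n n W n "V * V'" n] * by simp_all
  show ?thesis
    unfolding column_equiv_def
    by (intro conjI exI[of _ "V * V'"] exI[of _ "W' * W"]) (use * 1 2 in \<open>auto simp: assoc_mult_mat[of _ n n _ n _ n]\<close>)
qed

lemma column_equiv_addcol:
  assumes "A \<in> carrier_mat n n" "k < n" "l < n" "k \<noteq> l"
  shows "column_equiv n A (addcol a l k A)"
proof -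
  have "addrow_mat n (- a) k l * addrow_mat n a k l = 1\<^sub>m n"
    using addrow_mat_inv[OF assms(2-4), of "- a"] by simp
  then show ?thesis
    unfolding column_equiv_def using assms addcol_mat[OF assms(1,2), of a l] addrow_mat_inv[OF assms(2-4), of a]
    by (intro conjI exI[of _ "addrow_mat n a k l"] exI[of _ "addrow_mat n (- a) k l"]) auto
qed

lemma column_equiv_swapcols:
  assumes "A \<in> carrier_mat n n" "k < n" "l < n"
  shows "column_equiv n A (swapcols k l A)"
  unfolding column_equiv_def using assms swapcols_mat[OF assms] swaprows_mat_inv[OF assms(2,3)]
  by (intro conjI exI[of _ "swaprows_mat n k l"]) auto

text \<open>The Euclidean algorithm on the entries of row \<open>i\<close> from column
  \<open>i\<close> on; the sum of their absolute values decreases. The rows above have zeros in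
  these columns, so they stay unaffected.\<close>

lemma column_equiv_row:
  assumes "A \<in> carrier_mat n n" "i < n" "\<And>i' j. i' < i \<Longrightarrow> i' < j \<Longrightarrow> j < n \<Longrightarrow> A $$ (i', j) = 0"
  shows "\<exists>B. column_equiv n A B \<and> (\<forall>i'\<le>i. \<forall>j. i' < j \<longrightarrow> j < n \<longrightarrow> B $$ (i', j) = 0)"
  using assms
proof (induction "\<Sum>j\<in>{i..<n}. nat \<bar>A $$ (i, j)\<bar>" arbitrary: A rule: less_induct)
  case less
  note A = less.prems(1) and i = less.prems(2) and low = less.prems(3)
  show ?case
  proof (cases "\<exists>k l. i \<le> k \<and> k < n \<and> i \<le> l \<and> l < n \<and> k \<noteq> l \<and> A $$ (i, k) \<noteq> 0 \<and> A $$ (i, l) \<noteq> 0")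
    case True
    then obtain k l where kl: "i \<le> k" "k < n" "i \<le> l" "l < n" "k \<noteq> l" "A $$ (i, k) \<noteq> 0" "\<bar>A $$ (i, k)\<bar> \<le> \<bar>A $$ (i, l)\<bar>"
      by (metis linorder_linear)
    \<comment> \<open>One subtraction instead of a division: the sign is chosen so that adding the
      smaller entry shrinks the larger one in absolute value.\<close>
    define a where "a = - (sgn (A $$ (i, l)) * sgn (A $$ (i, k)))"
    define B where "B = addcol a l k A"
    have AB: "column_equiv n A B" unfolding B_def by (rule column_equiv_addcol[OF A]) (use kl in auto)
    have B: "B \<in> carrier_mat n n" using column_equiv_carrier[OF AB] .
    have entry: "B $$ (i', j) = (if j = l then a * A $$ (i', k) + A $$ (i', j) else A $$ (i', j))" if "i' < n" "j < n" for i' j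
      using that A by (auto simp: B_def)
    have lowB: "B $$ (i', j) = 0" if "i' < i" "i' < j" "j < n" for i' j
      using that low i kl by (simp add: entry)
    have "\<bar>a * A $$ (i, k) + A $$ (i, l)\<bar> < \<bar>A $$ (i, l)\<bar>"
      using kl(6,7) by (auto simp: a_def sgn_if split: if_splits)
    then have "(\<Sum>j\<in>{i..<n}. nat \<bar>B $$ (i, j)\<bar>) < (\<Sum>j\<in>{i..<n}. nat \<bar>A $$ (i, j)\<bar>)"
      using kl i by (intro sum_strict_mono_ex1) (auto simp: entry intro!: bexI[of _ l])
    from less.hyps[OF this B i lowB] show ?thesis using column_equiv_trans[OF AB] by blast
  next
    case False
    \<comment> \<open>At most one nonzero entry is left; it is moved to the diagonal.\<close>
    then obtain m where m: "i \<le> m" "m < n" "\<And>j. i \<le> j \<Longrightarrow> j < n \<Longrightarrow> j \<noteq> m \<Longrightarrow> A $$ (i, j) = 0"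
      using i by (metis order_refl)
    define B where "B = swapcols i m A"
    have AB: "column_equiv n A B" unfolding B_def by (rule column_equiv_swapcols[OF A]) (use m i in auto)
    have "B $$ (i', j) = 0" if "i' \<le> i" "i' < j" "j < n" for i' j
    proof (cases "i' = i")
      case True
      then show ?thesis using that m A i by (auto simp: B_def)
    next
      case False
      then show ?thesis using that m A i low by (auto simp: B_def)
    qed
    then show ?thesis using AB by blast
  qed
qed

lemma column_equiv_lower_triangular:
  assumes "A \<in> carrier_mat n n"
  shows "\<exists>B. column_equiv n A B \<and> (\<forall>i j. i < j \<longrightarrow> j < n \<longrightarrow> B $$ (i, j) = 0)"
proof -
  have "\<exists>B. column_equiv n A B \<and> (\<forall>i j. i < m \<longrightarrow> i < j \<longrightarrow> j < n \<longrightarrow> B $$ (i, j) = 0)" if "m \<le> n" for m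
    using that
  proof (induction m)
    case 0
    then show ?case using column_equiv_refl[OF assms] by auto
  next
    case (Suc m)
    then obtain B where B: "column_equiv n A B" "\<And>i j. i < m \<Longrightarrow> i < j \<Longrightarrow> j < n \<Longrightarrow> B $$ (i, j) = 0" by auto
    then obtain C where "column_equiv n B C" "\<forall>i\<le>m. \<forall>j. i < j \<longrightarrow> j < n \<longrightarrow> C $$ (i, j) = 0"
      using column_equiv_row[OF column_equiv_carrier[OF B(1)], of m] Suc.prems by auto
    then show ?case using column_equiv_trans[OF B(1)] by (auto simp: less_Suc_eq_le)
  qed
  from this[of n] show ?thesis by (meson less_trans order_refl)
qed

theorem card_inf_mat_coset:
  assumes A: "A \<in> carrier_mat n n"
  shows "card_inf (carrier_vec n // mat_coset_rel n A) = abs_inf (det A)"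
proof -
  obtain B where B: "column_equiv n A B" "\<And>i j. i < j \<Longrightarrow> j < n \<Longrightarrow> B $$ (i, j) = 0"
    using column_equiv_lower_triangular[OF A] by blast
  then obtain V W where VW: "V \<in> carrier_mat n n" "W \<in> carrier_mat n n" "V * W = 1\<^sub>m n" "W * V = 1\<^sub>m n" "B = A * V"
    by (auto simp: column_equiv_def)
  have "(\<exists>z\<in>carrier_vec n. x = y + A *\<^sub>v z) \<longleftrightarrow> (\<exists>z\<in>carrier_vec n. x = y + B *\<^sub>v z)" for x y
  proof safe
    fix z :: "int vec" assume z: "z \<in> carrier_vec n"
    have "V *\<^sub>v (W *\<^sub>v z) = z" using assoc_mult_mat_vec[of V n n W n z] z VW by simp
    then have "A *\<^sub>v z = A *\<^sub>v (V *\<^sub>v (W *\<^sub>v z))" by simp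
    also have "\<dots> = B *\<^sub>v (W *\<^sub>v z)" using z VW A by (simp add: assoc_mult_mat_vec[of _ n n _ n])
    finally show "\<exists>z'\<in>carrier_vec n. y + A *\<^sub>v z = y + B *\<^sub>v z'" using VW z by (metis mult_mat_vec_carrier)
    have "B *\<^sub>v z = A *\<^sub>v (V *\<^sub>v z)" using z VW A by (simp add: assoc_mult_mat_vec[of _ n n _ n])
    then show "\<exists>z'\<in>carrier_vec n. y + B *\<^sub>v z = y + A *\<^sub>v z'" using VW z by (metis mult_mat_vec_carrier)
  qed
  then have "mat_coset_rel n A = mat_coset_rel n B" by (simp add: mat_coset_rel_def)
  moreover have "abs_inf (det B) = abs_inf (det A)"
  proof -
    have "det V * det W = 1" using VW det_mult[of V n W] by simp
    then have "\<bar>det V\<bar> = 1" by (metis abs_zmult_eq_1 abs_1)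
    moreover have "det B = det A * det V" using VW det_mult[OF A, of V] by simp
    ultimately show ?thesis by (auto simp: abs_inf_def abs_mult)
  qed
  ultimately show ?thesis
    using card_inf_lower_triangular[OF column_equiv_carrier[OF B(1)] B(2)] by simp
qed

section \<open>Endomorphisms of free groups and their leading forms\<close>

lemma lie_closure_uminus: "f \<in> lie_closure c S \<Longrightarrow> - f \<in> lie_closure c S"
  using lie_closure_diff[OF lie_closure_0] by fastforce

lemma lead_part_1_closure:
  assumes "g \<in> carrier (free_group r)"
  shows "lead_part 1 g \<in> lie_closure c (Leaf ` {..<r})"
proof -
  have "g \<in> generate (free_group r) ((\<lambda>i. [(i, True)]) ` {..<r})"
    using assms unfolding free_group_generate .
  then have "dim_ge 1 g \<and> lead_part 1 g \<in> lie_closure c (Leaf ` {..<r})"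
  proof (rule dim_ge_generate[where r = r, rotated -1])
    fix a assume "a \<in> (\<lambda>i. [(i, True)]) ` {..<r}"
    then obtain i where i: "i < r" "a = [(i, True)]" by auto
    then have "lie_poly (Leaf i) \<in> lie_closure c (Leaf ` {..<r})" by (intro lie_closure_gen) auto
    then show "dim_ge 1 a \<and> lead_part 1 a \<in> lie_closure c (Leaf ` {..<r})"
      unfolding i(2) lead_part_generator using dim_ge_1 by simp
  qed (auto intro: lie_closure_add lie_closure_uminus)
  then show ?thesis by blast
qed

text \<open>By induction, since the leading form of \<open>[h, x]\<close> is the bracket of the
  leading forms of \<open>h\<close> and \<open>x\<close>.\<close>

lemma lead_part_closure:
  assumes "1 \<le> k" "g \<in> lower_central (free_group r) k"
  shows "lead_part k g \<in> lie_closure c (Leaf ` {..<r})"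
  using assms
proof (induction k arbitrary: g rule: nat_induct_at_least)
  case base
  then show ?case using lead_part_1_closure by simp
next
  case (Suc k)
  interpret group "free_group r" by (rule free_group_is_group)
  obtain m where m: "k = Suc m" using \<open>1 \<le> k\<close> by (cases k) auto
  define A where "A = {commutator (free_group r) h x |h x. h \<in> lower_central (free_group r) k \<and> x \<in> carrier (free_group r)}"
  have A: "dim_ge (Suc k) a \<and> lead_part (Suc k) a \<in> lie_closure c (Leaf ` {..<r})" "a \<in> carrier (free_group r)" if "a \<in> A" for a
  proof -
    from that obtain h x where *: "a = commutator (free_group r) h x" "h \<in> lower_central (free_group r) k" "x \<in> carrier (free_group r)"
      unfolding A_def by blast
    have h: "h \<in> carrier (free_group r)" by (rule lower_central_carrier[OF *(2)])
    note comm = dim_ge_commutator[OF lower_central_dim_ge[OF Suc.hyps *(2)] dim_ge_1 h *(3), unfolded Suc_eq_plus1[symmetric]]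
    have "lead_part 1 x \<in> lie_closure c (Leaf ` {..<r})" by (rule lead_part_1_closure[OF *(3)])
    then show "dim_ge (Suc k) a \<and> lead_part (Suc k) a \<in> lie_closure c (Leaf ` {..<r})"
      unfolding *(1) comm(2) using comm(1) Suc.IH[OF *(2)] lie_closure_bracket by blast
    show "a \<in> carrier (free_group r)" unfolding *(1) by (rule commutator_closed[OF h *(3)])
  qed
  have "g \<in> generate (free_group r) A"
    using Suc.prems unfolding m lower_central_Suc_Suc A_def .
  then have "dim_ge (Suc k) g \<and> lead_part (Suc k) g \<in> lie_closure c (Leaf ` {..<r})"
  proof (rule dim_ge_generate[where A = A and r = r, rotated -1])
    show "A \<subseteq> carrier (free_group r)" using A(2) by blast
  qed (use A(1) in \<open>auto intro: lie_closure_add lie_closure_uminus\<close>)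
  then show ?case by blast
qed

text \<open>The leading form of degree 1 records the exponent sums of the generators, a point of the
  free abelian group of rank \<open>r\<close>.\<close>

lemma lead_part_1_expand:
  assumes "g \<in> carrier (free_group r)"
  shows "lead_part 1 g = (\<Sum>i<r. scale (coef (lead_part 1 g) [i]) (letter_series i))"
proof -
  have coef: "coef (\<Sum>i<r. scale (a i) (letter_series i)) [m] = (if m < r then a m else 0)" for a :: "nat \<Rightarrow> int" and m
    by (simp add: coef_letter_series if_distrib[of "\<lambda>x. _ * x"] cong: if_cong)
  let ?L = "{f. \<exists>a. f = (\<Sum>i<r. scale (a i) (letter_series i :: int ncs))}"
  have "g \<in> generate (free_group r) ((\<lambda>i. [(i, True)]) ` {..<r})" using assms unfolding free_group_generate .
  then have "dim_ge 1 g \<and> lead_part 1 g \<in> ?L"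
  proof (rule dim_ge_generate[where r = r, rotated -1])
    fix a assume "a \<in> (\<lambda>i. [(i, True)]) ` {..<r}"
    then obtain j where j: "j < r" "a = [(j, True)]" by auto
    have "(\<Sum>i<r. scale (if i = j then 1 else 0) (letter_series i)) = (\<Sum>i<r. if i = j then letter_series i else 0 :: int ncs)"
      by (rule sum.cong) auto
    then have "lead_part 1 a = (\<Sum>i<r. scale (if i = j then 1 else 0) (letter_series i))"
      using j by (simp add: lead_part_generator[of 1, simplified])
    then show "dim_ge 1 a \<and> lead_part 1 a \<in> ?L" by (intro conjI dim_ge_1 CollectI exI)
  next
    show "0 \<in> ?L" by (auto intro!: exI[of _ "\<lambda>_. 0"])
    fix f assume f: "f \<in> ?L"
    then obtain a where a: "f = (\<Sum>i<r. scale (a i) (letter_series i))" by blast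
    have "- f = (\<Sum>i<r. scale (- a i) (letter_series i))" by (rule ncs_eqI) (simp add: a sum_negf)
    then show "- f \<in> ?L" by (auto intro!: exI[of _ "\<lambda>i. - a i"])
    fix g assume "g \<in> ?L"
    then obtain b where "g = (\<Sum>i<r. scale (b i) (letter_series i))" by blast
    then have "f + g = (\<Sum>i<r. scale (a i + b i) (letter_series i))" by (simp add: a scale_add_left sum.distrib)
    then show "f + g \<in> ?L" by (auto intro!: exI[of _ "\<lambda>i. a i + b i"])
  qed auto
  then obtain a where a: "lead_part 1 g = (\<Sum>i<r. scale (a i) (letter_series i))" by blast
  show ?thesis unfolding a coef by (rule sum.cong) auto
qed

text \<open>Magnus' theorem in the form needed by the filtration: leading forms embed
  \<open>\<gamma>_k\<close> modulo \<open>\<gamma>_{k+1}\<close> into the integer series, so the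
  layers are torsion free.\<close>

lemma lead_part_eq_0_iff:
  assumes "1 \<le> k" "g \<in> lower_central (free_group r) k"
  shows "lead_part k g = 0 \<longleftrightarrow> g \<in> lower_central (free_group r) (Suc k)"
proof -
  interpret group "free_group r" by (rule free_group_is_group)
  have "dim_ge k g" by (rule lower_central_dim_ge[OF assms])
  moreover have "g \<in> carrier (free_group r)" by (rule lower_central_carrier[OF assms(2)])
  ultimately show ?thesis
    using dim_ge_lower_central[OF assms(1), of g r] lower_central_dim_ge[of "Suc k" g r] dim_ge_Suc_iff by auto
qed

section \<open>The layers of the lower central series as lattices\<close>

context hall_basis
begin

definition lie_comb :: "nat \<Rightarrow> int vec \<Rightarrow> int ncs" where
  "lie_comb k x = (\<Sum>i<length (basis k). scale (x $ i) (lie_poly (basis k ! i)))"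

text \<open>One inclusion holds because leading forms are Lie elements, the other because products
  of powers of the basis commutators realize every integer combination.\<close>

lemma lead_part_image:
  assumes k: "1 \<le> k" "k \<le> c"
  shows "lead_part k ` lower_central (free_group r) k = lie_comb k ` carrier_vec (length (basis k))"
proof
  let ?n = "length (basis k)"
  interpret group "free_group r" by (rule free_group_is_group)
  show "lead_part k ` lower_central (free_group r) k \<subseteq> lie_comb k ` carrier_vec ?n"
  proof clarify
    fix g assume "g \<in> lower_central (free_group r) k"
    then have "lead_part k g \<in> lie_closure c (Leaf ` {..<r})" by (rule lead_part_closure[OF k(1)])
    from basis_span[OF this k(2)] obtain a
      where "hom_part k (lead_part k g) = (\<Sum>i<?n. scale (a i) (lie_poly (basis k ! i)))" by blast
    then have "lead_part k g = lie_comb k (vec ?n a)"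
      by (simp add: lie_comb_def lead_part_def hom_part_hom_part)
    then show "lead_part k g \<in> lie_comb k ` carrier_vec ?n" by auto
  qed
  have "\<exists>g\<in>lower_central (free_group r) k. lead_part k g = (\<Sum>i<m. scale (x $ i) (lie_poly (basis k ! i)))"
    if "m \<le> ?n" for m and x :: "int vec"
    using that
  proof (induction m)
    case 0
    then show ?case using subgroup.one_closed[OF lower_central_subgroup] by (auto intro!: bexI[of _ "[]"])
  next
    case (Suc m)
    then obtain g where g: "g \<in> lower_central (free_group r) k" "lead_part k g = (\<Sum>i<m. scale (x $ i) (lie_poly (basis k ! i)))" by auto
    define h where "h = free_comm r (basis k ! m)"
    have len: "length (foliage (basis k ! m)) = k" and let_m: "set (foliage (basis k ! m)) \<subseteq> {..<r}"
      using basis_nth(1,2)[of m k] Suc.prems by auto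
    have h: "h \<in> lower_central (free_group r) k" "dim_ge k h" "lead_part k h = lie_poly (basis k ! m)"
      using tree_comm_lower_central[of "free_gen r" "basis k ! m"] free_gen_carrier free_comm_lead_part[OF let_m]
      unfolding len h_def by auto
    have hc: "h \<in> carrier (free_group r)" by (rule lower_central_carrier[OF h(1)])
    define w where "w = g \<otimes>\<^bsub>free_group r\<^esub> (h [^]\<^bsub>free_group r\<^esub> (x $ m))"
    have "w \<in> lower_central (free_group r) k"
      unfolding w_def
      by (rule subgroup.m_closed[OF lower_central_subgroup g(1) subgroup_int_pow_closed[OF lower_central_subgroup h(1)]])
    moreover have "lead_part k w = (\<Sum>i<Suc m. scale (x $ i) (lie_poly (basis k ! i)))"
      using dim_ge_int_pow[OF k(1) h(2) hc, of "x $ m"] dim_ge_mult(2)[OF k(1) lower_central_dim_ge[OF k(1) g(1)]]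
      by (simp add: w_def g(2) h(3))
    ultimately show ?case by blast
  qed
  from this[OF order_refl] show "lie_comb k ` carrier_vec ?n \<subseteq> lead_part k ` lower_central (free_group r) k"
    unfolding lie_comb_def by (metis (no_types, lifting) image_iff image_subsetI)
qed

lemma lie_comb_diff:
  "x \<in> carrier_vec (length (basis k)) \<Longrightarrow> y \<in> carrier_vec (length (basis k)) \<Longrightarrow>
    lie_comb k (x - y) = lie_comb k x - lie_comb k y"
  unfolding lie_comb_def sum_subtractf[symmetric]
  by (rule sum.cong) (auto simp: scale_diff_left)

lemma lie_comb_eq_0:
  assumes "x \<in> carrier_vec (length (basis k))" "lie_comb k x = 0"
  shows "x = 0\<^sub>v (length (basis k))"
  by (rule eq_vecI) (use basis_independent[OF subset_refl assms(2)[unfolded lie_comb_def]] assms(1) in auto)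

lemma lie_comb_inj: "inj_on (lie_comb k) (carrier_vec (length (basis k)))"
proof (rule inj_onI)
  fix x y assume *: "x \<in> carrier_vec (length (basis k))" "y \<in> carrier_vec (length (basis k))" "lie_comb k x = lie_comb k y"
  then have "x - y = 0\<^sub>v (length (basis k))" by (intro lie_comb_eq_0) (auto simp: lie_comb_diff)
  then have zero: "(x - y) $ i = 0" if "i < length (basis k)" for i using that by simp
  show "x = y"
  proof (rule eq_vecI)
    fix i assume "i < dim_vec y"
    then show "x $ i = y $ i" using zero[of i] * by simp
  qed (use * in simp)
qed

end

text \<open>\<open>p\<close> need not be injective, since points with equal image are automatically
  related by \<open>R\<close>. Both coordinates on a layer and the passage to cosets are of this
  kind.\<close>

lemma quotient_bij_betw:
  assumes R: "equiv A R" and S: "S \<subseteq> B \<times> B" and p: "p ` A = B"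
    and iff: "\<And>x y. x \<in> A \<Longrightarrow> y \<in> A \<Longrightarrow> (x, y) \<in> R \<longleftrightarrow> (p x, p y) \<in> S"
  shows "bij_betw ((`) p) (A // R) (B // S)"
proof -
  have RA: "R \<subseteq> A \<times> A" using R by (auto simp: equiv_def)
  have img: "p ` (R `` {x}) = S `` {p x}" if "x \<in> A" for x
    using that RA S p iff by (auto simp: image_iff) blast+
  show ?thesis
    unfolding bij_betw_def
  proof
    show "inj_on ((`) p) (A // R)"
    proof (rule inj_onI)
      fix C D assume "C \<in> A // R" "D \<in> A // R" and eq: "p ` C = p ` D"
      then obtain x y where xy: "x \<in> A" "y \<in> A" "C = R `` {x}" "D = R `` {y}" by (auto elim!: quotientE)
      have "(y, y) \<in> R" using R xy(2) by (auto simp: equiv_def refl_on_def)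
      then have "p y \<in> S `` {p y}" using iff xy by auto
      then have "(p x, p y) \<in> S" using eq xy img by auto
      then have "(x, y) \<in> R" using iff xy by blast
      then show "C = D" using equiv_class_eq[OF R] xy by auto
    qed
    show "(`) p ` (A // R) = B // S"
      using img p by (auto simp: quotient_def image_iff)
  qed
qed

section \<open>The action of an endomorphism on the layers\<close>

locale free_group_endo = hall_basis +
  fixes \<phi> :: "letter list \<Rightarrow> letter list"
  assumes \<phi>: "\<phi> \<in> hom (free_group r) (free_group r)"
begin

sublocale F: group "free_group r" by (rule free_group_is_group)

sublocale \<phi>: group_hom "free_group r" "free_group r" \<phi>
  using \<phi> by (simp add: group_hom_def group_hom_axioms_def F.group_axioms)

text \<open>The matrix of \<open>\<phi>\<close> on the abelianization with respect to the free
  generators: column \<open>j\<close> holds the exponent sums in the image of generator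
  \<open>j\<close>.\<close>

definition ab_mat :: "int mat" where
  "ab_mat = mat r r (\<lambda>(i, j). coef (lead_part 1 (\<phi> [(j, True)])) [i])"

lemma ab_mat_carrier [simp]: "ab_mat \<in> carrier_mat r r"
  by (simp add: ab_mat_def)

text \<open>Both sides are additive on \<open>\<gamma>_k\<close>, so generators decide.\<close>

lemma lead_part_generate_act:
  assumes "1 \<le> k" "A \<subseteq> lower_central (free_group r) k"
    and eq: "\<And>a. a \<in> A \<Longrightarrow> lead_part k (\<phi> a) = act ab_mat (lead_part k a)"
    and g: "g \<in> generate (free_group r) A"
  shows "lead_part k (\<phi> g) = act ab_mat (lead_part k g)"
proof -
  have A: "a \<in> carrier (free_group r)" if "a \<in> lower_central (free_group r) k" for a by (rule F.lower_central_carrier[OF that])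
  have dim: "dim_ge k a" "dim_ge k (\<phi> a)" if "a \<in> lower_central (free_group r) k" for a
    using lower_central_dim_ge[OF assms(1)] \<phi>.hom_lower_central that by blast+
  have "g \<in> lower_central (free_group r) k \<and> lead_part k (\<phi> g) = act ab_mat (lead_part k g)"
    using g
  proof (induction g rule: generate.induct)
    case one
    then show ?case using subgroup.one_closed[OF F.lower_central_subgroup] \<phi>.hom_one by simp
  next
    case (inv a)
    then have a: "a \<in> lower_central (free_group r) k" using assms(2) by blast
    have "lead_part k (\<phi> (inv\<^bsub>free_group r\<^esub> a)) = - lead_part k (\<phi> a)"
      unfolding \<phi>.hom_inv[OF A[OF a]] by (rule dim_ge_inv(2)[OF assms(1) dim(2)[OF a] \<phi>.hom_closed[OF A[OF a]]])
    also have "\<dots> = act ab_mat (- lead_part k a)"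
      using eq[OF inv] act_diff[of ab_mat 0 "lead_part k a"] by simp
    also have "- lead_part k a = lead_part k (inv\<^bsub>free_group r\<^esub> a)"
      by (rule dim_ge_inv(2)[OF assms(1) dim(1)[OF a] A[OF a], symmetric])
    finally show ?case using subgroup.m_inv_closed[OF F.lower_central_subgroup a] by blast
  next
    case (eng a b)
    then have ab: "a \<in> lower_central (free_group r) k" "b \<in> lower_central (free_group r) k" by auto
    have "lead_part k (\<phi> (a \<otimes>\<^bsub>free_group r\<^esub> b)) = lead_part k (\<phi> a) + lead_part k (\<phi> b)"
      unfolding \<phi>.hom_mult[OF A[OF ab(1)] A[OF ab(2)]]
      using dim_ge_mult(2)[OF assms(1) dim(2)[OF ab(1)] dim(2)[OF ab(2)]] by simp
    also have "\<dots> = act ab_mat (lead_part k (a \<otimes>\<^bsub>free_group r\<^esub> b))"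
      using eng dim_ge_mult(2)[OF assms(1) dim(1)[OF ab(1)] dim(1)[OF ab(2)]] by (simp add: act_add)
    finally show ?case using subgroup.m_closed[OF F.lower_central_subgroup ab] by blast
  qed (use assms(2) eq in blast)
  then show ?thesis by blast
qed

lemma lead_part_endo_1:
  assumes "g \<in> carrier (free_group r)"
  shows "lead_part 1 (\<phi> g) = act ab_mat (lead_part 1 g)"
proof (rule lead_part_generate_act)
  show "g \<in> generate (free_group r) ((\<lambda>i. [(i, True)]) ` {..<r})" using assms unfolding free_group_generate .
  fix a assume "a \<in> (\<lambda>i. [(i, True)]) ` {..<r}"
  then obtain j where j: "j < r" "a = [(j, True)]" by auto
  have "\<phi> [(j, True)] \<in> carrier (free_group r)" by (rule \<phi>.hom_closed[OF generator_carrier[OF j(1)]])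
  from lead_part_1_expand[OF this] show "lead_part 1 (\<phi> a) = act ab_mat (lead_part 1 a)"
    unfolding j(2) lead_part_generator using act_letter_series[OF ab_mat_carrier j(1)] j(1) by (simp add: ab_mat_def)
qed (auto simp: reduced_Cons)

text \<open>The linear part determines the induced map on every layer, because
  \<open>act ab_mat\<close> is a ring homomorphism and leading forms of commutators are
  brackets.\<close>

lemma lead_part_endo:
  assumes "1 \<le> k" "g \<in> lower_central (free_group r) k"
  shows "lead_part k (\<phi> g) = act ab_mat (lead_part k g)"
  using assms
proof (induction k arbitrary: g rule: nat_induct_at_least)
  case base
  then show ?case using lead_part_endo_1 by simp
next
  case (Suc k)
  obtain m where m: "k = Suc m" using \<open>1 \<le> k\<close> by (cases k) auto
  show ?case
  proof (rule lead_part_generate_act[OF _ _ _ Suc.prems[unfolded m lower_central_Suc_Suc, folded m]])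
    show "{commutator (free_group r) h x |h x. h \<in> lower_central (free_group r) k \<and> x \<in> carrier (free_group r)}
        \<subseteq> lower_central (free_group r) (Suc k)"
      using F.commutator_lower_central_carrier[OF Suc.hyps] by blast
    fix a assume "a \<in> {commutator (free_group r) h x |h x. h \<in> lower_central (free_group r) k \<and> x \<in> carrier (free_group r)}"
    then obtain h x where *: "a = commutator (free_group r) h x" "h \<in> lower_central (free_group r) k" "x \<in> carrier (free_group r)" by blast
    have h: "h \<in> carrier (free_group r)" by (rule F.lower_central_carrier[OF *(2)])
    note comm = dim_ge_commutator(2)[OF _ dim_ge_1, unfolded Suc_eq_plus1[symmetric]]
    have "lead_part (Suc k) (\<phi> a) = lead_part k (\<phi> h) * lead_part 1 (\<phi> x) - lead_part 1 (\<phi> x) * lead_part k (\<phi> h)"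
      unfolding *(1) \<phi>.hom_commutator[OF h *(3)]
      by (rule comm[OF lower_central_dim_ge[OF Suc.hyps \<phi>.hom_lower_central[OF *(2)]] \<phi>.hom_closed[OF h] \<phi>.hom_closed[OF *(3)]])
    also have "\<dots> = act ab_mat (lead_part k h * lead_part 1 x - lead_part 1 x * lead_part k h)"
      using Suc.IH[OF *(2)] lead_part_endo_1[OF *(3)] by (simp add: act_diff act_times)
    also have "lead_part k h * lead_part 1 x - lead_part 1 x * lead_part k h = lead_part (Suc k) a"
      unfolding *(1) by (rule comm[OF lower_central_dim_ge[OF Suc.hyps *(2)] h *(3), symmetric])
    finally show "lead_part (Suc k) (\<phi> a) = act ab_mat (lead_part (Suc k) a)" .
  qed simp
qed

text \<open>The index is shifted by one, as the filtration starts at \<open>N 0\<close> and the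
  lower central series at \<open>\<gamma>_1\<close>. The action on all layers is the same
  substitution, restricted to different degrees.\<close>

sublocale filt: central_filtration "free_group r" \<phi> "\<lambda>k. lower_central (free_group r) (Suc k)" c
  "\<lambda>k. lead_part (Suc k)" "\<lambda>k. act ab_mat"
proof (intro central_filtration.intro central_filtration_axioms.intro)
  show "group (free_group r)" by (rule free_group_is_group)
  show "\<phi> \<in> hom (free_group r) (free_group r)" by (rule \<phi>)
  show "lower_central (free_group r) (Suc 0) = carrier (free_group r)" by simp
  show "subgroup (lower_central (free_group r) (Suc k)) (free_group r)" for k by (rule F.lower_central_subgroup)
  show "lower_central (free_group r) (Suc (Suc k)) = {x \<in> lower_central (free_group r) (Suc k). lead_part (Suc k) x = 0}" for k
    using lead_part_eq_0_iff[of "Suc k" _ r] F.lower_central_Suc_subset[of "Suc k"] by auto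
  show "lead_part (Suc k) (x \<otimes>\<^bsub>free_group r\<^esub> y) = lead_part (Suc k) x + lead_part (Suc k) y"
    if "x \<in> lower_central (free_group r) (Suc k)" "y \<in> lower_central (free_group r) (Suc k)" for k x y
    using dim_ge_mult(2)[of "Suc k" x y] lower_central_dim_ge[of "Suc k" _ r] that by simp
  show "y \<otimes>\<^bsub>free_group r\<^esub> x \<otimes>\<^bsub>free_group r\<^esub> inv\<^bsub>free_group r\<^esub> y \<in> lower_central (free_group r) (Suc k)"
    if "x \<in> lower_central (free_group r) (Suc k)" "y \<in> carrier (free_group r)" for k x y
    by (rule normal.inv_op_closed2[OF F.lower_central_normal that(2,1)])
  show "lead_part (Suc k) (y \<otimes>\<^bsub>free_group r\<^esub> x \<otimes>\<^bsub>free_group r\<^esub> inv\<^bsub>free_group r\<^esub> y) = lead_part (Suc k) x"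
    if x: "x \<in> lower_central (free_group r) (Suc k)" and y: "y \<in> carrier (free_group r)" for k x y
  proof -
    have xc: "x \<in> carrier (free_group r)" by (rule F.lower_central_carrier[OF x])
    have dim: "dim_ge (Suc k) x" using lower_central_dim_ge[OF _ x] by simp
    \<comment> \<open>Conjugation by \<open>y\<close> multiplies \<open>x\<close> by
      \<open>[y, x]\<close>, whose order is larger by one.\<close>
    have d: "dim_ge (Suc (Suc k)) (commutator (free_group r) y x)"
      using dim_ge_commutator(1)[OF dim_ge_1 dim y xc] by simp
    have "y \<otimes>\<^bsub>free_group r\<^esub> x \<otimes>\<^bsub>free_group r\<^esub> inv\<^bsub>free_group r\<^esub> y = commutator (free_group r) y x \<otimes>\<^bsub>free_group r\<^esub> x"
      using xc y by (simp add: commutator_def F.group_simps del: free_group_simps)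
    then show ?thesis
      using dim_ge_mult(2)[OF _ dim_ge_mono[OF d] dim] lead_part_eq_0[OF d, of "Suc k"] by simp
  qed
  show "\<phi> x \<in> lower_central (free_group r) (Suc k)" if "x \<in> lower_central (free_group r) (Suc k)" for k x
    by (rule \<phi>.hom_lower_central[OF that])
  show "lead_part (Suc k) (\<phi> x) = act ab_mat (lead_part (Suc k) x)" if "x \<in> lower_central (free_group r) (Suc k)" for k x
    using lead_part_endo[OF _ that] by simp
qed

lemma layer_eq: "k < c \<Longrightarrow> filt.layer k = lie_comb (Suc k) ` carrier_vec (length (basis (Suc k)))"
  unfolding filt.layer_def by (rule lead_part_image) auto

lemma lie_comb_act:
  assumes "k < c" "x \<in> carrier_vec (length (basis (Suc k)))"
  shows "lie_comb (Suc k) x - act ab_mat (lie_comb (Suc k) x) =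
    lie_comb (Suc k) ((1\<^sub>m (length (basis (Suc k))) - lie_mat (Suc k) ab_mat) *\<^sub>v x)"
proof -
  let ?n = "length (basis (Suc k))" and ?L = "lie_mat (Suc k) ab_mat"
  have "act ab_mat (lie_comb (Suc k) x) = lie_comb (Suc k) (?L *\<^sub>v x)"
    unfolding lie_comb_def by (rule act_lie_comb) (use assms in auto)
  moreover have "(1\<^sub>m ?n - ?L) *\<^sub>v x = x - ?L *\<^sub>v x"
    using minus_mult_distrib_mat_vec[OF one_carrier_mat lie_mat_carrier[of "Suc k" ab_mat] assms(2)] assms(2) by simp
  moreover have "?L *\<^sub>v x \<in> carrier_vec ?n" by (rule mult_mat_vec_carrier[OF lie_mat_carrier assms(2)])
  ultimately show ?thesis using lie_comb_diff[OF assms(2)] by simp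
qed

text \<open>In the coordinates given by \<open>lie_comb\<close> the relation on the layer becomes
  congruence modulo the image of an integer matrix.\<close>

lemma card_inf_layer:
  assumes k: "k < c"
  shows "card_inf (filt.layer k // filt.layer_rel k) =
    abs_inf (det (1\<^sub>m (length (basis (Suc k))) - lie_mat (Suc k) ab_mat))"
proof -
  let ?n = "length (basis (Suc k))" and ?L = "lie_mat (Suc k) ab_mat"
  let ?B = "1\<^sub>m ?n - ?L"
  have B: "?B \<in> carrier_mat ?n ?n" by (auto intro!: minus_carrier_mat)
  let ?p = "the_inv_into (carrier_vec ?n) (lie_comb (Suc k))"
  have p: "?p (lie_comb (Suc k) x) = x" if "x \<in> carrier_vec ?n" for x
    using lie_comb_inj that by (rule the_inv_into_f_f)
  have "bij_betw ((`) ?p) (filt.layer k // filt.layer_rel k) (carrier_vec ?n // mat_coset_rel ?n ?B)"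
  proof (rule quotient_bij_betw[OF filt.layer_equiv[OF k]])
    show "mat_coset_rel ?n ?B \<subseteq> carrier_vec ?n \<times> carrier_vec ?n" by (auto simp: mat_coset_rel_def)
    show "?p ` filt.layer k = carrier_vec ?n"
      unfolding layer_eq[OF k] by (auto simp: image_image p)
    fix u v assume "u \<in> filt.layer k" "v \<in> filt.layer k"
    then obtain x y where xy: "x \<in> carrier_vec ?n" "y \<in> carrier_vec ?n" "u = lie_comb (Suc k) x" "v = lie_comb (Suc k) y"
      unfolding layer_eq[OF k] by blast
    have "(u, v) \<in> filt.layer_rel k \<longleftrightarrow>
      (\<exists>z\<in>carrier_vec ?n. lie_comb (Suc k) x - lie_comb (Suc k) y = lie_comb (Suc k) z - act ab_mat (lie_comb (Suc k) z))"
      using xy by (auto simp: coset_rel_def layer_eq[OF k])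
    also have "\<dots> \<longleftrightarrow> (\<exists>z\<in>carrier_vec ?n. x = y + ?B *\<^sub>v z)"
    proof (rule bex_cong[OF refl])
      fix z :: "int vec" assume z: "z \<in> carrier_vec ?n"
      have Bz: "?B *\<^sub>v z \<in> carrier_vec ?n" by (rule mult_mat_vec_carrier[OF B z])
      have "lie_comb (Suc k) x - lie_comb (Suc k) y = lie_comb (Suc k) z - act ab_mat (lie_comb (Suc k) z) \<longleftrightarrow>
          lie_comb (Suc k) (x - y) = lie_comb (Suc k) (?B *\<^sub>v z)"
        unfolding lie_comb_act[OF k z] lie_comb_diff[OF xy(1,2)] ..
      also have "\<dots> \<longleftrightarrow> x - y = ?B *\<^sub>v z"
        using lie_comb_inj Bz xy by (intro inj_on_eq_iff) auto
      also have "\<dots> \<longleftrightarrow> x = y + ?B *\<^sub>v z"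
      proof
        assume "x - y = ?B *\<^sub>v z"
        moreover have "x = y + (x - y)" using xy by auto
        ultimately show "x = y + ?B *\<^sub>v z" by simp
      next
        assume "x = y + ?B *\<^sub>v z"
        then show "x - y = ?B *\<^sub>v z" using xy Bz by (intro eq_vecI) auto
      qed
      finally show "lie_comb (Suc k) x - lie_comb (Suc k) y = lie_comb (Suc k) z - act ab_mat (lie_comb (Suc k) z) \<longleftrightarrow>
          x = y + ?B *\<^sub>v z" .
    qed
    also have "\<dots> \<longleftrightarrow> (?p u, ?p v) \<in> mat_coset_rel ?n ?B"
      using xy by (simp add: mat_coset_rel_def p)
    finally show "(u, v) \<in> filt.layer_rel k \<longleftrightarrow> (?p u, ?p v) \<in> mat_coset_rel ?n ?B" .
  qed
  from card_inf_bij_betw[OF this] show ?thesis unfolding card_inf_mat_coset[OF B] .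
qed

lemma layer_separated:
  assumes k: "k < c" and fin: "card_inf (filt.layer k // filt.layer_rel k) \<noteq> \<infinity>"
  shows "filt.separated k"
proof -
  let ?n = "length (basis (Suc k))"
  let ?B = "1\<^sub>m ?n - lie_mat (Suc k) ab_mat"
  have B: "?B \<in> carrier_mat ?n ?n" by (auto intro!: minus_carrier_mat)
  have det: "det ?B \<noteq> 0" using fin unfolding card_inf_layer[OF k] by (auto simp: abs_inf_def)
  show ?thesis
    unfolding filt.separated_def
  proof (intro ballI impI)
    fix u assume u: "u \<in> filt.layer k" "u = act ab_mat u"
    then obtain x where x: "x \<in> carrier_vec ?n" "u = lie_comb (Suc k) x" unfolding layer_eq[OF k] by blast
    have Bx: "?B *\<^sub>v x \<in> carrier_vec ?n" by (rule mult_mat_vec_carrier[OF B x(1)])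
    have "lie_comb (Suc k) (?B *\<^sub>v x) = 0"
      using lie_comb_act[OF k x(1)] u(2) unfolding x(2) by simp
    then have "?B *\<^sub>v x = 0\<^sub>v ?n" by (rule lie_comb_eq_0[OF Bx])
    \<comment> \<open>The adjugate turns the nonzero determinant into injectivity over the
      integers.\<close>
    then have "adj_mat ?B *\<^sub>v (?B *\<^sub>v x) = 0\<^sub>v ?n"
      using adj_mat(1)[OF B] by (intro eq_vecI) auto
    moreover have "adj_mat ?B *\<^sub>v (?B *\<^sub>v x) = det ?B \<cdot>\<^sub>v x"
    proof -
      have "(det ?B \<cdot>\<^sub>m 1\<^sub>m ?n) *\<^sub>v x = det ?B \<cdot>\<^sub>v x" using x(1) by auto
      then show ?thesis
        using assoc_mult_mat_vec[OF adj_mat(1)[OF B] B x(1)] unfolding adj_mat(3)[OF B] by simp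
    qed
    ultimately have "det ?B \<cdot>\<^sub>v x = 0\<^sub>v ?n" by simp
    then have "(det ?B \<cdot>\<^sub>v x) $ i = 0" if "i < ?n" for i using that by simp
    then have "x = 0\<^sub>v ?n" using det x(1) by (intro eq_vecI) auto
    then show "u = 0" unfolding x(2) lie_comb_def by simp
  qed
qed

lemma card_inf_twisted_free:
  "card_inf (carrier (free_group r) // filt.twisted c) =
    abs_inf (\<Prod>k=1..c. det (1\<^sub>m (length (basis k)) - lie_mat k ab_mat))"
proof -
  have "card_inf (carrier (free_group r) // filt.twisted c) = (\<Prod>k<c. card_inf (filt.layer k // filt.layer_rel k))"
    by (rule filt.card_inf_twisted) (rule layer_separated)
  also have "\<dots> = (\<Prod>k<c. abs_inf (det (1\<^sub>m (length (basis (Suc k))) - lie_mat (Suc k) ab_mat)))"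
    by (rule prod.cong) (auto simp: card_inf_layer)
  also have "\<dots> = (\<Prod>k=1..c. abs_inf (det (1\<^sub>m (length (basis k)) - lie_mat k ab_mat)))"
    by (rule prod.reindex_bij_witness[of _ "\<lambda>k. k - 1" Suc]) auto
  finally show ?thesis by (simp add: abs_inf_prod)
qed

end

section \<open>Passing to the free nilpotent group\<close>

lemma (in group) r_coset_group_hom:
  assumes "K \<lhd> G"
  shows "group_hom G (G Mod K) ((#>) K)"
  using normal.r_coset_hom_Mod[OF assms] normal.factorgroup_is_group[OF assms] group_axioms
  by (simp add: group_hom_def group_hom_axioms_def)

lemma (in group) mult_inv_eq_one_iff:
  assumes "x \<in> carrier G" "y \<in> carrier G"
  shows "x \<otimes> inv y = \<one> \<longleftrightarrow> x = y"
proof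
  assume "x \<otimes> inv y = \<one>"
  then have "x \<otimes> inv y \<otimes> y = y" using assms by simp
  then show "x = y" using assms by (simp add: m_assoc)
qed (use assms in simp)

lemma (in group) r_coset_eq_iff:
  assumes K: "K \<lhd> G" and "x \<in> carrier G" "y \<in> carrier G"
  shows "K #> x = K #> y \<longleftrightarrow> x \<otimes> inv y \<in> K"
proof -
  interpret p: group_hom G "G Mod K" "(#>) K" by (rule r_coset_group_hom[OF K])
  have "x \<otimes> inv y \<in> K \<longleftrightarrow> (K #> x) \<otimes>\<^bsub>G Mod K\<^esub> inv\<^bsub>G Mod K\<^esub> (K #> y) = \<one>\<^bsub>G Mod K\<^esub>"
    using r_coset_eq_one_iff[OF K, of "x \<otimes> inv y"] p.hom_mult[of x "inv y"] p.hom_inv[of y] assms by simp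
  also have "\<dots> \<longleftrightarrow> K #> x = K #> y"
    by (rule p.H.mult_inv_eq_one_iff) (use p.hom_closed assms in blast)+
  finally show ?thesis by blast
qed

text \<open>By normality, elements of \<open>K\<close> can be moved from one side of
  \<open>z y \<phi>(z)^-1\<close> to the other, so the relation on \<open>G\<close> is exactly the
  preimage of twisted conjugacy of cosets.\<close>

lemma (in group) reidemeister_number_quotient:
  assumes K: "K \<lhd> G" and \<phi>: "\<phi> \<in> hom G G"
    and \<Phi>: "\<And>x. x \<in> carrier G \<Longrightarrow> \<Phi> (K #> x) = K #> \<phi> x"
    and R: "R = {(x, y). x \<in> carrier G \<and> y \<in> carrier G \<and> (\<exists>z\<in>carrier G. \<exists>n\<in>K. x = z \<otimes> y \<otimes> inv (\<phi> z) \<otimes> n)}"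
    and eqv: "equiv (carrier G) R"
  shows "reidemeister_number (G Mod K) \<Phi> = card_inf (carrier G // R)"
proof -
  interpret p: group_hom G "G Mod K" "(#>) K" by (rule r_coset_group_hom[OF K])
  have \<phi>c: "\<phi> x \<in> carrier G" if "x \<in> carrier G" for x using \<phi> that by (auto simp: hom_def)
  have Kc: "n \<in> carrier G" if "n \<in> K" for n using K that normal_imp_subgroup subgroup.mem_carrier by metis
  have img: "(#>) K ` carrier G = carrier (G Mod K)" by (auto simp: FactGroup_def RCOSETS_def)
  have "bij_betw ((`) ((#>) K)) (carrier G // R) (carrier (G Mod K) // twisted_conj (G Mod K) \<Phi>)"
  proof (rule quotient_bij_betw[OF eqv _ img])
    show "twisted_conj (G Mod K) \<Phi> \<subseteq> carrier (G Mod K) \<times> carrier (G Mod K)"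
      by (auto simp: twisted_conj_def)
    fix x y assume xy: "x \<in> carrier G" "y \<in> carrier G"
    have hom: "(K #> z) \<otimes>\<^bsub>G Mod K\<^esub> (K #> y) \<otimes>\<^bsub>G Mod K\<^esub> inv\<^bsub>G Mod K\<^esub> (\<Phi> (K #> z)) = K #> (z \<otimes> y \<otimes> inv (\<phi> z))"
      if "z \<in> carrier G" for z
      using that xy \<phi>c[OF that] p.hom_mult[of "z \<otimes> y" "inv (\<phi> z)"] p.hom_mult[of z y] p.hom_inv[of "\<phi> z"]
      by (simp add: \<Phi>)
    have "(x, y) \<in> R \<longleftrightarrow> (\<exists>z\<in>carrier G. K #> x = K #> (z \<otimes> y \<otimes> inv (\<phi> z)))"
    proof
      assume "(x, y) \<in> R"
      then obtain z n where z: "z \<in> carrier G" "n \<in> K" "x = z \<otimes> y \<otimes> inv (\<phi> z) \<otimes> n" using R by blast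
      let ?w = "z \<otimes> y \<otimes> inv (\<phi> z)"
      have w: "?w \<in> carrier G" using z xy \<phi>c by simp
      have "x \<otimes> inv ?w = ?w \<otimes> n \<otimes> inv ?w" unfolding z(3) ..
      also have "\<dots> \<in> K" by (rule normal.inv_op_closed2[OF K w z(2)])
      finally show "\<exists>z\<in>carrier G. K #> x = K #> (z \<otimes> y \<otimes> inv (\<phi> z))"
        using r_coset_eq_iff[OF K xy(1) w] z(1) by blast
    next
      assume "\<exists>z\<in>carrier G. K #> x = K #> (z \<otimes> y \<otimes> inv (\<phi> z))"
      then obtain z where z: "z \<in> carrier G" "K #> x = K #> (z \<otimes> y \<otimes> inv (\<phi> z))" by blast
      let ?w = "z \<otimes> y \<otimes> inv (\<phi> z)"
      have w: "?w \<in> carrier G" using z xy \<phi>c by simp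
      have "inv ?w \<otimes> (x \<otimes> inv ?w) \<otimes> ?w \<in> K"
        using r_coset_eq_iff[OF K xy(1) w] z(2) by (intro normal.inv_op_closed1[OF K w]) simp
      moreover have "x = ?w \<otimes> (inv ?w \<otimes> (x \<otimes> inv ?w) \<otimes> ?w)" using xy z(1) \<phi>c[OF z(1)] by (simp add: group_simps)
      ultimately show "(x, y) \<in> R" using R xy z(1) by blast
    qed
    also have "\<dots> \<longleftrightarrow> (K #> x, K #> y) \<in> twisted_conj (G Mod K) \<Phi>"
      unfolding twisted_conj_def using xy hom img[symmetric] by auto
    finally show "(x, y) \<in> R \<longleftrightarrow> (K #> x, K #> y) \<in> twisted_conj (G Mod K) \<Phi>" .
  qed
  then show ?thesis using card_inf_bij_betw by (fastforce simp: reidemeister_number_def card_inf_def Let_def)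
qed

text \<open>Freeness enters here: representatives are chosen for the images of the generators, and
  the endomorphism that they define agrees with \<open>\<Phi>\<close> on generators, hence
  everywhere.\<close>

lemma free_group_lift:
  assumes K: "K \<lhd> free_group r" and \<Phi>: "\<Phi> \<in> hom (free_group r Mod K) (free_group r Mod K)"
  shows "\<exists>\<phi>\<in>hom (free_group r) (free_group r). \<forall>x\<in>carrier (free_group r).
    \<Phi> (K #>\<^bsub>free_group r\<^esub> x) = K #>\<^bsub>free_group r\<^esub> \<phi> x"
proof -
  let ?F = "free_group r"
  interpret F: group ?F by (rule free_group_is_group)
  interpret p: group_hom ?F "?F Mod K" "(#>\<^bsub>?F\<^esub>) K" by (rule F.r_coset_group_hom[OF K])
  have "\<exists>g. g \<in> carrier ?F \<and> \<Phi> (K #>\<^bsub>?F\<^esub> [(i, True)]) = K #>\<^bsub>?F\<^esub> g" if "i < r" for i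
  proof -
    have "\<Phi> (K #>\<^bsub>?F\<^esub> [(i, True)]) \<in> carrier (?F Mod K)"
      using \<Phi> p.hom_closed[OF generator_carrier[OF that]] unfolding hom_def by blast
    then show ?thesis unfolding FactGroup_def RCOSETS_def by auto
  qed
  then obtain g where g: "\<And>i. i < r \<Longrightarrow> g i \<in> carrier ?F \<and> \<Phi> (K #>\<^bsub>?F\<^esub> [(i, True)]) = K #>\<^bsub>?F\<^esub> g i" by metis
  define \<phi> where "\<phi> = word_eval ?F g"
  have \<phi>: "\<phi> \<in> hom ?F ?F" unfolding \<phi>_def by (rule word_eval_hom[OF F.group_axioms]) (use g in blast)
  have "\<Phi> (K #>\<^bsub>?F\<^esub> x) = K #>\<^bsub>?F\<^esub> \<phi> x" if "x \<in> carrier ?F" for x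
  proof (rule free_group_hom_eqI[OF p.H.group_axioms _ _ _ that])
    show "(\<lambda>x. \<Phi> (K #>\<^bsub>?F\<^esub> x)) \<in> hom ?F (?F Mod K)"
      using hom_compose[OF p.homh \<Phi>] by (simp add: o_def)
    show "(\<lambda>x. K #>\<^bsub>?F\<^esub> \<phi> x) \<in> hom ?F (?F Mod K)"
      using hom_compose[OF \<phi> p.homh] by (simp add: o_def)
    show "\<Phi> (K #>\<^bsub>?F\<^esub> [(i, True)]) = K #>\<^bsub>?F\<^esub> \<phi> [(i, True)]" if "i < r" for i
      using g[OF that] word_eval_generator[OF F.group_axioms, of g i] by (simp add: \<phi>_def)
  qed
  then show ?thesis using \<phi> by blast
qed

section \<open>Abelianization and eigenvalues\<close>

context free_group_endo
begin

text \<open>Leading forms of degree 1 are well defined on the abelianization, which turns an abstract basis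
  into an invertible integer matrix.\<close>

abbreviation nilp :: "letter list set monoid" where
  "nilp \<equiv> free_nilpotent r c"

abbreviation nilp_proj :: "letter list \<Rightarrow> letter list set" where
  "nilp_proj x \<equiv> lower_central (free_group r) (c + 1) #>\<^bsub>free_group r\<^esub> x"

abbreviation nilp_ab :: "letter list set set monoid" where
  "nilp_ab \<equiv> nilp Mod lower_central nilp 2"

definition ab_proj :: "letter list \<Rightarrow> letter list set set" where
  "ab_proj x = lower_central nilp 2 #>\<^bsub>nilp\<^esub> nilp_proj x"

lemma nilp_proj_hom: "group_hom (free_group r) nilp (\<lambda>x. nilp_proj x)"
  unfolding free_nilpotent_def by (rule F.r_coset_group_hom[OF F.lower_central_normal])

sublocale p: group_hom "free_group r" nilp "\<lambda>x. nilp_proj x"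
  by (rule nilp_proj_hom)

lemma nilp_proj_image: "(\<lambda>x. nilp_proj x) ` carrier (free_group r) = carrier nilp"
  by (auto simp: free_nilpotent_def FactGroup_def RCOSETS_def simp del: free_group_simps)

lemma ab_proj_hom: "group_hom (free_group r) nilp_ab ab_proj"
proof -
  have q: "group_hom nilp nilp_ab ((#>\<^bsub>nilp\<^esub>) (lower_central nilp 2))"
    by (rule p.H.r_coset_group_hom[OF p.H.lower_central_normal])
  have "ab_proj = (#>\<^bsub>nilp\<^esub>) (lower_central nilp 2) \<circ> (\<lambda>x. nilp_proj x)" by (rule ext) (simp add: ab_proj_def)
  then have "ab_proj \<in> hom (free_group r) nilp_ab"
    using hom_compose[OF p.homh group_hom.homh[OF q]] by simp
  then show ?thesis using q by (simp add: group_hom_def group_hom_axioms_def F.group_axioms)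
qed

sublocale E: group_hom "free_group r" nilp_ab ab_proj
  by (rule ab_proj_hom)

lemma ab_proj_image: "ab_proj ` carrier (free_group r) = carrier nilp_ab"
proof -
  have "carrier nilp_ab = (\<lambda>X. lower_central nilp 2 #>\<^bsub>nilp\<^esub> X) ` carrier nilp"
    by (auto simp: FactGroup_def RCOSETS_def)
  then show ?thesis by (simp only: nilp_proj_image[symmetric] image_image ab_proj_def[abs_def])
qed

text \<open>Used to lift membership in \<open>\<gamma>_2\<close> of the nilpotent quotient back to
  the free group.\<close>

lemma lower_central_nilp_2: "lower_central nilp 2 \<subseteq> (\<lambda>x. nilp_proj x) ` lower_central (free_group r) 2"
proof -
  have 2: "2 = Suc (Suc 0)" by simp
  have "subgroup ((\<lambda>x. nilp_proj x) ` lower_central (free_group r) 2) nilp"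
    by (rule p.subgroup_img_is_subgroup[OF F.lower_central_subgroup])
  moreover have "{commutator nilp h k |h k. h \<in> lower_central nilp (Suc 0) \<and> k \<in> carrier nilp}
      \<subseteq> (\<lambda>x. nilp_proj x) ` lower_central (free_group r) 2"
  proof clarify
    fix h k assume "h \<in> lower_central nilp (Suc 0)" "k \<in> carrier nilp"
    then have "h \<in> (\<lambda>x. nilp_proj x) ` carrier (free_group r)" "k \<in> (\<lambda>x. nilp_proj x) ` carrier (free_group r)"
      unfolding nilp_proj_image by simp_all
    then obtain a b where ab: "a \<in> carrier (free_group r)" "b \<in> carrier (free_group r)" "h = nilp_proj a" "k = nilp_proj b"
      by blast
    have "commutator (free_group r) a b \<in> lower_central (free_group r) 2"
      using F.commutator_lower_central_carrier[of 1 a b] ab(1,2) unfolding 2 by (simp del: free_group_simps lower_central.simps(3))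
    then show "commutator nilp h k \<in> (\<lambda>x. nilp_proj x) ` lower_central (free_group r) 2"
      unfolding ab(3,4) p.hom_commutator[OF ab(1,2), symmetric] by blast
  qed
  ultimately show ?thesis
    unfolding 2 lower_central_Suc_Suc[of nilp 0] by (intro p.H.generate_subgroup_incl)
qed

lemma ab_proj_lead_part:
  assumes x: "x \<in> carrier (free_group r)" and y: "y \<in> carrier (free_group r)" and eq: "ab_proj x = ab_proj y"
  shows "lead_part 1 x = lead_part 1 y"
proof -
  let ?F = "free_group r"
  define u where "u = x \<otimes>\<^bsub>?F\<^esub> inv\<^bsub>?F\<^esub> y"
  have u: "u \<in> carrier ?F" unfolding u_def by (rule F.m_closed[OF x F.inv_closed[OF y]])
  have "nilp_proj x \<otimes>\<^bsub>nilp\<^esub> inv\<^bsub>nilp\<^esub> nilp_proj y \<in> lower_central nilp 2"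
    using eq p.H.r_coset_eq_iff[OF p.H.lower_central_normal p.hom_closed[OF x] p.hom_closed[OF y], of 2] unfolding ab_proj_def by blast
  then have "nilp_proj u \<in> lower_central nilp 2"
    unfolding u_def p.hom_mult[OF x F.inv_closed[OF y]] p.hom_inv[OF y] .
  then obtain w where w: "w \<in> lower_central ?F 2" "nilp_proj u = nilp_proj w" using lower_central_nilp_2 by blast
  have wc: "w \<in> carrier ?F" by (rule F.lower_central_carrier[OF w(1)])
  have "u \<otimes>\<^bsub>?F\<^esub> inv\<^bsub>?F\<^esub> w \<in> lower_central ?F (c + 1)"
    using w(2) F.r_coset_eq_iff[OF F.lower_central_normal u wc] by blast
  \<comment> \<open>As \<open>c \<ge> 1\<close>, the kernel of the projection to the nilpotent
    quotient is contained in \<open>\<gamma>_2\<close>.\<close>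
  moreover have "lower_central ?F (c + 1) \<subseteq> lower_central ?F 2"
    by (rule F.lower_central_antimono) (use c_pos in simp)
  ultimately have "u \<otimes>\<^bsub>?F\<^esub> inv\<^bsub>?F\<^esub> w \<otimes>\<^bsub>?F\<^esub> w \<in> lower_central ?F 2"
    using subgroup.m_closed[OF F.lower_central_subgroup _ w(1)] by blast
  moreover have "u \<otimes>\<^bsub>?F\<^esub> inv\<^bsub>?F\<^esub> w \<otimes>\<^bsub>?F\<^esub> w = u" using u wc by (simp add: F.m_assoc del: free_group_simps)
  ultimately have "dim_ge 2 u" using lower_central_dim_ge[of 2 u r] by simp
  then have "lead_part 1 u = 0" by (rule lead_part_eq_0) simp
  moreover have "lead_part 1 u = lead_part 1 x - lead_part 1 y"
    using dim_ge_mult(2)[OF _ dim_ge_1 dim_ge_1, of x "inv\<^bsub>?F\<^esub> y"] dim_ge_inv(2)[OF _ dim_ge_1 y] by (simp add: u_def)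
  ultimately show ?thesis by simp
qed

lemma nilp_ab_comm: "comm_group nilp_ab"
proof (rule E.H.group_comm_groupI)
  fix X Y assume "X \<in> carrier nilp_ab" "Y \<in> carrier nilp_ab"
  then obtain a b where ab: "a \<in> carrier (free_group r)" "b \<in> carrier (free_group r)" "X = ab_proj a" "Y = ab_proj b"
    unfolding ab_proj_image[symmetric] by blast
  have "commutator nilp (nilp_proj a) (nilp_proj b) \<in> lower_central nilp 2"
    using p.H.commutator_lower_central_carrier[of 1 "nilp_proj a" "nilp_proj b"] p.hom_closed ab(1,2)
    by (simp del: free_group_simps lower_central.simps(3) add: numeral_2_eq_2)
  then have "ab_proj (commutator (free_group r) a b) = \<one>\<^bsub>nilp_ab\<^esub>"
    unfolding ab_proj_def p.hom_commutator[OF ab(1,2)]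
    using p.H.r_coset_eq_one_iff[OF p.H.lower_central_normal p.H.commutator_closed[OF p.hom_closed[OF ab(1)] p.hom_closed[OF ab(2)]]] by blast
  then show "X \<otimes>\<^bsub>nilp_ab\<^esub> Y = Y \<otimes>\<^bsub>nilp_ab\<^esub> X"
    unfolding E.hom_commutator[OF ab(1,2)] ab(3,4)
    using E.H.commutator_eq_one_iff[OF E.hom_closed[OF ab(1)] E.hom_closed[OF ab(2)]] by blast
qed

text \<open>Products in the abelianization carry no order, so a preimage \<open>w\<close> is only
  asserted to exist; by \<open>ab_proj_lead_part\<close> its leading form does not depend on the
  choice.\<close>

lemma finprod_lead_part:
  fixes k :: "nat \<Rightarrow> int"
  assumes "finite S" "\<And>i. i \<in> S \<Longrightarrow> g i \<in> carrier (free_group r)"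
  shows "\<exists>w\<in>carrier (free_group r). (\<Otimes>\<^bsub>nilp_ab\<^esub>i\<in>S. ab_proj (g i) [^]\<^bsub>nilp_ab\<^esub> k i) = ab_proj w \<and>
    lead_part 1 w = (\<Sum>i\<in>S. scale (k i) (lead_part 1 (g i)))"
  using assms
proof (induction S rule: finite_induct)
  case empty
  interpret A: comm_group nilp_ab by (rule nilp_ab_comm)
  show ?case
    by (rule bexI[of _ "\<one>\<^bsub>free_group r\<^esub>"]) (use E.hom_one in simp_all)
next
  case (insert j S)
  interpret A: comm_group nilp_ab by (rule nilp_ab_comm)
  obtain w where w: "w \<in> carrier (free_group r)" "(\<Otimes>\<^bsub>nilp_ab\<^esub>i\<in>S. ab_proj (g i) [^]\<^bsub>nilp_ab\<^esub> k i) = ab_proj w"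
    "lead_part 1 w = (\<Sum>i\<in>S. scale (k i) (lead_part 1 (g i)))"
    using insert.IH insert.prems by blast
  have gj: "g j \<in> carrier (free_group r)" using insert.prems by blast
  have pow: "g j [^]\<^bsub>free_group r\<^esub> k j \<in> carrier (free_group r)" by (rule F.int_pow_closed[OF gj])
  have "(\<lambda>i. ab_proj (g i) [^]\<^bsub>nilp_ab\<^esub> k i) \<in> S \<rightarrow> carrier nilp_ab"
    using insert.prems E.hom_closed E.H.int_pow_closed by blast
  then have "(\<Otimes>\<^bsub>nilp_ab\<^esub>i\<in>insert j S. ab_proj (g i) [^]\<^bsub>nilp_ab\<^esub> k i) =
      ab_proj (g j) [^]\<^bsub>nilp_ab\<^esub> k j \<otimes>\<^bsub>nilp_ab\<^esub> ab_proj w"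
    unfolding w(2)[symmetric] using insert.hyps E.H.int_pow_closed[OF E.hom_closed[OF gj]]
    by (intro A.finprod_insert)
  also have "\<dots> = ab_proj (g j [^]\<^bsub>free_group r\<^esub> k j \<otimes>\<^bsub>free_group r\<^esub> w)"
    unfolding E.hom_mult[OF pow w(1)] E.hom_int_pow[OF gj] ..
  finally have 1: "(\<Otimes>\<^bsub>nilp_ab\<^esub>i\<in>insert j S. ab_proj (g i) [^]\<^bsub>nilp_ab\<^esub> k i) =
      ab_proj (g j [^]\<^bsub>free_group r\<^esub> k j \<otimes>\<^bsub>free_group r\<^esub> w)" .
  have "lead_part 1 (g j [^]\<^bsub>free_group r\<^esub> k j \<otimes>\<^bsub>free_group r\<^esub> w) = scale (k j) (lead_part 1 (g j)) + lead_part 1 w"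
    using dim_ge_mult(2)[OF _ dim_ge_1 dim_ge_1, of "g j [^]\<^bsub>free_group r\<^esub> k j" w]
      dim_ge_int_pow[OF _ dim_ge_1 gj, of "k j"] by simp
  then have 2: "lead_part 1 (g j [^]\<^bsub>free_group r\<^esub> k j \<otimes>\<^bsub>free_group r\<^esub> w) = (\<Sum>i\<in>insert j S. scale (k i) (lead_part 1 (g i)))"
    using insert.hyps w(3) by simp
  show ?case using 1 2 F.m_closed[OF pow w(1)] by blast
qed

lemma induced_map_ab_proj:
  assumes \<Phi>: "\<Phi> \<in> hom nilp nilp" "\<And>x. x \<in> carrier (free_group r) \<Longrightarrow> \<Phi> (nilp_proj x) = nilp_proj (\<phi> x)"
    and x: "x \<in> carrier (free_group r)"
  shows "induced_map nilp (lower_central nilp 2) \<Phi> (ab_proj x) = ab_proj (\<phi> x)"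
proof -
  let ?H = "lower_central nilp 2"
  have H: "?H \<lhd> nilp" by (rule p.H.lower_central_normal)
  interpret \<Phi>: group_hom nilp nilp \<Phi> using \<Phi>(1) p.H.group_axioms by (simp add: group_hom_def group_hom_axioms_def)
  have px: "nilp_proj x \<in> carrier nilp" by (rule p.hom_closed[OF x])
  have "?H #>\<^bsub>nilp\<^esub> \<Phi> (h \<otimes>\<^bsub>nilp\<^esub> nilp_proj x) = ?H #>\<^bsub>nilp\<^esub> \<Phi> (nilp_proj x)" if h: "h \<in> ?H" for h
  proof -
    have hc: "h \<in> carrier nilp" by (rule p.H.lower_central_carrier[OF h])
    have "\<Phi> h \<in> ?H" by (rule \<Phi>.hom_lower_central[OF h])
    moreover have "\<Phi> (h \<otimes>\<^bsub>nilp\<^esub> nilp_proj x) \<otimes>\<^bsub>nilp\<^esub> inv\<^bsub>nilp\<^esub> \<Phi> (nilp_proj x) = \<Phi> h"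
      unfolding \<Phi>.hom_mult[OF hc px] using \<Phi>.hom_closed[OF hc] \<Phi>.hom_closed[OF px] by (simp add: p.H.m_assoc)
    ultimately show ?thesis
      using p.H.r_coset_eq_iff[OF H \<Phi>.hom_closed[OF p.H.m_closed[OF hc px]] \<Phi>.hom_closed[OF px]] by simp
  qed
  moreover have "ab_proj x = (\<lambda>h. h \<otimes>\<^bsub>nilp\<^esub> nilp_proj x) ` ?H" by (auto simp: ab_proj_def r_coset_def)
  moreover have "?H \<noteq> {}" using subgroup.one_closed[OF p.H.lower_central_subgroup] by blast
  ultimately have "induced_map nilp ?H \<Phi> (ab_proj x) = ?H #>\<^bsub>nilp\<^esub> \<Phi> (nilp_proj x)"
    by (simp add: induced_map_def)
  then show ?thesis unfolding \<Phi>(2)[OF x] ab_proj_def[of "\<phi> x"] .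
qed

text \<open>\<open>has_eigenvalues\<close> provides a matrix \<open>M\<close> in an arbitrary basis.
  The linear parts of representatives of that basis form a matrix \<open>Q\<close> with
  \<open>ab_mat * Q = Q * M\<close>, and expanding the free generators in the basis gives an inverse
  of \<open>Q\<close>.\<close>

lemma char_poly_ab_mat:
  assumes \<Phi>: "\<Phi> \<in> hom nilp nilp" "\<And>x. x \<in> carrier (free_group r) \<Longrightarrow> \<Phi> (nilp_proj x) = nilp_proj (\<phi> x)"
    and ev: "has_eigenvalues nilp_ab r (induced_map nilp (lower_central nilp 2) \<Phi>) ev"
  shows "char_poly (map_mat complex_of_int ab_mat) = (\<Prod>i<r. [:- ev i, 1:])"
proof -
  let ?F = "free_group r"
  from ev obtain b M where b: "int_basis nilp_ab r b"
    and M: "represents nilp_ab r b (induced_map nilp (lower_central nilp 2) \<Phi>) M"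
    and cp: "char_poly (map_mat complex_of_int M) = (\<Prod>i<r. [:- ev i, 1:])"
    unfolding has_eigenvalues_def by blast
  have Mc: "M \<in> carrier_mat r r" using M by (simp add: represents_def)
  interpret A: comm_group nilp_ab by (rule nilp_ab_comm)
  have "\<exists>g. g \<in> carrier ?F \<and> b j = ab_proj g" if "j < r" for j
  proof -
    have "b j \<in> ab_proj ` carrier ?F" using b that unfolding int_basis_def ab_proj_image by blast
    then show ?thesis by blast
  qed
  then obtain g where g: "\<And>j. j < r \<Longrightarrow> g j \<in> carrier ?F" "\<And>j. j < r \<Longrightarrow> b j = ab_proj (g j)" by metis
  have expand: "lead_part 1 x = (\<Sum>i<r. scale (k i) (lead_part 1 (g i)))"
    if x: "x \<in> carrier ?F" and eq: "ab_proj x = (\<Otimes>\<^bsub>nilp_ab\<^esub>i\<in>{..<r}. b i [^]\<^bsub>nilp_ab\<^esub> k i)" for x and k :: "nat \<Rightarrow> int"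
  proof -
    have "(\<Otimes>\<^bsub>nilp_ab\<^esub>i\<in>{..<r}. b i [^]\<^bsub>nilp_ab\<^esub> k i) = (\<Otimes>\<^bsub>nilp_ab\<^esub>i\<in>{..<r}. ab_proj (g i) [^]\<^bsub>nilp_ab\<^esub> k i)"
      by (rule A.finprod_cong') (use g(2) E.H.int_pow_closed[OF E.hom_closed[OF g(1)]] in auto)
    moreover obtain w where w: "w \<in> carrier ?F" "(\<Otimes>\<^bsub>nilp_ab\<^esub>i\<in>{..<r}. ab_proj (g i) [^]\<^bsub>nilp_ab\<^esub> k i) = ab_proj w"
      "lead_part 1 w = (\<Sum>i<r. scale (k i) (lead_part 1 (g i)))"
      using finprod_lead_part[of "{..<r}" g k] g(1) by auto
    ultimately have "ab_proj x = ab_proj w" using eq by simp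
    then show ?thesis using ab_proj_lead_part[OF x w(1)] w(3) by simp
  qed
  define Q where "Q = mat r r (\<lambda>(m, j). coef (lead_part 1 (g j)) [m])"
  have Qc: "Q \<in> carrier_mat r r" by (simp add: Q_def)
  have MQ: "ab_mat * Q = Q * M"
  proof (rule eq_matI)
    fix m j assume "m < dim_row (Q * M)" "j < dim_col (Q * M)"
    then have mj: "m < r" "j < r" using Qc Mc by auto
    have "ab_proj (\<phi> (g j)) = induced_map nilp (lower_central nilp 2) \<Phi> (b j)"
      unfolding g(2)[OF mj(2)] by (rule induced_map_ab_proj[OF \<Phi> g(1)[OF mj(2)], symmetric])
    also have "\<dots> = (\<Otimes>\<^bsub>nilp_ab\<^esub>i\<in>{..<r}. b i [^]\<^bsub>nilp_ab\<^esub> (M $$ (i, j)))"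
      using M mj(2) by (simp add: represents_def)
    finally have "ab_proj (\<phi> (g j)) = (\<Otimes>\<^bsub>nilp_ab\<^esub>i\<in>{..<r}. b i [^]\<^bsub>nilp_ab\<^esub> (M $$ (i, j)))" .
    then have "lead_part 1 (\<phi> (g j)) = (\<Sum>i<r. scale (M $$ (i, j)) (lead_part 1 (g i)))"
      by (rule expand[OF \<phi>.hom_closed[OF g(1)[OF mj(2)]]])
    then have "act ab_mat (lead_part 1 (g j)) = (\<Sum>i<r. scale (M $$ (i, j)) (lead_part 1 (g i)))"
      unfolding lead_part_endo_1[OF g(1)[OF mj(2)]] .
    then have "coef (act ab_mat (lead_part 1 (g j))) [m] = coef (\<Sum>i<r. scale (M $$ (i, j)) (lead_part 1 (g i))) [m]"
      by simp
    then have "(\<Sum>l<r. ab_mat $$ (m, l) * coef (lead_part 1 (g j)) [l]) = (\<Sum>i<r. M $$ (i, j) * coef (lead_part 1 (g i)) [m])"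
      using mj ab_mat_carrier by simp
    then show "(ab_mat * Q) $$ (m, j) = (Q * M) $$ (m, j)"
      using mj unfolding index_mult_mat_sum[OF ab_mat_carrier Qc mj] index_mult_mat_sum[OF Qc Mc mj]
      by (simp add: Q_def mult.commute)
  qed (use Qc Mc ab_mat_carrier in \<open>auto simp del: ab_mat_carrier\<close>)
  have "\<forall>j\<in>{..<r}. \<exists>k. ab_proj [(j, True)] = (\<Otimes>\<^bsub>nilp_ab\<^esub>i\<in>{..<r}. b i [^]\<^bsub>nilp_ab\<^esub> (k i :: int))"
  proof
    fix j assume "j \<in> {..<r}"
    then have "j < r" by simp
    have "ab_proj [(j, True)] \<in> carrier nilp_ab" by (rule E.hom_closed[OF generator_carrier[OF \<open>j < r\<close>]])
    with b have "\<exists>!k. k \<in> {..<r} \<rightarrow>\<^sub>E (UNIV :: int set) \<and>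
        ab_proj [(j, True)] = (\<Otimes>\<^bsub>nilp_ab\<^esub>i\<in>{..<r}. b i [^]\<^bsub>nilp_ab\<^esub> k i)"
      unfolding int_basis_def by (elim conjE) (rule bspec)
    then show "\<exists>k. ab_proj [(j, True)] = (\<Otimes>\<^bsub>nilp_ab\<^esub>i\<in>{..<r}. b i [^]\<^bsub>nilp_ab\<^esub> (k i :: int))"
      by (elim ex1E conjE) (rule exI)
  qed
  from bchoice[OF this] obtain k
    where k: "\<And>j. j < r \<Longrightarrow> ab_proj [(j, True)] = (\<Otimes>\<^bsub>nilp_ab\<^esub>i\<in>{..<r}. b i [^]\<^bsub>nilp_ab\<^esub> (k j i :: int))"
    by blast
  define W where "W = mat r r (\<lambda>(i, j). k j i)"
  have Wc: "W \<in> carrier_mat r r" by (simp add: W_def)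
  have QW: "Q * W = 1\<^sub>m r"
  proof (rule eq_matI)
    fix m j assume "m < dim_row (1\<^sub>m r :: int mat)" "j < dim_col (1\<^sub>m r :: int mat)"
    then have mj: "m < r" "j < r" by auto
    have "letter_series j = (\<Sum>i<r. scale (k j i) (lead_part 1 (g i)))"
      using expand[OF generator_carrier[OF mj(2)] k[OF mj(2)]] unfolding lead_part_generator by simp
    then have "coef (letter_series j) [m] = coef (\<Sum>i<r. scale (k j i) (lead_part 1 (g i))) [m]" by simp
    then have "(\<Sum>i<r. k j i * coef (lead_part 1 (g i)) [m]) = (if m = j then 1 else 0)"
      by (simp add: coef_letter_series)
    then show "(Q * W) $$ (m, j) = 1\<^sub>m r $$ (m, j)"
      using mj unfolding index_mult_mat_sum[OF Qc Wc mj] by (simp add: Q_def W_def mult.commute)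
  qed (use Qc Wc in auto)
  let ?c = "map_mat complex_of_int"
  have c: "?c Q \<in> carrier_mat r r" "?c W \<in> carrier_mat r r" "?c M \<in> carrier_mat r r" "?c ab_mat \<in> carrier_mat r r"
    using Qc Wc Mc by auto
  have QWc: "?c Q * ?c W = 1\<^sub>m r"
    using of_int_hom.mat_hom_mult[OF Qc Wc, where 'a = complex] QW by (simp add: of_int_hom.mat_hom_one)
  \<comment> \<open>Only the right inverse was constructed; for square matrices over a field it is
    two-sided.\<close>
  have WQc: "?c W * ?c Q = 1\<^sub>m r" by (rule mat_mult_left_right_inverse[OF c(1,2) QWc])
  have "?c ab_mat * ?c Q = ?c Q * ?c M"
    using arg_cong[OF MQ, of ?c] of_int_hom.mat_hom_mult[OF ab_mat_carrier Qc, where 'a = complex]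
      of_int_hom.mat_hom_mult[OF Qc Mc, where 'a = complex] by simp
  then have "?c ab_mat * ?c Q * ?c W = ?c Q * ?c M * ?c W" by simp
  moreover have "?c ab_mat * ?c Q * ?c W = ?c ab_mat"
    using assoc_mult_mat[OF c(4,1,2)] right_mult_one_mat[OF c(4)] unfolding QWc by simp
  ultimately have "similar_mat (?c ab_mat) (?c M)"
    by (intro similar_matI[OF _ QWc WQc]) (use c in auto)
  then show ?thesis using char_poly_similar cp by metis
qed

end

theorem theorem2p8:
  fixes r c :: nat
  assumes "r \<ge> 2" and "c \<ge> 2"
  shows "\<exists>f :: nat \<Rightarrow> int_mpoly.
    (\<forall>k\<in>{1..c}. f k \<in> symmetric_mpolys r) \<and>
    (\<forall>\<phi>\<in>hom (free_nilpotent r c) (free_nilpotent r c). \<forall>ev :: nat \<Rightarrow> complex.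
       has_eigenvalues (free_nilpotent r c Mod lower_central (free_nilpotent r c) 2) r
         (induced_map (free_nilpotent r c) (lower_central (free_nilpotent r c) 2) \<phi>) ev \<longrightarrow>
       (\<exists>n :: int. of_int n = (\<Prod>k=1..c. mpoly_eval ev (f k)) \<and>
          reidemeister_number (free_nilpotent r c) \<phi> = abs_inf n))"
proof -
  have "\<exists>hs. elim c (Leaf ` {..<r}) hs"
    by (rule elim_exists[where r = r]) (use assms(2) in auto)
  then obtain hs where hs: "elim c (Leaf ` {..<r}) hs" by blast
  \<comment> \<open>The elimination, and with it the polynomials, is fixed before the endomorphism
    is chosen.\<close>
  interpret hall_basis r c hs using hs assms(2) by unfold_locales auto
  show ?thesis
  proof (intro exI[of _ lie_char] conjI ballI allI impI)
    show "lie_char k \<in> symmetric_mpolys r" if "k \<in> {1..c}" for k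
      by (rule lie_char_symmetric) (use that in simp)
    fix \<Phi> ev
    assume \<Phi>: "\<Phi> \<in> hom (free_nilpotent r c) (free_nilpotent r c)"
      and ev: "has_eigenvalues (free_nilpotent r c Mod lower_central (free_nilpotent r c) 2) r
         (induced_map (free_nilpotent r c) (lower_central (free_nilpotent r c) 2) \<Phi>) ev"
    let ?F = "free_group r" and ?K = "lower_central (free_group r) (c + 1)"
    interpret F: group ?F by (rule free_group_is_group)
    obtain \<phi> where lift: "\<phi> \<in> hom ?F ?F" "\<And>x. x \<in> carrier ?F \<Longrightarrow> \<Phi> (?K #>\<^bsub>?F\<^esub> x) = ?K #>\<^bsub>?F\<^esub> \<phi> x"
      using free_group_lift[OF F.lower_central_normal \<Phi>[unfolded free_nilpotent_def]] by blast
    interpret free_group_endo r c hs \<phi> by unfold_locales (rule lift(1))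
    define n where "n = (\<Prod>k=1..c. det (1\<^sub>m (length (basis k)) - lie_mat k ab_mat))"
    have cp: "char_poly (map_mat complex_of_int ab_mat) = (\<Prod>i<r. [:- ev i, 1:])"
      by (rule char_poly_ab_mat[OF \<Phi> lift(2) ev])
    have "of_int n = (\<Prod>k=1..c. mpoly_eval ev (lie_char k))"
      unfolding n_def of_int_prod
      by (rule prod.cong) (simp_all add: det_lie_mat_eigenvalues[OF ab_mat_carrier _ cp] mpoly_eval_lie_char)
    moreover have "reidemeister_number (free_nilpotent r c) \<Phi> = abs_inf n"
      unfolding free_nilpotent_def n_def card_inf_twisted_free[symmetric]
    proof (rule F.reidemeister_number_quotient[OF F.lower_central_normal lift])
      \<comment> \<open>The kernel of the projection is \<open>\<gamma>_{c+1}\<close>, which is step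
        \<open>c\<close> of the shifted filtration.\<close>
      show "filt.twisted c = {(x, y). x \<in> carrier ?F \<and> y \<in> carrier ?F \<and>
          (\<exists>z\<in>carrier ?F. \<exists>n\<in>?K. x = z \<otimes>\<^bsub>?F\<^esub> y \<otimes>\<^bsub>?F\<^esub> inv\<^bsub>?F\<^esub> (\<phi> z) \<otimes>\<^bsub>?F\<^esub> n)}"
        unfolding filt.twisted_def unfolding Suc_eq_plus1 ..
      show "equiv (carrier ?F) (filt.twisted c)" by (rule filt.twisted_equiv) simp
    qed
    ultimately show "\<exists>n :: int. of_int n = (\<Prod>k=1..c. mpoly_eval ev (lie_char k)) \<and>
        reidemeister_number (free_nilpotent r c) \<Phi> = abs_inf n" by blast
  qed
qed

end
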